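(* Let $\mathbb{K}$ be an algebraically closed field of characteristic $p\geq 0$, let $G$ be a group of order $n$, and assume $p=0$ or $p>n$. Let $\Lambda=(\Lambda_1,\Lambda_2,\Lambda_3)$ be a light dual multinet in $\mathrm{PG}(2,\mathbb{K})$ labeled by $G$. If $\Lambda$ has a line of length at least $9$, then exactly one of the following holds: (i) $\Lambda_1\cup\Lambda_2\cup\Lambda_3$ is contained in a line; (ii) $\Lambda$ has a line of length $3$; (iii) $\Lambda$ is either triangular, or of tetrahedron type, or of conic-line type.
   Context: $\mathrm{PG}(2,\mathbb{K})$ is the projective plane over $\mathbb{K}$. For a finite quasigroup $(Q,\cdot)$ (e.g. a group), a dual multinet labeled by $Q$ is a triple $(\alpha_1,\alpha_2,\alpha_3)$ of maps $Q\to \mathrm{PG}(2,\mathbb{K})$ such that for all $x,y\in Q$ the points $\alpha_1(x),\alpha_2(y),\alpha_3(x\cdot y)$ are collinear; the components $\Lambda_i=\alpha_i(Q)$ are assumed pairwise disjoint and one writes $\Lambda=(\Lambda_1,\Lambda_2,\Lambda_3)$. It is light if every $\alpha_i$ is injective. A line belongs to $\Lambda$ if it meets all three components; for such a line $m$ the numbers $|m\cap\Lambda_i|$, $i=1,2,3$, are equal, and this common value is the length of $m$. $\Lambda$ is triangular (of triangle type) if $\Lambda_1\cup\Lambda_2\cup\Lambda_3$ lies on a cubic curve splitting into three non-concurrent lines; of conic-line type if it lies on a cubic curve splitting into an irreducible conic and a line; of tetrahedron type if $\Lambda_1\cup\Lambda_2\cup\Lambda_3\subseteq m_0\cup m_1\cup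 m_2\cup m_3$ for lines $m_0,m_1,m_2,m_3$ where $m_1,m_2,m_3$ are distinct and pass through a common point not on $m_0$.
   Formalization: Case (iii) is read as "not contained in a line, and triangular, of tetrahedron type or of conic-line type": by the literal definitions every multinet contained in a line also satisfies (iii), so "exactly one" would fail for collinear multinets. *)

theory Defs
  imports
    "HOL-Analysis.Analysis"
    "HOL-Library.Poly_Mapping"
    "HOL-Algebra.Group"
begin

section \<open>The projective plane over a field\<close>

text \<open>A point is a one-dimensional subspace of \<open>K\<^sup>3\<close>; a line is represented by the set of its points.\<close>

definition PG2 :: "('k::field ^ 3) set set" where
  "PG2 = {P. vec.subspace P \<and> vec.dim P = 1}"

definition PG2_lines :: "('k::field ^ 3) set set set" where
  "PG2_lines = {{P \<in> PG2. P \<subseteq> W} | W. vec.subspace W \<and> vec.dim W = 2}"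

definition collinear_points :: "('k::field ^ 3) set set \<Rightarrow> bool" where
  "collinear_points S \<longleftrightarrow> (\<exists>m\<in>PG2_lines. S \<subseteq> m)"


section \<open>Plane algebraic curves\<close>

text \<open>Polynomials in three variables indexed by the three-element type \<open>3\<close>: a monomial is its
  finitely supported exponent vector, and a polynomial is a finitely supported map from monomials
  to coefficients, with the convolution product of \<^theory>\<open>HOL-Library.Poly_Mapping\<close>.\<close>

type_synonym 'k poly3 = "(3 \<Rightarrow>\<^sub>0 nat) \<Rightarrow>\<^sub>0 'k"

definition eval3 :: "'k::field poly3 \<Rightarrow> 'k ^ 3 \<Rightarrow> 'k" where
  "eval3 F v = (\<Sum>e\<in>Poly_Mapping.keys F.
     Poly_Mapping.lookup F e * (\<Prod>i\<in>UNIV. (v $ i) ^ Poly_Mapping.lookup e i))"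

definition form3 :: "nat \<Rightarrow> 'k::field poly3 \<Rightarrow> bool" where
  "form3 d F \<longleftrightarrow>
     F \<noteq> 0 \<and> (\<forall>e\<in>Poly_Mapping.keys F. (\<Sum>i\<in>UNIV. Poly_Mapping.lookup e i) = d)"

definition curve :: "'k::field poly3 \<Rightarrow> ('k ^ 3) set set" where
  "curve F = {P \<in> PG2. \<forall>v\<in>P. eval3 F v = 0}"


section \<open>Dual multinets\<close>

text \<open>Only the carrier and the multiplication of \<open>Q\<close> are used, so the definition makes sense for
  any quasigroup \<open>Q\<close>.\<close>

definition dual_multinet ::
  "('q, 'm) monoid_scheme \<Rightarrow> ('q \<Rightarrow> ('k::field ^ 3) set) \<Rightarrow> ('q \<Rightarrow> ('k ^ 3) set) \<Rightarrow> ('q \<Rightarrow> ('k ^ 3) set) \<Rightarrow> bool"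
where
  "dual_multinet Q \<alpha>\<^sub>1 \<alpha>\<^sub>2 \<alpha>\<^sub>3 \<longleftrightarrow>
     \<alpha>\<^sub>1 ` carrier Q \<subseteq> PG2 \<and> \<alpha>\<^sub>2 ` carrier Q \<subseteq> PG2 \<and> \<alpha>\<^sub>3 ` carrier Q \<subseteq> PG2 \<and>
     (\<forall>x\<in>carrier Q. \<forall>y\<in>carrier Q. collinear_points {\<alpha>\<^sub>1 x, \<alpha>\<^sub>2 y, \<alpha>\<^sub>3 (x \<otimes>\<^bsub>Q\<^esub> y)}) \<and>
     \<alpha>\<^sub>1 ` carrier Q \<inter> \<alpha>\<^sub>2 ` carrier Q = {} \<and>
     \<alpha>\<^sub>1 ` carrier Q \<inter> \<alpha>\<^sub>3 ` carrier Q = {} \<and>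
     \<alpha>\<^sub>2 ` carrier Q \<inter> \<alpha>\<^sub>3 ` carrier Q = {}"

definition light_dual_multinet ::
  "('q, 'm) monoid_scheme \<Rightarrow> ('q \<Rightarrow> ('k::field ^ 3) set) \<Rightarrow> ('q \<Rightarrow> ('k ^ 3) set) \<Rightarrow> ('q \<Rightarrow> ('k ^ 3) set) \<Rightarrow> bool"
where
  "light_dual_multinet Q \<alpha>\<^sub>1 \<alpha>\<^sub>2 \<alpha>\<^sub>3 \<longleftrightarrow>
     dual_multinet Q \<alpha>\<^sub>1 \<alpha>\<^sub>2 \<alpha>\<^sub>3 \<and>
     inj_on \<alpha>\<^sub>1 (carrier Q) \<and> inj_on \<alpha>\<^sub>2 (carrier Q) \<and> inj_on \<alpha>\<^sub>3 (carrier Q)"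

definition line_of_multinet ::
  "('k::field ^ 3) set set \<Rightarrow> ('k ^ 3) set set \<Rightarrow> ('k ^ 3) set set \<Rightarrow> ('k ^ 3) set set \<Rightarrow> bool"
where
  "line_of_multinet \<Lambda>\<^sub>1 \<Lambda>\<^sub>2 \<Lambda>\<^sub>3 m \<longleftrightarrow>
     m \<in> PG2_lines \<and> m \<inter> \<Lambda>\<^sub>1 \<noteq> {} \<and> m \<inter> \<Lambda>\<^sub>2 \<noteq> {} \<and> m \<inter> \<Lambda>\<^sub>3 \<noteq> {}"

text \<open>The length is a relation rather than a function, so that it is the common value of the three
  cardinalities by definition.\<close>

definition line_of_length ::
  "('k::field ^ 3) set set \<Rightarrow> ('k ^ 3) set set \<Rightarrow> ('k ^ 3) set set \<Rightarrow> ('k ^ 3) set set \<Rightarrow> nat \<Rightarrow> bool"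
where
  "line_of_length \<Lambda>\<^sub>1 \<Lambda>\<^sub>2 \<Lambda>\<^sub>3 m l \<longleftrightarrow>
     line_of_multinet \<Lambda>\<^sub>1 \<Lambda>\<^sub>2 \<Lambda>\<^sub>3 m \<and>
     card (m \<inter> \<Lambda>\<^sub>1) = l \<and> card (m \<inter> \<Lambda>\<^sub>2) = l \<and> card (m \<inter> \<Lambda>\<^sub>3) = l"

text \<open>The three types are literal containment conditions on the union \<open>S\<close> of the components; in
  particular each of them holds when \<open>S\<close> is contained in a line.\<close>

definition triangular :: "('k::field ^ 3) set set \<Rightarrow> bool" where
  "triangular S \<longleftrightarrow>
     (\<exists>F L\<^sub>1 L\<^sub>2 L\<^sub>3. form3 3 F \<and> form3 1 L\<^sub>1 \<and> form3 1 L\<^sub>2 \<and> form3 1 L\<^sub>3 \<and> F = L\<^sub>1 * L\<^sub>2 * L\<^sub>3 \<and>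
        curve L\<^sub>1 \<inter> curve L\<^sub>2 \<inter> curve L\<^sub>3 = {} \<and> S \<subseteq> curve F)"

definition conic_line_type :: "('k::field ^ 3) set set \<Rightarrow> bool" where
  "conic_line_type S \<longleftrightarrow>
     (\<exists>F C L. form3 3 F \<and> form3 2 C \<and> irreducible C \<and> form3 1 L \<and> F = C * L \<and> S \<subseteq> curve F)"

definition tetrahedron_type :: "('k::field ^ 3) set set \<Rightarrow> bool" where
  "tetrahedron_type S \<longleftrightarrow>
     (\<exists>m\<^sub>0\<in>PG2_lines. \<exists>m\<^sub>1\<in>PG2_lines. \<exists>m\<^sub>2\<in>PG2_lines. \<exists>m\<^sub>3\<in>PG2_lines.
        distinct [m\<^sub>1, m\<^sub>2, m\<^sub>3] \<and> (\<exists>P. P \<in> m\<^sub>1 \<inter> m\<^sub>2 \<inter> m\<^sub>3 \<and> P \<notin> m\<^sub>0) \<and>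
        S \<subseteq> m\<^sub>0 \<union> m\<^sub>1 \<union> m\<^sub>2 \<union> m\<^sub>3)"

definition exactly_one :: "bool \<Rightarrow> bool \<Rightarrow> bool \<Rightarrow> bool" where
  "exactly_one A B C \<longleftrightarrow> (A \<or> B \<or> C) \<and> \<not> (A \<and> B) \<and> \<not> (A \<and> C) \<and> \<not> (B \<and> C)"

end

theory Submission
  imports Defs
begin

text \<open>Put the long line at infinity. After a relabeling, the indices of its points form a subgroup
  \<open>H\<close> of order \<open>h \<ge> 9\<close>, and the remaining points are affine. Each coset of \<open>H\<close> yields two families of
  affine points joined by lines in the \<open>h\<close> directions belonging to \<open>H\<close>. For fixed directions such
  pairs of families form a vector space on which \<open>H\<close> acts by translation; diagonalising this action
  shows that they are \<open>c + u \<theta> P + v \<theta>\<inverse> Q\<close> and \<open>c + u \<theta> Q + v \<theta>\<inverse> P\<close> for an injective character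
  \<open>\<theta>\<close> of \<open>H\<close>, so every coset lies on a conic or on a line.

  If \<open>H\<close> has index 2, this gives the conic-line type and the tetrahedron type. If the index is larger,
  two cosets whose points are joined through a third coset lie on parallel lines (comparison of
  coefficients of characters of \<open>H\<close>). Either \<open>H\<close> is normal of index 3, and the centroids of all cosets
  coincide, which gives a triangle; or all cosets of the same kind are parallel, and averaging over
  cosets produces a twisted cocycle on \<open>G\<close> with vanishing sum, which is impossible as the order of
  \<open>G\<close> is invertible. In each configuration a line other than the three or four special ones contains
  at most four of the points, so no line has length 3.\<close>

section \<open>Plane vectors\<close>

text \<open>The bound 9 comes from comparing two cosets through the points of a third one. At least
  half of the elements of \<open>H\<close> supply such points, so there are at least five of them,
  just more than the degree 4 of the polynomial that governs the case of equal characters. The other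
  coefficient comparisons have degree at most 6, for which seven elements are enough. The
  characteristic enters through division: by the order of a translation (so that no eigenvalue 1
  occurs), by the order of \<open>H\<close> (so that centroids exist and character sums isolate
  coefficients), and finally by the order of \<open>G\<close>. The obstacle is that \<open>G\<close>
  need not be abelian and \<open>H\<close> need not be normal. The components \<open>A2\<close> and
  \<open>A3\<close> are controlled on right cosets and \<open>A1\<close> and \<open>A3\<close> on
  left cosets, with unrelated characters and frames. Statements are therefore proved for one pair of
  components and transported by permuting the components.\<close>

definition wedge :: "'k::field ^ 2 \<Rightarrow> 'k ^ 2 \<Rightarrow> 'k" where
  "wedge u v = u $ 1 * v $ 2 - u $ 2 * v $ 1"

lemma vec2_eq_iff: "(u :: 'k ^ 2) = v \<longleftrightarrow> u $ 1 = v $ 1 \<and> u $ 2 = v $ 2"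
  by (simp add: vec_eq_iff forall_2)

lemma wedge_simps [simp]:
  "wedge u u = 0" "wedge 0 u = 0" "wedge u 0 = 0"
  "wedge (c *s u) v = c * wedge u v" "wedge u (c *s v) = c * wedge u v"
  "wedge (- u) v = - wedge u v" "wedge u (- v) = - wedge u v"
  by (simp_all add: wedge_def algebra_simps)

lemma wedge_distribs:
  "wedge (u + v) w = wedge u w + wedge v w" "wedge w (u + v) = wedge w u + wedge w v"
  "wedge (u - v) w = wedge u w - wedge v w" "wedge w (u - v) = wedge w u - wedge w v"
  by (simp_all add: wedge_def algebra_simps)

lemma wedge_swap: "wedge u v = - wedge v u"
  by (simp add: wedge_def)

lemma wedge_swap_eq_0: "wedge u v = 0 \<longleftrightarrow> wedge v u = 0"
  by (metis neg_equal_0_iff_equal wedge_swap)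

lemma wedge_sum_left: "wedge (sum f A) v = (\<Sum>x\<in>A. wedge (f x) v)"
  by (induction A rule: infinite_finite_induct) (simp_all add: wedge_distribs)

lemma wedge_expand:
  assumes "wedge P Q \<noteq> 0"
  shows "v = (wedge v Q / wedge P Q) *s P + (wedge P v / wedge P Q) *s Q"
proof -
  have "wedge P Q * v $ i = wedge v Q * P $ i + wedge P v * Q $ i" if "i = 1 \<or> i = 2" for i
    using that by (auto simp: wedge_def algebra_simps)
  from this [of 1] this [of 2] show ?thesis
    using assms by (simp add: vec2_eq_iff add_divide_distrib [symmetric] eq_divide_eq mult.commute)
qed

lemma wedge_trans:
  assumes "wedge u v = 0" "wedge v w = 0" "v \<noteq> 0"
  shows "wedge u w = 0"
proof -
  have "v $ i * wedge u w = wedge u v * w $ i + wedge v w * u $ i" if "i = 1 \<or> i = 2" for i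
    using that by (auto simp: wedge_def algebra_simps)
  then show ?thesis
    using assms by (auto simp: vec2_eq_iff)
qed

lemma wedge_zero_unique:
  assumes "wedge u v = 0" "wedge u w = 0" "wedge v w \<noteq> 0"
  shows "u = 0"
  using wedge_trans [of v u w] assms wedge_swap_eq_0 by blast

lemma wedge_parallelE:
  assumes "wedge u v = 0" "u \<noteq> 0"
  obtains c where "v = c *s u"
proof -
  consider "u $ 1 \<noteq> 0" | "u $ 2 \<noteq> 0"
    using assms(2) by (auto simp: vec2_eq_iff)
  then show thesis
  proof cases
    case 1
    then show thesis
      using assms(1) by (intro that [of "v $ 1 / u $ 1"]) (auto simp: vec2_eq_iff wedge_def field_simps)
  next
    case 2
    then show thesis
      using assms(1) by (intro that [of "v $ 2 / u $ 2"]) (auto simp: vec2_eq_iff wedge_def field_simps)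
  qed
qed

lemma wedge_basis_unique:
  assumes "wedge P Q \<noteq> 0" "a *s P + b *s Q = 0"
  shows "a = 0" "b = 0"
proof -
  have "wedge (a *s P + b *s Q) Q = 0" "wedge P (a *s P + b *s Q) = 0"
    by (simp_all only: assms(2) wedge_simps)
  then show "a = 0" "b = 0"
    using assms(1) by (simp_all add: wedge_distribs)
qed

text \<open>In coordinates along \<open>P\<close> and \<open>Q\<close> the relation becomes linear.
  Subtracting its instances for \<open>j = i1\<close> and \<open>j = i2\<close> eliminates the
  second coordinate of \<open>a i\<close> and shows that the first one is affine in
  \<open>w i\<close>; the other coordinates follow by back substitution.\<close>

lemma wedge_core:
  fixes w :: "'i \<Rightarrow> 'k::field"
  assumes w: "\<And>i. i \<in> I \<Longrightarrow> w i \<noteq> 0" and I: "i1 \<in> I" "i2 \<in> I" "w i1 \<noteq> w i2"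
    and PQ: "wedge P Q \<noteq> 0"
    and rel: "\<And>i j. i \<in> I \<Longrightarrow> j \<in> I \<Longrightarrow> wedge (b j - a i) (w j *s Q - w i *s P) = 0"
  obtains c u v where "\<And>i. i \<in> I \<Longrightarrow> a i = c + (u * w i) *s P + (v / w i) *s Q"
    "\<And>i. i \<in> I \<Longrightarrow> b i = c + (u * w i) *s Q + (v / w i) *s P"
proof -
  define a1 where "a1 = (\<lambda>i. wedge (a i) Q / wedge P Q)"
  define a2 where "a2 = (\<lambda>i. wedge P (a i) / wedge P Q)"
  define b1 where "b1 = (\<lambda>i. wedge (b i) Q / wedge P Q)"
  define b2 where "b2 = (\<lambda>i. wedge P (b i) / wedge P Q)"
  have a: "a i = a1 i *s P + a2 i *s Q" and b: "b i = b1 i *s P + b2 i *s Q" for i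
    unfolding a1_def a2_def b1_def b2_def by (rule wedge_expand [OF PQ])+
  have E: "b1 j * w j - a1 i * w j + b2 j * w i - a2 i * w i = 0" if "i \<in> I" "j \<in> I" for i j
  proof -
    have "(b1 j * w j - a1 i * w j + b2 j * w i - a2 i * w i) * wedge P Q
        = wedge (b j - a i) (w j *s Q - w i *s P)"
      unfolding a b using wedge_swap [of Q P] by (simp add: wedge_distribs algebra_simps)
    then show ?thesis using rel [OF that] PQ by simp
  qed
  define \<delta> where "\<delta> = w i1 - w i2"
  have \<delta>: "\<delta> \<noteq> 0" using I by (simp add: \<delta>_def)
  define \<alpha> where "\<alpha> = (b1 i1 * w i1 - b1 i2 * w i2) / \<delta>"
  define u where "u = (b2 i1 - b2 i2) / \<delta>"
  define v where "v = w i1 * (b1 i1 - \<alpha>)"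
  define \<gamma> where "\<gamma> = b2 i1 - u * w i1"
  have 1: "a1 i = \<alpha> + u * w i" if i: "i \<in> I" for i
  proof -
    have "a1 i * \<delta> = (b1 i1 * w i1 - b1 i2 * w i2) + (b2 i1 - b2 i2) * w i"
      using E [OF i I(1)] E [OF i I(2)] unfolding \<delta>_def by algebra
    moreover have "(\<alpha> + u * w i) * \<delta> = (b1 i1 * w i1 - b1 i2 * w i2) + (b2 i1 - b2 i2) * w i"
      using \<delta> by (simp add: \<alpha>_def u_def distrib_right)
    ultimately show ?thesis using \<delta> by (metis mult_right_cancel)
  qed
  have 2: "a2 i * w i = v + \<gamma> * w i" if i: "i \<in> I" for i
    using E [OF i I(1)] unfolding 1 [OF i] v_def \<gamma>_def by algebra
  have 3: "b2 j = \<gamma> + u * w j" if j: "j \<in> I" for j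
  proof -
    have "(b2 j - \<gamma> - u * w j) * \<delta> = 0"
      using E [OF I(1) j] E [OF I(2) j] 2 [OF I(1)] 2 [OF I(2)]
      unfolding 1 [OF I(1)] 1 [OF I(2)] \<delta>_def by algebra
    then have "b2 j - \<gamma> - u * w j = 0" using \<delta> by simp
    then show ?thesis by (simp add: algebra_simps)
  qed
  have 4: "b1 j * w j = v + \<alpha> * w j" if j: "j \<in> I" for j
    using E [OF I(1) j] 2 [OF I(1)] unfolding 1 [OF I(1)] 3 [OF j] by algebra
  show thesis
  proof (rule that [of "\<alpha> *s P + \<gamma> *s Q" u v])
    fix i assume i: "i \<in> I"
    have 5: "a2 i = v / w i + \<gamma>" "b1 i = v / w i + \<alpha>"
      using 2 [OF i] 4 [OF i] w [OF i] by (auto simp: field_simps)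
    show "a i = \<alpha> *s P + \<gamma> *s Q + (u * w i) *s P + (v / w i) *s Q"
      unfolding a 1 [OF i] 5 by (simp add: vec2_eq_iff algebra_simps)
    show "b i = \<alpha> *s P + \<gamma> *s Q + (u * w i) *s Q + (v / w i) *s P"
      unfolding b 3 [OF i] 5 by (simp add: vec2_eq_iff algebra_simps)
  qed
qed

lemma quadratic_three_roots:
  fixes w1 w2 w3 :: "'k::field"
  assumes "w1 \<noteq> w2" "w1 \<noteq> w3" "w2 \<noteq> w3"
    and "a + b * w1 + c * w1\<^sup>2 = 0" "a + b * w2 + c * w2\<^sup>2 = 0" "a + b * w3 + c * w3\<^sup>2 = 0"
  shows "a = 0" "b = 0" "c = 0"
proof -
  have "(w1 - w2) * (b + c * (w1 + w2)) = 0" "(w1 - w3) * (b + c * (w1 + w3)) = 0"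
    using assms(4-6) by algebra+
  then have e: "b + c * (w1 + w2) = 0" "b + c * (w1 + w3) = 0"
    using assms(1,2) by simp_all
  then have "c * (w2 - w3) = 0"
    by algebra
  then show c: "c = 0"
    using assms(3) by simp
  with e show b: "b = 0" by simp
  with c assms(4) show "a = 0" by simp
qed

text \<open>Multiplication by \<open>w\<close> turns each coordinate into a quadratic polynomial
  with three roots.\<close>

lemma laurent_three_points:
  fixes w1 w2 w3 :: "'k::field"
  assumes "w1 \<noteq> w2" "w1 \<noteq> w3" "w2 \<noteq> w3" "w1 \<noteq> 0" "w2 \<noteq> 0" "w3 \<noteq> 0"
    and "\<And>w. w \<in> {w1, w2, w3} \<Longrightarrow> X + w *s Y + (1 / w) *s Z = (0 :: 'k ^ 2)"
  shows "X = 0" "Y = 0" "Z = 0"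
proof -
  have *: "Z $ i + X $ i * w + Y $ i * w\<^sup>2 = 0" if "w \<in> {w1, w2, w3}" for i w
  proof -
    have "(X + w *s Y + (1 / w) *s Z) $ i = 0"
      using assms(7) [OF that] by simp
    moreover have "w \<noteq> 0" using that assms by auto
    ultimately show ?thesis by (simp add: field_simps power2_eq_square) 
  qed
  have "Z $ i = 0" "X $ i = 0" "Y $ i = 0" for i
    using quadratic_three_roots [OF assms(1-3)] * by (metis insertCI)+
  then show "X = 0" "Y = 0" "Z = 0"
    by (simp_all add: vec_eq_iff)
qed

section \<open>Nets of lines through a pencil indexed by a group\<close>

definition grp_char :: "('a, 'm) monoid_scheme \<Rightarrow> ('a \<Rightarrow> 'k::field) \<Rightarrow> bool" where
  "grp_char H \<theta> \<longleftrightarrow> (\<forall>x\<in>carrier H. \<theta> x \<noteq> 0) \<and> (\<forall>x\<in>carrier H. \<forall>y\<in>carrier H. \<theta> (x \<otimes>\<^bsub>H\<^esub> y) = \<theta> x * \<theta> y)"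

lemma (in group) grp_char_one: "grp_char G \<theta> \<Longrightarrow> \<theta> \<one> = 1"
  unfolding grp_char_def by (metis mult_cancel_left1 one_closed r_one)

lemma (in group) grp_char_inv: "grp_char G \<theta> \<Longrightarrow> x \<in> carrier G \<Longrightarrow> \<theta> (inv x) = 1 / \<theta> x"
  using grp_char_one unfolding grp_char_def
  by (metis inv_closed nonzero_eq_divide_eq l_inv)

lemma (in group) sum_translate:
  assumes "t \<in> carrier G"
  shows "(\<Sum>x\<in>carrier G. f (x \<otimes> t)) = (\<Sum>x\<in>carrier G. f x)"
    "(\<Sum>x\<in>carrier G. f (t \<otimes> x)) = (\<Sum>x\<in>carrier G. f x)"
proof -
  have "bij_betw (\<lambda>x. x \<otimes> t) (carrier G) (carrier G)"
    by (rule bij_betw_byWitness [where f' = "\<lambda>x. x \<otimes> inv t"]) (use assms in \<open>auto simp: m_assoc\<close>)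
  then show "(\<Sum>x\<in>carrier G. f (x \<otimes> t)) = (\<Sum>x\<in>carrier G. f x)"
    by (rule sum.reindex_bij_betw)
  have "bij_betw (\<lambda>x. t \<otimes> x) (carrier G) (carrier G)"
    by (rule bij_betw_byWitness [where f' = "\<lambda>x. inv t \<otimes> x"])
      (use assms in \<open>auto simp: m_assoc [symmetric]\<close>)
  then show "(\<Sum>x\<in>carrier G. f (t \<otimes> x)) = (\<Sum>x\<in>carrier G. f x)"
    by (rule sum.reindex_bij_betw)
qed

lemma (in group) sum_inv: "(\<Sum>x\<in>carrier G. f (inv x)) = (\<Sum>x\<in>carrier G. f x)"
  by (rule sum.reindex_bij_betw, rule bij_betw_byWitness [where f' = "\<lambda>x. inv x"]) auto

lemma (in group) sum_grp_char:
  assumes "grp_char G \<theta>" "t \<in> carrier G" "\<theta> t \<noteq> 1"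
  shows "(\<Sum>x\<in>carrier G. \<theta> x) = 0"
proof -
  have "(\<Sum>x\<in>carrier G. \<theta> x) = (\<Sum>x\<in>carrier G. \<theta> (x \<otimes> t))"
    using sum_translate(1) [OF assms(2)] by metis
  also have "\<dots> = (\<Sum>x\<in>carrier G. \<theta> x) * \<theta> t"
    using assms by (auto simp: grp_char_def sum_distrib_right intro!: sum.cong)
  finally show ?thesis using assms(3) by simp
qed

text \<open>The lines of direction \<open>d x\<close> join the points \<open>a y\<close> and \<open>b (x \<otimes> y)\<close>.\<close>

locale line_net = group H for H (structure) +
  fixes d :: "'a \<Rightarrow> 'k::alg_closed_field ^ 2"
  assumes fin: "finite (carrier H)" and order_ge_3: "card (carrier H) \<ge> 3"
    and char: "\<And>m. 0 < m \<Longrightarrow> m \<le> card (carrier H) \<Longrightarrow> of_nat m \<noteq> (0::'k)"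
    and nonparallel: "\<And>x y. x \<in> carrier H \<Longrightarrow> y \<in> carrier H \<Longrightarrow> x \<noteq> y \<Longrightarrow> wedge (d x) (d y) \<noteq> 0"
begin

definition sol :: "('a \<Rightarrow> 'k ^ 2) \<Rightarrow> ('a \<Rightarrow> 'k ^ 2) \<Rightarrow> bool" where
  "sol a b \<longleftrightarrow> (\<forall>x\<in>carrier H. \<forall>y\<in>carrier H. wedge (b (x \<otimes> y) - a y) (d x) = 0)"

lemma solD: "sol a b \<Longrightarrow> x \<in> carrier H \<Longrightarrow> y \<in> carrier H \<Longrightarrow> wedge (b (x \<otimes> y) - a y) (d x) = 0"
  by (simp add: sol_def)

lemma solD': 
  assumes "sol a b" "z \<in> carrier H" "y \<in> carrier H" 
  shows "wedge (b z - a y) (d (z \<otimes> inv y)) = 0"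
  using solD [OF assms(1), of "z \<otimes> inv y" y] assms by (simp add: m_assoc)

lemma sol_translate:
  assumes "sol a b" "t \<in> carrier H"
  shows "sol (\<lambda>y. a (y \<otimes> t)) (\<lambda>y. b (y \<otimes> t))"
  unfolding sol_def
proof (intro ballI)
  fix x y assume xy: "x \<in> carrier H" "y \<in> carrier H"
  then show "wedge (b (x \<otimes> y \<otimes> t) - a (y \<otimes> t)) (d x) = 0"
    using solD [OF assms(1), of x "y \<otimes> t"] assms(2) by (simp add: m_assoc)
qed

lemma sol_add: "sol a b \<Longrightarrow> sol a' b' \<Longrightarrow> sol (\<lambda>y. a y + a' y) (\<lambda>y. b y + b' y)"
  by (auto simp: sol_def add_diff_add wedge_distribs)

lemma sol_scale: "sol a b \<Longrightarrow> sol (\<lambda>y. c *s a y) (\<lambda>y. c *s b y)"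
  by (auto simp: sol_def wedge_distribs simp flip: right_diff_distrib)

lemma sol_shift: "sol a b \<Longrightarrow> sol (\<lambda>y. a y - c) (\<lambda>y. b y - c)"
  by (auto simp: sol_def)

lemma sol_sum: "(\<And>i. i \<in> I \<Longrightarrow> sol (a i) (b i)) \<Longrightarrow> sol (\<lambda>y. \<Sum>i\<in>I. a i y) (\<lambda>y. \<Sum>i\<in>I. b i y)"
  by (auto simp: sol_def wedge_sum_left simp flip: sum_subtractf intro!: sum.neutral)

section \<open>Rigidity of solutions\<close>

lemma d_nonzero: 
  assumes "x \<in> carrier H" shows "d x \<noteq> 0"
proof -
  have "card (carrier H - {x}) \<noteq> 0"
    using order_ge_3 fin assms by (simp add: card_Diff_singleton)
  then obtain y where "y \<in> carrier H" "y \<noteq> x"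
    by (metis Diff_iff card_eq_0_iff ex_in_conv insertI1)
  with nonparallel [of x y] assms show ?thesis by auto
qed

text \<open>Every \<open>b z\<close> is joined to the repeated point by lines of two different
  directions that pass through it, so it equals that point. Then each \<open>a z\<close> is joined
  to it in the directions \<open>d \<one>\<close> and \<open>d x\<close> and collapses as
  well.\<close>

lemma rigid:
  assumes s: "sol a b" and y: "y \<in> carrier H" "y' \<in> carrier H" "y \<noteq> y'" "a y = a y'"
    and z: "z \<in> carrier H"
  shows "a z = a y" "b z = a y"
proof -
  have b: "b z = a y" if z: "z \<in> carrier H" for z
  proof -
    have "wedge (b z - a y) (d (z \<otimes> inv y)) = 0" "wedge (b z - a y) (d (z \<otimes> inv y')) = 0"
      using solD' [OF s z y(1)] solD' [OF s z y(2)] y(4) by simp_all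
    moreover have "z \<otimes> inv y \<noteq> z \<otimes> inv y'"
      using y z by (metis Units_eq Units_l_cancel inv_closed inv_inv)
    ultimately have "b z - a y = 0"
      using nonparallel z y by (metis inv_closed m_closed wedge_zero_unique)
    then show ?thesis by simp
  qed
  show "b z = a y" using b z by simp
  have "card (carrier H - {\<one>}) \<noteq> 0"
    using order_ge_3 fin by (simp add: card_Diff_singleton)
  then obtain x where x: "x \<in> carrier H" "x \<noteq> \<one>"
    by (metis Diff_iff card_eq_0_iff ex_in_conv insertI1)
  have "wedge (a y - a z) (d x) = 0" "wedge (a y - a z) (d \<one>) = 0"
    using solD [OF s x(1) z] solD [OF s one_closed z] b x z by (simp_all add: m_closed)
  then have "a y - a z = 0"
    using nonparallel x by (metis one_closed wedge_zero_unique)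
  then show "a z = a y" by simp
qed

definition nonconst :: "('a \<Rightarrow> 'k ^ 2) \<Rightarrow> bool" where
  "nonconst a \<longleftrightarrow> (\<exists>y\<in>carrier H. a y \<noteq> a \<one>)"

lemma nonconst_inj:
  assumes "sol a b" "nonconst a" "y \<in> carrier H" "y' \<in> carrier H" "a y = a y'"
  shows "y = y'"
  using rigid [OF assms(1,3,4) _ assms(5)] assms(2) unfolding nonconst_def by (metis one_closed)

lemma not_nonconstD:
  assumes "sol a b" "\<not> nonconst a" "y \<in> carrier H"
  shows "a y = a \<one>" "b y = a \<one>"
proof -
  have "card (carrier H - {\<one>}) \<noteq> 0"
    using order_ge_3 fin by (simp add: card_Diff_singleton)
  then obtain x where x: "x \<in> carrier H" "x \<noteq> \<one>"
    by (metis Diff_iff card_eq_0_iff ex_in_conv insertI1)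
  have "a \<one> = a x" using x assms(2) unfolding nonconst_def by metis
  then show "a y = a \<one>" "b y = a \<one>"
    using rigid [OF assms(1) one_closed x(1) x(2) [symmetric] _ assms(3)] by blast+
qed

text \<open>If all elements were involutions, the sum of a solution and its translate by
  \<open>t\<close> would take equal values at \<open>\<one>\<close> and \<open>t\<close>, hence be
  constant. Three such identities, for \<open>t\<close>, \<open>s\<close> and their product,
  determine \<open>2 * a y\<close> independently of \<open>y\<close>. The element found provides
  three distinct indices \<open>\<one>\<close>, \<open>t\<close>,
  \<open>t \<otimes> t\<close>.\<close>

lemma exists_non_involution:
  assumes s: "sol a b" and nc: "nonconst a"
  obtains t where "t \<in> carrier H" "t \<otimes> t \<noteq> \<one>"
proof (cases "\<exists>t\<in>carrier H. t \<otimes> t \<noteq> \<one>")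
  case True
  then show ?thesis using that by blast
next
  case False
  then have inv2: "t \<otimes> t = \<one>" if "t \<in> carrier H" for t using that by blast
  have M: "a y + a (y \<otimes> t) = a \<one> + a t" if y: "y \<in> carrier H" and t: "t \<in> carrier H" "t \<noteq> \<one>" for y t
  proof -
    have s': "sol (\<lambda>y. a y + a (y \<otimes> t)) (\<lambda>y. b y + b (y \<otimes> t))"
      by (intro sol_add sol_translate s t)
    show ?thesis
      using rigid(1) [OF s' one_closed t(1) t(2) [symmetric] _ y] inv2 [OF t(1)] t by (simp add: add.commute)
  qed
  have "card (carrier H - {\<one>}) \<ge> 2"
    using order_ge_3 fin by (simp add: card_Diff_singleton)
  then obtain t where t: "t \<in> carrier H" "t \<noteq> \<one>"
    by (metis Diff_iff card.empty ex_in_conv insertI1 not_numeral_le_zero)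
  have "card (carrier H - {\<one>, t}) \<ge> 1"
    using order_ge_3 fin t by (simp add: card_Diff_subset)
  then obtain s where s': "s \<in> carrier H" "s \<noteq> \<one>" "s \<noteq> t"
    by (metis Diff_iff card.empty ex_in_conv insertI1 insertI2 not_one_le_zero)
  have ts: "t \<otimes> s \<in> carrier H" "t \<otimes> s \<noteq> \<one>"
    using s' t inv2 by (simp, metis Units_eq Units_l_cancel)
  have double: "a y + a y = a \<one> + a \<one>" if y: "y \<in> carrier H" for y
  proof -
    have "a y + a y = (a y + a (y \<otimes> (t \<otimes> s))) - (a (y \<otimes> t) + a (y \<otimes> t \<otimes> s)) + (a y + a (y \<otimes> t))"
      using y t s' by (simp add: m_assoc algebra_simps)
    also have "\<dots> = (a \<one> + a (\<one> \<otimes> (t \<otimes> s))) - (a (\<one> \<otimes> t) + a (\<one> \<otimes> t \<otimes> s)) + (a \<one> + a (\<one> \<otimes> t))"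
      using M y t s' ts by (metis l_one m_closed one_closed)
    also have "\<dots> = a \<one> + a \<one>" using s' t by simp
    finally show ?thesis .
  qed
  have two: "(2::'k) \<noteq> 0" using char [of 2] order_ge_3 by simp
  have half: "u = v" if "u + u = v + v" for u v :: "'k ^ 2"
  proof -
    have "2 * u $ i = 2 * v $ i" for i
      using arg_cong [OF that, of "\<lambda>x. x $ i"] by (simp only: mult_2 vector_add_component)
    then show ?thesis using two by (simp add: vec_eq_iff)
  qed
  have "a y = a \<one>" if "y \<in> carrier H" for y
    by (rule half [OF double [OF that]])
  then show ?thesis using nc unfolding nonconst_def by blast
qed

text \<open>The polynomial \<open>q\<close> applied to the operator of right translation by \<open>t\<close>.\<close>

definition act :: "'a \<Rightarrow> 'k poly \<Rightarrow> ('a \<Rightarrow> 'k ^ 2) \<Rightarrow> 'a \<Rightarrow> 'k ^ 2" where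
  "act t q a y = (\<Sum>i\<le>degree q. coeff q i *s a (y \<otimes> t [^] i))"

section \<open>Eigenvectors of translations\<close>

lemma act_extend: "degree q \<le> n \<Longrightarrow> act t q a y = (\<Sum>i\<le>n. coeff q i *s a (y \<otimes> t [^] i))"
  unfolding act_def by (rule sum.mono_neutral_left) (auto simp: coeff_eq_0)

lemma act_linear_factor:
  assumes "t \<in> carrier H" "y \<in> carrier H"
  shows "act t ([:- w, 1:] * s) a y = act t s a (y \<otimes> t) - w *s act t s a y"
proof -
  let ?n = "degree s"
  have q: "[:- w, 1:] * s = pCons 0 s - smult w s" by (simp add: mult_pCons_left)
  have "degree ([:- w, 1:] * s) \<le> Suc ?n"
    using degree_mult_le [of "[:- w, 1:]" s] by simp
  then have "act t ([:- w, 1:] * s) a y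
      = (\<Sum>i\<le>Suc ?n. coeff (pCons 0 s - smult w s) i *s a (y \<otimes> t [^] i))"
    by (subst act_extend) (simp_all only: q)
  also have "\<dots> = (\<Sum>i\<le>Suc ?n. coeff (pCons 0 s) i *s a (y \<otimes> t [^] i))
      - (\<Sum>i\<le>Suc ?n. w *s (coeff s i *s a (y \<otimes> t [^] i)))"
    by (simp add: vec.scale_left_diff_distrib flip: sum_subtractf)
  also have "(\<Sum>i\<le>Suc ?n. coeff (pCons 0 s) i *s a (y \<otimes> t [^] i)) = (\<Sum>i\<le>?n. coeff s i *s a (y \<otimes> t [^] Suc i))"
    by (subst sum.atMost_Suc_shift) (simp add: vec.scale_zero_left)
  also have "\<dots> = act t s a (y \<otimes> t)"
    unfolding act_def using assms nat_pow_Suc2 [of t] by (simp add: m_assoc)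
  also have "(\<Sum>i\<le>Suc ?n. w *s (coeff s i *s a (y \<otimes> t [^] i))) = w *s act t s a y"
    by (subst act_extend [of s "Suc ?n"]) (simp_all add: vec.scale_sum_right coeff_eq_0)
  finally show ?thesis .
qed

lemma sol_act: "sol a b \<Longrightarrow> t \<in> carrier H \<Longrightarrow> sol (act t q a) (act t q b)"
  unfolding act_def by (intro sol_sum sol_scale sol_translate) auto

text \<open>Descent on the degree of the polynomial: split off a root \<open>w\<close> with cofactor
  \<open>s\<close>. If \<open>act t s a\<close> is nonconstant, it is an eigenvector up to a
  constant; otherwise \<open>s\<close> takes the place of \<open>q\<close>. A constant solution need
  not be 0, so only annihilation up to a constant \<open>k\<close> survives the descent.\<close>

lemma affine_eigenvector_exists:
  assumes "sol a b" "nonconst a" "t \<in> carrier H" "q \<noteq> 0"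
    and "\<And>y. y \<in> carrier H \<Longrightarrow> act t q a y = k" "\<And>y. y \<in> carrier H \<Longrightarrow> act t q b y = k"
  shows "\<exists>w a' b' k'. sol a' b' \<and> nonconst a' \<and>
    (\<forall>y\<in>carrier H. a' (y \<otimes> t) - w *s a' y = k' \<and> b' (y \<otimes> t) - w *s b' y = k')"
  using assms(4-)
proof (induction "degree q" arbitrary: q k)
  case 0
  then obtain c where c: "q = [:c:]" "c \<noteq> 0"
    by (metis degree_eq_zeroE pCons_eq_0_iff)
  have "c *s a y = c *s a \<one>" if "y \<in> carrier H" for y
    using "0.prems"(2) [OF that] "0.prems"(2) [OF one_closed] that by (simp add: c act_def)
  then have "a y = a \<one>" if "y \<in> carrier H" for y
    using that c(2) vector_mul_lcancel by blast
  with assms(2) show ?case unfolding nonconst_def by blast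
next
  case (Suc n)
  obtain w where "poly q w = 0"
    using alg_closed_imp_poly_has_root [of q] Suc.hyps(2) by auto
  then obtain s where s: "q = [:- w, 1:] * s"
    by (metis poly_eq_0_iff_dvd dvdE)
  have s0: "s \<noteq> 0" using s Suc.prems(1) by auto
  have deg: "n = degree s"
    using Suc.hyps(2) s0 unfolding s by (subst (asm) degree_mult_eq) auto
  have so: "sol (act t s a) (act t s b)" by (rule sol_act [OF assms(1,3)])
  have st: "act t s a (y \<otimes> t) - w *s act t s a y = k \<and> act t s b (y \<otimes> t) - w *s act t s b y = k"
    if "y \<in> carrier H" for y
    using Suc.prems(2,3) [OF that] unfolding s act_linear_factor [OF assms(3) that] by simp
  show ?case
  proof (cases "nonconst (act t s a)")
    case True
    with so st show ?thesis by blast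
  next
    case False
    show ?thesis
      by (rule Suc.hyps(1) [OF deg s0, of "act t s a \<one>"])
        (erule not_nonconstD [OF so False])+
  qed
qed

text \<open>The polynomial \<open>X^N - 1\<close> with \<open>t [^] N = \<one>\<close> annihilates
  everything. An eigenvalue 1 would move \<open>a'\<close> by a fixed step \<open>k'\<close> along
  the powers of \<open>t\<close>; after \<open>N\<close> steps it returns, so \<open>k' = 0\<close>,
  against injectivity. For \<open>w \<noteq> 1\<close> the affine map has a fixed point
  \<open>c\<close>, and taking it as origin removes \<open>k'\<close>.\<close>

lemma eigenvector_exists:
  assumes "sol a b" "nonconst a" "t \<in> carrier H" "t \<noteq> \<one>"
  obtains w f g where "sol f g" "nonconst f" "w \<noteq> 1"
    "\<And>y. y \<in> carrier H \<Longrightarrow> f (y \<otimes> t) = w *s f y" "\<And>y. y \<in> carrier H \<Longrightarrow> g (y \<otimes> t) = w *s g y"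
proof -
  \<comment> \<open>The pigeonhole argument also bounds \<open>N\<close> by the order of
    \<open>H\<close>, which makes \<open>N\<close> invertible in the field.\<close>
  obtain N :: nat where N: "N > 0" "t [^] N = \<one>" "N \<le> card (carrier H)"
  proof -
    let ?c = "card (carrier H)"
    have "\<not> inj_on (\<lambda>i::nat. t [^] i) {..?c}"
    proof (rule pigeonhole)
      have "(\<lambda>i::nat. t [^] i) ` {..?c} \<subseteq> carrier H" using assms(3) by auto
      then have "card ((\<lambda>i::nat. t [^] i) ` {..?c}) \<le> ?c" by (rule card_mono [OF fin])
      then show "card ((\<lambda>i::nat. t [^] i) ` {..?c}) < card {..?c}" by simp
    qed
    then obtain i j where "i < j" "j \<le> ?c" "t [^] i = t [^] j"
      unfolding inj_on_def by (metis atMost_iff linorder_neqE_nat)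
    moreover from this have "t [^] i \<otimes> t [^] (j - i) = t [^] i"
      using nat_pow_mult [OF assms(3), of i "j - i"] by simp
    ultimately show thesis
      using assms(3) by (intro that [of "j - i"]) auto
  qed
  define q :: "'k poly" where "q = monom 1 N - 1"
  have dq: "degree q \<le> N" unfolding q_def by (intro degree_diff_le degree_monom_le) simp
  have cq: "coeff q i = (if i = N then 1 else 0) - (if i = 0 then 1 else 0)" for i
    unfolding q_def coeff_diff coeff_1 coeff_monom by auto
  have q0: "q \<noteq> 0"
    using cq [of N] N by auto
  have act0: "act t q h y = 0" if "y \<in> carrier H" for h y
  proof -
    have "act t q h y = (\<Sum>i\<le>N. (if i = N then h (y \<otimes> t [^] i) else 0) - (if i = 0 then h (y \<otimes> t [^] i) else 0))"
      unfolding act_extend [OF dq] cq by (intro sum.cong) (auto simp: vec.scale_left_diff_distrib)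
    also have "\<dots> = 0"
      using N that by (simp add: sum_subtractf)
    finally show ?thesis .
  qed
  obtain w a' b' k' where s': "sol a' b'" and nc: "nonconst a'"
    and ev: "\<And>y. y \<in> carrier H \<Longrightarrow> a' (y \<otimes> t) - w *s a' y = k'"
      "\<And>y. y \<in> carrier H \<Longrightarrow> b' (y \<otimes> t) - w *s b' y = k'"
    using affine_eigenvector_exists [OF assms(1-3) q0 act0 act0] by blast
  have w1: "w \<noteq> 1"
  proof
    assume w: "w = 1"
    have "a' (t [^] i) = a' \<one> + of_nat i *s k'" for i
    proof (induction i)
      case (Suc i)
      have "a' (t [^] Suc i) = a' (t [^] i) + k'"
        using ev(1) [of "t [^] i"] assms(3) by (simp add: w algebra_simps)
      with Suc show ?case by (simp add: vec2_eq_iff algebra_simps)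
    qed simp
    from this [of N] have "of_nat N *s k' = 0" by (simp add: N)
    then have "k' = 0" using char [of N] N by simp
    then have "a' t = a' \<one>" using ev(1) [OF one_closed] assms(3) by (simp add: w)
    then show False using nonconst_inj [OF s' nc] assms by auto
  qed
  define c where "c = (1 / (1 - w)) *s k'"
  have c: "c - w *s c = k'"
  proof -
    have "(1 - w) *s c = k'" using w1 by (simp add: c_def)
    then show ?thesis by (metis vec.scale_left_diff_distrib vec.scale_one)
  qed
  show thesis
  proof (rule that [of "\<lambda>y. a' y - c" "\<lambda>y. b' y - c" w])
    show "sol (\<lambda>y. a' y - c) (\<lambda>y. b' y - c)" by (rule sol_shift [OF s'])
    show "nonconst (\<lambda>y. a' y - c)" using nc by (simp add: nonconst_def)
    show "a' (y \<otimes> t) - c = w *s (a' y - c)" "b' (y \<otimes> t) - c = w *s (b' y - c)" if "y \<in> carrier H" for y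
      using ev [OF that] c by (simp_all add: vec2_eq_iff algebra_simps)
  qed (rule w1)
qed

text \<open>If \<open>f y\<close> and \<open>g z\<close> were parallel, \<open>g z\<close> and all
  the points \<open>f (y \<otimes> t [^] i)\<close> would lie on one line through the origin. The
  lines joining \<open>g z\<close> to two of these points have different directions, so
  \<open>g z\<close> must coincide with one of any two of them. Among three distinct points this is
  impossible.\<close>

lemma eigenvector_independent:
  assumes s: "sol f g" and nc: "nonconst f" and t: "t \<in> carrier H" "t \<otimes> t \<noteq> \<one>"
    and f': "\<forall>y\<in>carrier H. f (y \<otimes> t) = w *s f y"
    and yz: "y \<in> carrier H" "z \<in> carrier H"
  shows "f y \<noteq> 0" "w \<noteq> 0" "w \<noteq> 1" "w\<^sup>2 \<noteq> 1" "wedge (f y) (g z) \<noteq> 0"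
proof -
  note f = bspec [OF f']
  have t1: "t \<noteq> \<one>" using t by auto
  show f0: "f y \<noteq> 0"
    using f [OF yz(1)] nonconst_inj [OF s nc yz(1), of "y \<otimes> t"] t yz t1 by auto
  show "w \<noteq> 1"
    using f [OF yz(1)] nonconst_inj [OF s nc yz(1), of "y \<otimes> t"] t yz t1 by auto
  have f2: "f (y \<otimes> (t \<otimes> t)) = w\<^sup>2 *s f y"
    using f [OF yz(1)] f [of "y \<otimes> t"] t yz by (simp add: m_assoc power2_eq_square)
  show w2: "w\<^sup>2 \<noteq> 1"
    using f2 nonconst_inj [OF s nc yz(1), of "y \<otimes> (t \<otimes> t)"] t yz by auto
  show w0: "w \<noteq> 0"
    using f [OF yz(1)] f [of "y \<otimes> t"] nonconst_inj [OF s nc, of "y \<otimes> t" "y \<otimes> t \<otimes> t"] t yz t1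
    by (auto simp: m_assoc)
  show "wedge (f y) (g z) \<noteq> 0"
  proof
    assume 0: "wedge (f y) (g z) = 0"
    have eq: "g z = w ^ i *s f y \<or> g z = w ^ j *s f y"
      if ij: "y \<otimes> t [^] i \<noteq> y \<otimes> t [^] j" for i j :: nat
    proof (rule ccontr)
      have pw: "f (y \<otimes> t [^] k) = w ^ k *s f y" for k :: nat
      proof (induction k)
        case (Suc k)
        then show ?case
          using f [of "y \<otimes> t [^] k"] t yz by (simp add: m_assoc)
      qed (use yz in simp)
      assume "\<not> ?thesis"
      then have ne: "g z - f (y \<otimes> t [^] i) \<noteq> 0" "g z - f (y \<otimes> t [^] j) \<noteq> 0"
        by (auto simp: pw)
      have "wedge (g z - f (y \<otimes> t [^] k)) (d (z \<otimes> inv (y \<otimes> t [^] k))) = 0" for k :: nat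
        using solD' [OF s yz(2), of "y \<otimes> t [^] k"] yz t by simp
      then have p: "wedge (d (z \<otimes> inv (y \<otimes> t [^] k))) (g z - f (y \<otimes> t [^] k)) = 0" for k :: nat
        using wedge_swap_eq_0 by blast
      have "wedge (g z - f (y \<otimes> t [^] i)) (g z - f (y \<otimes> t [^] j)) = 0"
        using 0 wedge_swap_eq_0 [of "f y" "g z"] by (simp add: pw wedge_distribs)
      then have "wedge (d (z \<otimes> inv (y \<otimes> t [^] i))) (d (z \<otimes> inv (y \<otimes> t [^] j))) = 0"
        using p [of i] p [of j] ne wedge_trans wedge_swap_eq_0 by metis
      moreover have "z \<otimes> inv (y \<otimes> t [^] i) \<noteq> z \<otimes> inv (y \<otimes> t [^] j)"
        using ij yz t by (metis Units_eq Units_l_cancel inv_closed inv_inv m_closed nat_pow_closed)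
      ultimately show False using nonparallel yz t by auto
    qed
    have "y \<otimes> t [^] (0::nat) \<noteq> y \<otimes> t [^] (1::nat)" "y \<otimes> t [^] (0::nat) \<noteq> y \<otimes> t [^] (2::nat)"
      "y \<otimes> t [^] (1::nat) \<noteq> y \<otimes> t [^] (2::nat)"
      using t t1 yz by (auto simp: numeral_2_eq_2 m_assoc)
    with eq [of 0 1] eq [of 0 2] eq [of 1 2]
    consider "f y = w *s f y" | "f y = w\<^sup>2 *s f y" | "w *s f y = w\<^sup>2 *s f y" by auto
    then show False
    proof cases
      case 1
      then have "(1 - w) *s f y = 0" unfolding vec.scale_left_diff_distrib by (metis diff_self vec.scale_one)
      with f0 \<open>w \<noteq> 1\<close> show False by (metis eq_iff_diff_eq_0 vec.scale_eq_0_iff)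
    next
      case 2
      then have "(1 - w\<^sup>2) *s f y = 0" unfolding vec.scale_left_diff_distrib by (metis diff_self vec.scale_one)
      with f0 w2 show False by (metis eq_iff_diff_eq_0 vec.scale_eq_0_iff)
    next
      case 3
      then have "(w * (1 - w)) *s f y = 0"
        unfolding right_diff_distrib mult_1_right vec.scale_left_diff_distrib power2_eq_square by simp
      with f0 \<open>w \<noteq> 1\<close> w0 show False by (metis eq_iff_diff_eq_0 mult_eq_0_iff vec.scale_eq_0_iff)
    qed
  qed
qed

text \<open>Both differences are parallel to the same nonzero direction. This eliminates
  \<open>d\<close> and leaves a relation between two solutions only.\<close>

lemma sol_wedge:
  assumes "sol a b" "sol f g" "y \<in> carrier H" "z \<in> carrier H"
  shows "wedge (b z - a y) (g z - f y) = 0"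
proof -
  have "z \<otimes> inv y \<in> carrier H" using assms by simp
  then show ?thesis
    using solD' [OF assms(1,4,3)] solD' [OF assms(2,4,3)] d_nonzero wedge_trans wedge_swap_eq_0 by metis
qed

text \<open>Along the cosets of the powers of \<open>t\<close> every solution is a combination of a constant, of the
  eigenvector \<open>(f, g)\<close> and of its mirror image \<open>(g, f)\<close> with inverted eigenvalue; only the last part
  can depend on the pair of cosets.\<close>

lemma translate_eigenvector:
  assumes s: "sol f g" and nc: "nonconst f" and t: "t \<in> carrier H" "t \<otimes> t \<noteq> \<one>"
    and f: "\<And>y. y \<in> carrier H \<Longrightarrow> f (y \<otimes> t) = w *s f y"
    and g: "\<And>y. y \<in> carrier H \<Longrightarrow> g (y \<otimes> t) = w *s g y"
    and x: "x \<in> carrier H"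
  obtains u where "\<And>y. y \<in> carrier H \<Longrightarrow> f (y \<otimes> x) = u *s f y"
    "\<And>y. y \<in> carrier H \<Longrightarrow> g (y \<otimes> x) = u *s g y"
proof -
  have "\<forall>y\<in>carrier H. f (y \<otimes> t) = w *s f y" using f by blast
  note ind = eigenvector_independent [OF s nc t this]
  have w: "w \<noteq> 0" "w \<noteq> 1" "w\<^sup>2 \<noteq> 1"
    using ind(2-4) one_closed by blast+
  have pw: "h (y \<otimes> t [^] k) = w ^ k *s h y"
    if "\<And>y. y \<in> carrier H \<Longrightarrow> h (y \<otimes> t) = w *s h y" "y \<in> carrier H" for h :: "'a \<Rightarrow> 'k ^ 2" and y and k :: nat
  proof (induction k)
    case (Suc k)
    then show ?case
      using that(1) [of "y \<otimes> t [^] k"] t that(2) by (simp add: m_assoc)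
  qed (use that in simp)
  define F where "F = (\<lambda>y. f (y \<otimes> x))"
  define E where "E = (\<lambda>y. g (y \<otimes> x))"
  have FE: "sol F E" unfolding F_def E_def by (rule sol_translate [OF s x])
  \<comment> \<open>Along the powers of \<open>t\<close> the eigenvector is a geometric progression,
    so \<open>wedge_core\<close> applies with the weights \<open>w ^ i\<close>.\<close>
  have "\<exists>c u v. (\<forall>i. F (y \<otimes> t [^] i) = c + (u * w ^ i) *s f y + (v / w ^ i) *s g z)
      \<and> (\<forall>i. E (z \<otimes> t [^] i) = c + (u * w ^ i) *s g z + (v / w ^ i) *s f y)"
    if yz: "y \<in> carrier H" "z \<in> carrier H" for y z
  proof -
    have "wedge (E (z \<otimes> t [^] j) - F (y \<otimes> t [^] i)) (w ^ j *s g z - w ^ i *s f y) = 0" for i j :: nat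
      using sol_wedge [OF FE s, of "y \<otimes> t [^] i" "z \<otimes> t [^] j"] pw [of f, OF f yz(1)] pw [of g, OF g yz(2)] yz t
      by simp
    from wedge_core [of UNIV "\<lambda>i. w ^ i" 0 1 "f y" "g z" "\<lambda>j. E (z \<otimes> t [^] j)" "\<lambda>i. F (y \<otimes> t [^] i)", OF _ _ _ _ _ this]
    show ?thesis using w ind(5) [OF yz] by (metis UNIV_I power_0 power_not_zero power_one_right)
  qed
  then obtain c u v where
    F': "\<And>y z i. y \<in> carrier H \<Longrightarrow> z \<in> carrier H \<Longrightarrow>
      F (y \<otimes> t [^] (i::nat)) = c y z + (u y z * w ^ i) *s f y + (v y z / w ^ i) *s g z" and
    E': "\<And>y z i. y \<in> carrier H \<Longrightarrow> z \<in> carrier H \<Longrightarrow>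
      E (z \<otimes> t [^] (i::nat)) = c y z + (u y z * w ^ i) *s g z + (v y z / w ^ i) *s f y"
    by metis
  have distinct: "(1::'k) \<noteq> w" "(1::'k) \<noteq> w\<^sup>2" "w \<noteq> w\<^sup>2"
    using w by (auto simp: power2_eq_square)
  have uniq: "X = 0 \<and> Y = 0 \<and> Z = 0"
    if "\<And>i::nat. X + (w ^ i) *s Y + (1 / w ^ i) *s Z = (0 :: 'k ^ 2)" for X Y Z
  proof -
    have "X + \<zeta> *s Y + (1 / \<zeta>) *s Z = 0" if "\<zeta> \<in> {1, w, w\<^sup>2}" for \<zeta>
      using that \<open>\<And>i. X + (w ^ i) *s Y + (1 / w ^ i) *s Z = 0\<close> [of 0]
        \<open>\<And>i. X + (w ^ i) *s Y + (1 / w ^ i) *s Z = 0\<close> [of 1]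
        \<open>\<And>i. X + (w ^ i) *s Y + (1 / w ^ i) *s Z = 0\<close> [of 2] by auto
    from laurent_three_points [OF distinct _ _ _ this] show ?thesis using w by simp
  qed
  have Fc: "c y z = c y z' \<and> u y z = u y z' \<and> v y z *s g z = v y z' *s g z'"
    if "y \<in> carrier H" "z \<in> carrier H" "z' \<in> carrier H" for y z z'
  proof -
    have "(c y z - c y z') + (w ^ i) *s ((u y z - u y z') *s f y)
        + (1 / w ^ i) *s (v y z *s g z - v y z' *s g z') = 0" for i :: nat
      using F' [OF that(1,2), of i] F' [OF that(1,3), of i] by (simp add: vec2_eq_iff algebra_simps diff_divide_distrib)
    from uniq [OF this] show ?thesis using ind(1) that by auto
  qed
  have Ec: "c y z = c y' z \<and> u y z = u y' z \<and> v y z *s f y = v y' z *s f y'"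
    if "y \<in> carrier H" "y' \<in> carrier H" "z \<in> carrier H" for y y' z
  proof -
    have "(c y z - c y' z) + (w ^ i) *s ((u y z - u y' z) *s g z)
        + (1 / w ^ i) *s (v y z *s f y - v y' z *s f y') = 0" for i :: nat
      using E' [OF that(1,3), of i] E' [OF that(2,3), of i] by (simp add: vec2_eq_iff algebra_simps diff_divide_distrib)
    from uniq [OF this] show ?thesis using ind(5) [OF that(1,3)] by auto
  qed
  define C where "C = c \<one> \<one>"
  define U where "U = u \<one> \<one>"
  have C: "c y z = C" and U: "u y z = U" if "y \<in> carrier H" "z \<in> carrier H" for y z
    using Fc [OF that(1) that(2) one_closed] Ec [OF that(1) one_closed one_closed] by (simp_all add: C_def U_def)
  \<comment> \<open>A nonzero \<open>v\<close> would make all values of \<open>f\<close> parallel.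
    The exponents 0 and 1 then place \<open>C\<close> plus two different multiples of
    \<open>g z\<close> on the line spanned by \<open>f y\<close>, and their difference contradicts
    the independence of \<open>f y\<close> and \<open>g z\<close>.\<close>
  have v0: "v y z = 0" if yz: "y \<in> carrier H" "z \<in> carrier H" for y z
  proof (rule ccontr)
    assume v: "v y z \<noteq> 0"
    have pf: "wedge (f y') (f y) = 0" if "y' \<in> carrier H" for y'
    proof -
      have "v y z *s f y = v y' z *s f y'" using Ec [OF yz(1) that yz(2)] by blast
      then have "wedge (f y') (v y z *s f y) = 0" by simp
      then show ?thesis using v by simp
    qed
    have F1: "wedge (C + v y z *s g z) (f y) = 0"
      using F' [OF yz, of 0] pf [of "y \<otimes> x"] yz x by (simp add: F_def C U wedge_distribs)
    have F2: "wedge (C + (v y z / w) *s g z) (f y) = 0"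
      using F' [OF yz, of 1] pf [of "y \<otimes> t \<otimes> x"] yz x t by (simp add: F_def C U wedge_distribs)
    have "v y z * (1 - 1 / w) * wedge (g z) (f y) = 0"
      using F1 F2 by (simp add: wedge_distribs algebra_simps) (metis add_left_cancel)
    moreover have "wedge (g z) (f y) \<noteq> 0" using ind(5) [OF yz] wedge_swap_eq_0 by blast
    ultimately show False using v w by simp
  qed
  have F1: "F y = C + U *s f y" if "y \<in> carrier H" for y
    using F' [OF that that, of 0] that by (simp add: C U v0)
  have E1: "E y = C + U *s g y" if "y \<in> carrier H" for y
    using E' [OF that that, of 0] that by (simp add: C U v0)
  \<comment> \<open>The sum of an eigenvector is multiplied by \<open>w \<noteq> 1\<close> under
    reindexing, so it vanishes. The translate \<open>F\<close> has the same sum, which leaves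
    \<open>C\<close> times the order of \<open>H\<close>.\<close>
  have S: "(\<Sum>y\<in>carrier H. f y) = 0"
  proof -
    have "(\<Sum>y\<in>carrier H. f y) = w *s (\<Sum>y\<in>carrier H. f y)"
      unfolding vec.scale_sum_right
      using sum_translate(1) [OF t(1), of f] f by simp
    then have "(1 - w) *s (\<Sum>y\<in>carrier H. f y) = 0"
      unfolding vec.scale_left_diff_distrib by (metis diff_self vec.scale_one)
    then show ?thesis using w by (metis eq_iff_diff_eq_0 vec.scale_eq_0_iff)
  qed
  have "0 = (\<Sum>y\<in>carrier H. F y)"
    unfolding F_def sum_translate(1) [OF x, of f] S ..
  also have "\<dots> = (\<Sum>y\<in>carrier H. C) + U *s (\<Sum>y\<in>carrier H. f y)"
    by (simp add: F1 sum.distrib vec.scale_sum_right)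
  finally have "C $ i = 0" for i
    using char [of "card (carrier H)"] order_ge_3 by (simp add: S vec_eq_iff of_nat_index)
  then have "C = 0" by (simp add: vec_eq_iff)
  then show thesis
    using F1 E1 by (intro that [of U]) (simp_all add: F_def E_def)
qed

text \<open>The eigenvalues of all translations on one eigenvector form the character
  \<open>\<theta>\<close>, which then serves as the weight in \<open>wedge_core\<close> on the whole
  of \<open>H\<close>. Thus \<open>\<theta>\<close>, \<open>P\<close>, \<open>Q\<close> are
  determined once for the given directions, and a particular solution enters only through
  \<open>c\<close>, \<open>u\<close>, \<open>v\<close>.\<close>

theorem net_form:
  assumes s0: "sol a0 b0" and nc0: "nonconst a0"
  obtains \<theta> P Q where "grp_char H \<theta>" "inj_on \<theta> (carrier H)" "wedge P Q \<noteq> 0"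
    "\<And>a b. sol a b \<Longrightarrow> \<exists>c u v. \<forall>y\<in>carrier H.
      a y = c + (u * \<theta> y) *s P + (v / \<theta> y) *s Q \<and> b y = c + (u * \<theta> y) *s Q + (v / \<theta> y) *s P"
proof -
  obtain t where t: "t \<in> carrier H" "t \<otimes> t \<noteq> \<one>" by (rule exists_non_involution [OF s0 nc0])
  then have t1: "t \<noteq> \<one>" by auto
  obtain w f g where s: "sol f g" and nc: "nonconst f"
    and ev: "\<And>y. y \<in> carrier H \<Longrightarrow> f (y \<otimes> t) = w *s f y" "\<And>y. y \<in> carrier H \<Longrightarrow> g (y \<otimes> t) = w *s g y"
    by (rule eigenvector_exists [OF s0 nc0 t(1) t1]) blast
  have "\<forall>y\<in>carrier H. f (y \<otimes> t) = w *s f y" using ev(1) by blast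
  note ind = eigenvector_independent [OF s nc t this]
  have "\<exists>u. \<forall>y\<in>carrier H. f (y \<otimes> x) = u *s f y \<and> g (y \<otimes> x) = u *s g y" if "x \<in> carrier H" for x
    by (rule translate_eigenvector [OF s nc t ev that]) blast+
  then obtain \<theta> where \<theta>: "\<And>x y. x \<in> carrier H \<Longrightarrow> y \<in> carrier H \<Longrightarrow> f (y \<otimes> x) = \<theta> x *s f y"
    "\<And>x y. x \<in> carrier H \<Longrightarrow> y \<in> carrier H \<Longrightarrow> g (y \<otimes> x) = \<theta> x *s g y"
    by metis
  define P Q where "P = f \<one>" and "Q = g \<one>"
  have f: "f y = \<theta> y *s P" and g: "g y = \<theta> y *s Q" if "y \<in> carrier H" for y
    using \<theta> [OF that one_closed] that by (simp_all add: P_def Q_def)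
  have PQ: "wedge P Q \<noteq> 0" unfolding P_def Q_def by (rule ind(5)) auto
  have P0: "P \<noteq> 0" using PQ by auto
  have inj: "inj_on \<theta> (carrier H)"
    using nonconst_inj [OF s nc] f by (auto simp: inj_on_def)
  have th: "grp_char H \<theta>"
    unfolding grp_char_def
  proof (intro conjI ballI)
    fix x assume "x \<in> carrier H"
    then show "\<theta> x \<noteq> 0" using ind(1) [of x] f by auto
  next
    fix x y assume xy: "x \<in> carrier H" "y \<in> carrier H"
    have "\<theta> (x \<otimes> y) *s P = (\<theta> x * \<theta> y) *s P"
      using \<theta>(1) [OF xy(2,1)] f xy by (simp add: mult.commute)
    then show "\<theta> (x \<otimes> y) = \<theta> x * \<theta> y" using P0 by simp
  qed
  show thesis
  proof (rule that [OF th inj PQ])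
    fix a b assume ab: "sol a b"
    have rel: "wedge (b j - a i) (\<theta> j *s Q - \<theta> i *s P) = 0" if "i \<in> carrier H" "j \<in> carrier H" for i j
      using sol_wedge [OF ab s that] f g that by simp
    have ne: "\<theta> t \<noteq> \<theta> \<one>" using inj t t1 by (simp add: inj_on_eq_iff)
    have nz: "\<theta> i \<noteq> 0" if "i \<in> carrier H" for i
      using th that by (simp add: grp_char_def)
    obtain c u v where "\<And>i. i \<in> carrier H \<Longrightarrow> a i = c + (u * \<theta> i) *s P + (v / \<theta> i) *s Q"
      "\<And>i. i \<in> carrier H \<Longrightarrow> b i = c + (u * \<theta> i) *s Q + (v / \<theta> i) *s P"
      by (rule wedge_core [of "carrier H" \<theta>, OF nz t(1) one_closed ne PQ rel]) blast+
    then show "\<exists>c u v. \<forall>y\<in>carrier H.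
      a y = c + (u * \<theta> y) *s P + (v / \<theta> y) *s Q \<and> b y = c + (u * \<theta> y) *s Q + (v / \<theta> y) *s P"
      by blast
  qed
qed

end

section \<open>Two cosets seen from the points of a third one\<close>

lemma (in group) grp_char_mult:
  "grp_char G \<phi> \<Longrightarrow> grp_char G \<psi> \<Longrightarrow> grp_char G (\<lambda>x. \<phi> x * \<psi> x)"
  by (simp add: grp_char_def mult_ac)

lemma (in group) grp_char_inverse: "grp_char G \<phi> \<Longrightarrow> grp_char G (\<lambda>x. inverse (\<phi> x))"
  by (simp add: grp_char_def)

lemma (in group) grp_char_power: "grp_char G \<phi> \<Longrightarrow> grp_char G (\<lambda>x. \<phi> x ^ k)"
  by (simp add: grp_char_def power_mult_distrib)

text \<open>Degree 6 is the largest that occurs: if \<open>\<psi>\<close> is the square of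
  \<open>\<phi>\<close>, the exponents of \<open>\<phi>\<close> in the relation run from -3 to
  3.\<close>

lemma poly7_eq_0:
  fixes f :: "'i \<Rightarrow> 'k::field"
  assumes "finite A" "inj_on f A" "card A \<ge> 7"
    and "\<And>x. x \<in> A \<Longrightarrow> c0 + c1 * f x + c2 * f x ^ 2 + c3 * f x ^ 3 + c4 * f x ^ 4 + c5 * f x ^ 5 + c6 * f x ^ 6 = 0"
  shows "c0 = 0 \<and> c1 = 0 \<and> c2 = 0 \<and> c3 = 0 \<and> c4 = 0 \<and> c5 = 0 \<and> c6 = 0"
proof -
  let ?p = "[:c0, c1, c2, c3, c4, c5, c6:]"
  have "?p = 0"
  proof (rule ccontr)
    assume "?p \<noteq> 0"
    then have f: "finite {x. poly ?p x = 0}" and c: "card {x. poly ?p x = 0} \<le> degree ?p"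
      by (rule poly_roots_finite, rule card_poly_roots_bound)
    have "f ` A \<subseteq> {x. poly ?p x = 0}"
    proof (rule image_subsetI)
      fix x assume "x \<in> A"
      then show "f x \<in> {x. poly ?p x = 0}"
        using assms(4) [of x] by (simp add: algebra_simps power_numeral_reduce)
    qed
    from card_mono [OF f this] have "card A \<le> degree ?p"
      using c by (simp add: card_image [OF assms(2)])
    moreover have "degree ?p \<le> 6"
      by (intro degree_le) (auto simp: coeff_pCons split: nat.splits)
    ultimately show False using assms(3) by simp
  qed
  then show ?thesis by simp
qed

text \<open>The points \<open>c + \<phi> x U + \<phi> x\<inverse> V\<close> and \<open>c' + \<psi> (y\<inverse> x) U' + \<psi> (y\<inverse> x)\<inverse> V'\<close> of two cosets are
  collinear with the point \<open>e y\<close> of a third one. Expanding this relation for fixed \<open>y\<close> gives a linear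
  combination of products of powers of \<open>\<phi>\<close> and \<open>\<psi>\<close>, whose coefficients vanish unless two of these
  characters coincide; that happens only for \<open>\<psi> = \<phi>\<^sup>i\<close> or \<open>\<phi> = \<psi>\<^sup>i\<close> with \<open>\<bar>i\<bar> \<le> 2\<close>, or for an
  involution \<open>\<phi> \<psi>\<close> or \<open>\<phi> / \<psi>\<close>, which is harmless.\<close>

locale pair_relation = group H for H (structure) +
  fixes \<phi> \<psi> :: "'a \<Rightarrow> 'k::field" and c c' U V U' V' :: "'k ^ 2" and Y and e :: "'a \<Rightarrow> 'k ^ 2"
  assumes fin: "finite (carrier H)" and order_ge_9: "card (carrier H) \<ge> 9"
    and char: "of_nat (card (carrier H)) \<noteq> (0::'k)"
    and \<phi>: "grp_char H \<phi>" "inj_on \<phi> (carrier H)" and \<psi>: "grp_char H \<psi>" "inj_on \<psi> (carrier H)"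
    and Y: "Y \<subseteq> carrier H" "card Y \<ge> 5" and e: "inj_on e Y"
    and UV: "wedge U V = 0 \<Longrightarrow> U = 0 \<or> V = 0" "U \<noteq> 0 \<or> V \<noteq> 0"
    and UV': "wedge U' V' = 0 \<Longrightarrow> U' = 0 \<or> V' = 0" "U' \<noteq> 0 \<or> V' \<noteq> 0"
    and rel: "\<And>x y. x \<in> carrier H \<Longrightarrow> y \<in> Y \<Longrightarrow>
      wedge (c + \<phi> x *s U + (1 / \<phi> x) *s V - e y)
        (c' + (\<psi> x / \<psi> y) *s U' + (\<psi> y / \<psi> x) *s V' - e y) = 0"
begin

lemma nz: "x \<in> carrier H \<Longrightarrow> \<phi> x \<noteq> 0" "x \<in> carrier H \<Longrightarrow> \<psi> x \<noteq> 0"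
  using \<phi> \<psi> by (auto simp: grp_char_def)

lemma expand:
  assumes "x \<in> carrier H" "y \<in> Y"
  shows "wedge (c - e y) (c' - e y) + \<phi> x * wedge U (c' - e y) + 1 / \<phi> x * wedge V (c' - e y)
    + \<psi> x * (1 / \<psi> y * wedge (c - e y) U') + 1 / \<psi> x * (\<psi> y * wedge (c - e y) V')
    + \<phi> x * \<psi> x * (1 / \<psi> y * wedge U U') + \<phi> x * (1 / \<psi> x) * (\<psi> y * wedge U V')
    + 1 / \<phi> x * \<psi> x * (1 / \<psi> y * wedge V U') + 1 / \<phi> x * (1 / \<psi> x) * (\<psi> y * wedge V V') = 0"
proof -
  have "wedge (c + \<phi> x *s U + (1 / \<phi> x) *s V - e y) (c' + (\<psi> x / \<psi> y) *s U' + (\<psi> y / \<psi> x) *s V' - e y)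
    = wedge ((c - e y) + \<phi> x *s U + (1 / \<phi> x) *s V) ((c' - e y) + (\<psi> x / \<psi> y) *s U' + (\<psi> y / \<psi> x) *s V')"
    by (simp add: algebra_simps)
  also have "\<dots> = wedge (c - e y) (c' - e y) + \<phi> x * wedge U (c' - e y) + 1 / \<phi> x * wedge V (c' - e y)
    + \<psi> x * (1 / \<psi> y * wedge (c - e y) U') + 1 / \<psi> x * (\<psi> y * wedge (c - e y) V')
    + \<phi> x * \<psi> x * (1 / \<psi> y * wedge U U') + \<phi> x * (1 / \<psi> x) * (\<psi> y * wedge U V')
    + 1 / \<phi> x * \<psi> x * (1 / \<psi> y * wedge V U') + 1 / \<phi> x * (1 / \<psi> x) * (\<psi> y * wedge V V')"
    unfolding wedge_distribs(1,2) wedge_simps by (simp add: algebra_simps)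
  finally show ?thesis using rel [OF assms] by simp
qed

text \<open>Replacing \<open>x\<close> by \<open>z \<otimes> x\<close> with \<open>z = inv y\<close>
  moves the dependence on the third point from the second family to the first.\<close>

lemma swapped: "pair_relation H \<psi> \<phi> c' c U' V' U V ((\<lambda>y. inv y) ` Y) (\<lambda>y. e (inv y))"
proof (unfold_locales; (rule fin order_ge_9 char \<phi> \<psi> UV(2) UV'(2))?)
  have i: "inj_on (\<lambda>y. inv y) Y" using Y(1) by (intro inj_onI) (metis inv_inv subsetD)
  show "(\<lambda>y. inv y) ` Y \<subseteq> carrier H" "5 \<le> card ((\<lambda>y. inv y) ` Y)"
    using Y by (auto simp: card_image [OF i])
  have "inv (inv y) = y" if "y \<in> Y" for y using that Y by auto
  then show "inj_on (\<lambda>y. e (inv y)) ((\<lambda>y. inv y) ` Y)"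
    using e by (auto simp: inj_on_def)
  show "U' = 0 \<or> V' = 0" if "wedge U' V' = 0" using UV'(1) that .
  show "U = 0 \<or> V = 0" if "wedge U V = 0" using UV(1) that .
  fix x y assume x: "x \<in> carrier H" and "y \<in> (\<lambda>y. inv y) ` Y"
  then obtain z where z: "z \<in> Y" "z \<in> carrier H" "y = inv z" using Y by auto
  have a: "\<phi> (z \<otimes> x) = \<phi> x / \<phi> y" "\<psi> (z \<otimes> x) / \<psi> z = \<psi> x"
    using x z \<phi>(1) \<psi>(1) nz [of z] grp_char_inv [OF \<phi>(1) z(2)]
    by (simp_all add: grp_char_def)
  then have b: "1 / \<phi> (z \<otimes> x) = \<phi> y / \<phi> x" "\<psi> z / \<psi> (z \<otimes> x) = 1 / \<psi> x"
    by (simp, metis inverse_divide inverse_eq_divide)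
  have "wedge (c + (\<phi> x / \<phi> y) *s U + (\<phi> y / \<phi> x) *s V - e z) (c' + \<psi> x *s U' + (1 / \<psi> x) *s V' - e z) = 0"
    using rel [of "z \<otimes> x" z] x z unfolding b unfolding a by simp
  then show "wedge (c' + \<psi> x *s U' + (1 / \<psi> x) *s V' - e (inv y)) (c + (\<phi> x / \<phi> y) *s U + (\<phi> y / \<phi> x) *s V - e (inv y)) = 0"
    using z wedge_swap_eq_0 by auto
qed

lemma inverted: "pair_relation H \<phi> (\<lambda>x. 1 / \<psi> x) c c' U V V' U' Y e"
proof (unfold_locales; (rule fin order_ge_9 char \<phi> UV Y e)?)
  show "grp_char H (\<lambda>x. 1 / \<psi> x)"
    using grp_char_inverse [OF \<psi>(1)] by (simp add: inverse_eq_divide)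
  show "inj_on (\<lambda>x. 1 / \<psi> x) (carrier H)"
    using \<psi>(2) by (simp add: inj_on_def)
  show "V' = 0 \<or> U' = 0" if "wedge V' U' = 0" using UV'(1) that wedge_swap_eq_0 by blast
  show "V' \<noteq> 0 \<or> U' \<noteq> 0" using UV'(2) by blast
  show "wedge (c + \<phi> x *s U + (1 / \<phi> x) *s V - e y)
      (c' + (1 / \<psi> x / (1 / \<psi> y)) *s V' + (1 / \<psi> y / (1 / \<psi> x)) *s U' - e y) = 0"
    if "x \<in> carrier H" "y \<in> Y" for x y
    using rel [OF that] by (simp add: add_ac)
qed (assumption | rule UV)+

lemma not_constant_e:
  assumes "\<And>y. y \<in> Y \<Longrightarrow> e y = k" 
  shows False
proof -
  have "card Y \<le> card {k}"
    using e assms by (intro card_inj_on_le [of e]) auto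
  then show False using Y by simp
qed

text \<open>Otherwise the injective image of \<open>H\<close> would consist of roots of
  \<open>X^k - 1\<close>.\<close>

lemma distinct_of_order:
  assumes "f = (\<lambda>x. \<phi> x) \<or> f = (\<lambda>x. \<psi> x)" "0 < k" "k < 9"
  shows "\<exists>x\<in>carrier H. f x ^ k \<noteq> 1"
proof (rule ccontr)
  assume "\<not> ?thesis"
  then have 1: "f x ^ k = 1" if "x \<in> carrier H" for x using that by blast
  have inj: "inj_on f (carrier H)" using assms \<phi> \<psi> by auto
  let ?p = "monom 1 k - 1 :: 'k poly"
  have "coeff ?p k = 1" using assms(2) by simp
  then have p: "?p \<noteq> 0" by (metis coeff_0 zero_neq_one)
  have "f ` carrier H \<subseteq> {x. poly ?p x = 0}" using 1 by (auto simp: poly_monom)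
  from card_mono [OF poly_roots_finite [OF p] this] have "card (carrier H) \<le> degree ?p"
    using card_poly_roots_bound [OF p] by (simp add: card_image [OF inj])
  also have "degree ?p \<le> k" by (intro degree_diff_le degree_monom_le) simp
  finally show False using order_ge_9 assms(3) by simp
qed

text \<open>Multiplying the expanded relation by the inverse of \<open>\<phi> x\<close>, or by
  \<open>\<phi> x\<close>, and summing over \<open>H\<close> isolates the coefficient of
  \<open>U\<close> or of \<open>V\<close>. The hypotheses exclude exactly the coincidences that
  would let a mixed term survive; the remaining terms vanish because \<open>\<phi>\<close>, its
  square and \<open>\<psi>\<close> are nontrivial.\<close>

lemma aligned_generic:
  assumes d: "\<exists>x\<in>carrier H. \<phi> x * \<psi> x \<noteq> 1" "\<exists>x\<in>carrier H. \<phi> x \<noteq> \<psi> x"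
    "\<exists>x\<in>carrier H. \<phi> x ^ 2 * \<psi> x \<noteq> 1" "\<exists>x\<in>carrier H. \<phi> x ^ 2 \<noteq> \<psi> x"
  shows "y \<in> Y \<Longrightarrow> wedge U (c' - e y) = 0 \<and> wedge V (c' - e y) = 0"
proof -
  assume y: "y \<in> Y"
  let ?H = "carrier H"
  have S: "(\<Sum>x\<in>?H. h x) = 0" if "grp_char H h" "\<exists>x\<in>?H. h x \<noteq> 1" for h :: "'a \<Rightarrow> 'k"
    using sum_grp_char [OF that(1)] that(2) by blast
  have ch: "grp_char H (\<lambda>x. \<phi> x ^ i * \<psi> x ^ j)" "grp_char H (\<lambda>x. \<phi> x ^ i * inverse (\<psi> x) ^ j)"
    "grp_char H (\<lambda>x. inverse (\<phi> x) ^ i * \<psi> x ^ j)" "grp_char H (\<lambda>x. inverse (\<phi> x) ^ i * inverse (\<psi> x) ^ j)" for i j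
    by (intro grp_char_mult grp_char_power grp_char_inverse \<phi> \<psi>)+
  have one: "\<exists>x\<in>?H. \<phi> x ^ 1 \<noteq> 1" "\<exists>x\<in>?H. \<phi> x ^ 2 \<noteq> 1" "\<exists>x\<in>?H. \<psi> x ^ 1 \<noteq> 1"
    by (rule distinct_of_order; simp)+
  have d': "\<exists>x\<in>?H. \<psi> x \<noteq> \<phi> x" "\<exists>x\<in>?H. \<psi> x \<noteq> \<phi> x ^ 2"
    using d(2,4) by force+
  have s1: "(\<Sum>x\<in>?H. \<phi> x) = 0"
    using S [OF ch(1) [of 1 0]] one(1) nz by (simp add: field_simps power_one_over cong: bex_cong)
  have s2: "(\<Sum>x\<in>?H. inverse (\<phi> x)) = 0"
    using S [OF ch(3) [of 1 0]] one(1) nz by (simp add: field_simps power_one_over cong: bex_cong)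
  have s3: "(\<Sum>x\<in>?H. \<phi> x ^ 2) = 0"
    using S [OF ch(1) [of 2 0]] one(2) nz by (simp add: field_simps power_one_over cong: bex_cong)
  have s4: "(\<Sum>x\<in>?H. inverse (\<phi> x) ^ 2) = 0"
    using S [OF ch(3) [of 2 0]] one(2) nz by (simp add: field_simps power_one_over cong: bex_cong)
  have s5: "(\<Sum>x\<in>?H. \<psi> x) = 0"
    using S [OF ch(1) [of 0 1]] one(3) nz by (simp add: field_simps power_one_over cong: bex_cong)
  have s6: "(\<Sum>x\<in>?H. inverse (\<psi> x)) = 0"
    using S [OF ch(2) [of 0 1]] one(3) nz by (simp add: field_simps power_one_over cong: bex_cong)
  have s7: "(\<Sum>x\<in>?H. \<phi> x * \<psi> x) = 0"
    using S [OF ch(1) [of 1 1]] d(1) nz by (simp add: field_simps power_one_over cong: bex_cong)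
  have s8: "(\<Sum>x\<in>?H. \<phi> x * inverse (\<psi> x)) = 0"
    using S [OF ch(2) [of 1 1]] d(2) nz by (simp add: field_simps power_one_over cong: bex_cong)
  have s9: "(\<Sum>x\<in>?H. inverse (\<phi> x) * \<psi> x) = 0"
    using S [OF ch(3) [of 1 1]] d'(1) nz by (simp add: field_simps power_one_over cong: bex_cong)
  have s10: "(\<Sum>x\<in>?H. inverse (\<phi> x) * inverse (\<psi> x)) = 0"
    using S [OF ch(4) [of 1 1]] d(1) nz by (simp add: field_simps power_one_over cong: bex_cong)
  have s11: "(\<Sum>x\<in>?H. \<phi> x ^ 2 * \<psi> x) = 0"
    using S [OF ch(1) [of 2 1]] d(3) nz by (simp add: field_simps power_one_over cong: bex_cong)
  have s12: "(\<Sum>x\<in>?H. \<phi> x ^ 2 * inverse (\<psi> x)) = 0"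
    using S [OF ch(2) [of 2 1]] d(4) nz by (simp add: field_simps power_one_over cong: bex_cong)
  have s13: "(\<Sum>x\<in>?H. inverse (\<phi> x) ^ 2 * \<psi> x) = 0"
    using S [OF ch(3) [of 2 1]] d'(2) nz by (simp add: field_simps power_one_over cong: bex_cong)
  have s14: "(\<Sum>x\<in>?H. inverse (\<phi> x) ^ 2 * inverse (\<psi> x)) = 0"
    using S [OF ch(4) [of 2 1]] d(3) nz by (simp add: field_simps power_one_over cong: bex_cong)
  note s = s1 s2 s3 s4 s5 s6 s7 s8 s9 s10 s11 s12 s13 s14
  define p q1 q2 q3 q4 q5 q6 q7 q8 where "p = wedge (c - e y) (c' - e y)" and
    "q1 = wedge U (c' - e y)" and "q2 = wedge V (c' - e y)" and "q3 = 1 / \<psi> y * wedge (c - e y) U'" and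
    "q4 = \<psi> y * wedge (c - e y) V'" and "q5 = 1 / \<psi> y * wedge U U'" and "q6 = \<psi> y * wedge U V'" and
    "q7 = 1 / \<psi> y * wedge V U'" and "q8 = \<psi> y * wedge V V'"
  have E: "p + \<phi> x * q1 + inverse (\<phi> x) * q2 + \<psi> x * q3 + inverse (\<psi> x) * q4
    + \<phi> x * \<psi> x * q5 + \<phi> x * inverse (\<psi> x) * q6 + inverse (\<phi> x) * \<psi> x * q7
    + inverse (\<phi> x) * inverse (\<psi> x) * q8 = 0" if "x \<in> ?H" for x
    using expand [OF that y] by (simp only: inverse_eq_divide p_def q1_def q2_def q3_def q4_def q5_def q6_def q7_def q8_def)
  have "0 = (\<Sum>x\<in>?H. inverse (\<phi> x) * p + q1 + inverse (\<phi> x) ^ 2 * q2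
    + inverse (\<phi> x) * \<psi> x * q3 + inverse (\<phi> x) * inverse (\<psi> x) * q4
    + \<psi> x * q5 + inverse (\<psi> x) * q6 + inverse (\<phi> x) ^ 2 * \<psi> x * q7
    + inverse (\<phi> x) ^ 2 * inverse (\<psi> x) * q8)"
  proof (rule sum.neutral [symmetric], rule ballI)
    fix x assume x: "x \<in> ?H"
    have "inverse (\<phi> x) * \<phi> x = 1" using nz(1) [OF x] by simp
    with E [OF x] show "inverse (\<phi> x) * p + q1 + inverse (\<phi> x) ^ 2 * q2
    + inverse (\<phi> x) * \<psi> x * q3 + inverse (\<phi> x) * inverse (\<psi> x) * q4
    + \<psi> x * q5 + inverse (\<psi> x) * q6 + inverse (\<phi> x) ^ 2 * \<psi> x * q7
    + inverse (\<phi> x) ^ 2 * inverse (\<psi> x) * q8 = 0"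
      by algebra
  qed
  also have "\<dots> = of_nat (card ?H) * q1"
    by (simp add: sum.distrib s flip: sum_distrib_right)
  finally have "q1 = 0" using char by simp
  have "0 = (\<Sum>x\<in>?H. \<phi> x * p + \<phi> x ^ 2 * q1 + q2
    + \<phi> x * \<psi> x * q3 + \<phi> x * inverse (\<psi> x) * q4
    + \<phi> x ^ 2 * \<psi> x * q5 + \<phi> x ^ 2 * inverse (\<psi> x) * q6 + \<psi> x * q7
    + inverse (\<psi> x) * q8)"
  proof (rule sum.neutral [symmetric], rule ballI)
    fix x assume x: "x \<in> ?H"
    have "inverse (\<phi> x) * \<phi> x = 1" using nz(1) [OF x] by simp
    with E [OF x] show "\<phi> x * p + \<phi> x ^ 2 * q1 + q2
    + \<phi> x * \<psi> x * q3 + \<phi> x * inverse (\<psi> x) * q4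
    + \<phi> x ^ 2 * \<psi> x * q5 + \<phi> x ^ 2 * inverse (\<psi> x) * q6 + \<psi> x * q7
    + inverse (\<psi> x) * q8 = 0"
      by algebra
  qed
  also have "\<dots> = of_nat (card ?H) * q2"
    by (simp add: sum.distrib s flip: sum_distrib_right)
  finally have "q2 = 0" using char by simp
  show ?thesis using \<open>q1 = 0\<close> \<open>q2 = 0\<close> by (simp add: q1_def q2_def)
qed

section \<open>Alignment of the two families, including coinciding characters\<close>

lemma collapse_left:
  assumes "\<And>y. y \<in> Y \<Longrightarrow> wedge U (c' - e y) = 0 \<and> wedge V (c' - e y) = 0"
  shows "wedge U V = 0"
proof (rule ccontr)
  assume UV: "wedge U V \<noteq> 0"
  have "e y = c'" if "y \<in> Y" for y
  proof -
    have "wedge (c' - e y) U = 0" "wedge (c' - e y) V = 0" using assms [OF that] wedge_swap_eq_0 by blast+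
    then have "c' - e y = 0" using UV by (rule wedge_zero_unique)
    then show ?thesis by simp
  qed
  then show False by (rule not_constant_e)
qed

text \<open>Otherwise all the \<open>\<psi> y\<close> would be roots of one polynomial of degree at most 4, but there are at
  least five of them.\<close>

lemma equal_wedge:
  assumes eq: "\<And>x. x \<in> carrier H \<Longrightarrow> \<psi> x = \<phi> x"
  shows "wedge U V = 0"
proof (rule ccontr)
  assume ne: "wedge U V \<noteq> 0"
  then have U0: "U \<noteq> 0" and V0: "V \<noteq> 0" by auto
  \<comment> \<open>After multiplication by \<open>\<phi> x ^ 2\<close> the relation is a polynomial
    of degree 4 in \<open>\<phi> x\<close>, so its coefficients vanish.\<close>
  have coeffs: "wedge U U' = 0 \<and> wedge V V' = 0 \<and>
      \<psi> y * wedge U (c' - e y) + wedge (c - e y) U' = 0 \<and> wedge V (c' - e y) + \<psi> y * wedge (c - e y) V' = 0 \<and>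
      \<psi> y * wedge (c - e y) (c' - e y) + \<psi> y ^ 2 * wedge U V' + wedge V U' = 0"
    if y: "y \<in> Y" for y
  proof -
    have \<eta>: "\<psi> y \<noteq> 0" using y Y nz by blast
    have "\<psi> y * wedge V V' + (wedge V (c' - e y) + \<psi> y * wedge (c - e y) V') * \<phi> x
      + (wedge (c - e y) (c' - e y) + \<psi> y * wedge U V' + 1 / \<psi> y * wedge V U') * \<phi> x ^ 2
      + (wedge U (c' - e y) + 1 / \<psi> y * wedge (c - e y) U') * \<phi> x ^ 3
      + (1 / \<psi> y * wedge U U') * \<phi> x ^ 4 + 0 * \<phi> x ^ 5 + 0 * \<phi> x ^ 6 = 0" if x: "x \<in> carrier H" for x
    proof -
      have "\<phi> x * (1 / \<phi> x) = 1" using nz(1) [OF x] by simp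
      with expand [OF x y] show ?thesis unfolding eq [OF x] by algebra
    qed
    from poly7_eq_0 [OF fin \<phi>(2) _ this] order_ge_9 \<eta> show ?thesis
      by (simp add: field_simps power2_eq_square)
  qed
  obtain y0 where y0: "y0 \<in> Y" using Y by (metis card.empty ex_in_conv not_numeral_le_zero)
  obtain u where u: "U' = u *s U" using wedge_parallelE [OF _ U0] coeffs [OF y0] by blast
  obtain v where v: "V' = v *s V" using wedge_parallelE [OF _ V0] coeffs [OF y0] by blast
  have uv: "u \<noteq> 0 \<or> v \<noteq> 0" using u v UV'(2) by auto
  \<comment> \<open>The product \<open>?p * ?q\<close> results from eliminating
    \<open>\<alpha>\<close> and \<open>\<beta>\<close> from facts 6 and 7 below. Neither factor is
    the zero polynomial, since \<open>u\<close> and \<open>v\<close> are not both 0.\<close>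
  define \<omega> A B where "\<omega> = wedge U V" and "A = wedge U (c' - c)" and "B = wedge V (c' - c)"
  let ?p = "[:- u, 0, v:]" and ?q = "[:- \<omega>\<^sup>2 * u, \<omega>\<^sup>2 * (u * v + 1) + A * B, - \<omega>\<^sup>2 * v:]"
  have root: "poly (?p * ?q) (\<psi> y) = 0" if y: "y \<in> Y" for y
  proof -
    define \<eta> \<alpha> \<beta> \<alpha>' \<beta>' \<pi> where "\<eta> = \<psi> y" and "\<alpha> = wedge U (c - e y)" and "\<beta> = wedge V (c - e y)"
      and "\<alpha>' = wedge U (c' - e y)" and "\<beta>' = wedge V (c' - e y)" and "\<pi> = wedge (c - e y) (c' - e y)"
    have 1: "\<eta> * \<alpha>' = u * \<alpha>" and 2: "\<beta>' = \<eta> * v * \<beta>" and 3: "\<eta> * \<pi> + \<eta>\<^sup>2 * v * \<omega> - u * \<omega> = 0"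
      using coeffs [OF y] wedge_swap [of "c - e y" U] wedge_swap [of "c - e y" V] wedge_swap [of V U]
      unfolding u v \<eta>_def \<alpha>_def \<beta>_def \<alpha>'_def \<beta>'_def \<pi>_def \<omega>_def by (simp_all add: algebra_simps)
    \<comment> \<open>The Grassmann-Pluecker identity for the four vectors \<open>U\<close>,
      \<open>V\<close>, \<open>c - e y\<close>, \<open>c' - e y\<close>.\<close>
    have 4: "\<omega> * \<pi> = \<alpha> * \<beta>' - \<beta> * \<alpha>'"
      unfolding \<alpha>_def \<beta>_def \<alpha>'_def \<beta>'_def \<pi>_def \<omega>_def wedge_def by algebra
    have 5: "\<alpha>' - \<alpha> = A" "\<beta>' - \<beta> = B"
      unfolding \<alpha>_def \<beta>_def \<alpha>'_def \<beta>'_def A_def B_def by (simp_all add: wedge_distribs)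
    have 6: "(v * \<eta>\<^sup>2 - u) * (\<alpha> * \<beta> + \<omega>\<^sup>2) = 0"
      using 1 2 3 4 by algebra
    have 7: "\<alpha> * (u - \<eta>) = \<eta> * A" "\<beta> * (\<eta> * v - 1) = B"
      using 1 2 5 by algebra+
    have "(v * \<eta>\<^sup>2 - u) * (\<omega>\<^sup>2 * (u - \<eta>) * (\<eta> * v - 1) + \<eta> * A * B) = 0"
      using 6 7 by algebra
    then show ?thesis
      by (simp add: \<eta>_def [symmetric] power2_eq_square algebra_simps)
  qed
  have p0: "?p * ?q \<noteq> 0" using uv ne by (auto simp: \<omega>_def)
  have inj: "inj_on \<psi> Y" using \<psi>(2) Y(1) by (rule inj_on_subset)
  have "card Y = card (\<psi> ` Y)" by (simp add: card_image [OF inj])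
  also have "\<dots> \<le> card {x. poly (?p * ?q) x = 0}"
    by (rule card_mono [OF poly_roots_finite [OF p0]]) (use root in blast)
  also have "\<dots> \<le> degree (?p * ?q)" by (rule card_poly_roots_bound [OF p0])
  also have "\<dots> \<le> degree ?p + degree ?q" by (rule degree_mult_le)
  also have "\<dots> \<le> 2 + 2" 
    by (intro add_mono degree_le) (auto simp: coeff_pCons split: nat.splits)
  finally show False using Y(2) by simp
qed

text \<open>Here only two pairs of terms share an exponent of \<open>\<phi>\<close>, namely 1 and
  -1, and all other coefficients vanish separately. Some \<open>e y\<close> differs from
  \<open>c\<close>, and \<open>c - e y\<close> is then a nonzero vector parallel to
  \<open>U'\<close>, \<open>V'\<close> and \<open>c' - e y\<close>; a nonzero one of
  \<open>U'\<close> and \<open>V'\<close> transmits its direction to both \<open>U\<close> and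
  \<open>V\<close>.\<close>

lemma double_wedge:
  assumes eq: "\<And>x. x \<in> carrier H \<Longrightarrow> \<psi> x = \<phi> x ^ 2"
  shows "wedge U V = 0"
proof -
  have coeffs: "wedge U U' = 0 \<and> wedge V V' = 0 \<and> wedge (c - e y) U' = 0 \<and> wedge (c - e y) V' = 0 \<and>
      \<psi> y * wedge U (c' - e y) + wedge V U' = 0 \<and> wedge V (c' - e y) + \<psi> y * wedge U V' = 0 \<and>
      wedge (c - e y) (c' - e y) = 0"
    if y: "y \<in> Y" for y
  proof -
    have \<eta>: "\<psi> y \<noteq> 0" using y Y nz by blast
    have "\<psi> y * wedge V V' + (\<psi> y * wedge (c - e y) V') * \<phi> x
      + (wedge V (c' - e y) + \<psi> y * wedge U V') * \<phi> x ^ 2 + wedge (c - e y) (c' - e y) * \<phi> x ^ 3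
      + (wedge U (c' - e y) + 1 / \<psi> y * wedge V U') * \<phi> x ^ 4
      + (1 / \<psi> y * wedge (c - e y) U') * \<phi> x ^ 5 + (1 / \<psi> y * wedge U U') * \<phi> x ^ 6 = 0"
      if x: "x \<in> carrier H" for x
    proof -
      have "\<phi> x * (1 / \<phi> x) = 1" "1 / \<phi> x ^ 2 = (1 / \<phi> x) ^ 2"
        using nz(1) [OF x] by (simp_all add: power_one_over)
      with expand [OF x y] show ?thesis unfolding eq [OF x] by algebra
    qed
    from poly7_eq_0 [OF fin \<phi>(2) _ this] order_ge_9 \<eta> show ?thesis
      by (simp add: field_simps)
  qed
  obtain y where y: "y \<in> Y" "c - e y \<noteq> 0"
    using not_constant_e [of c] by (metis eq_iff_diff_eq_0)
  define p p' where "p = c - e y" and "p' = c' - e y"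
  have p0: "p \<noteq> 0" and co: "wedge U U' = 0" "wedge V V' = 0" "wedge p U' = 0" "wedge p V' = 0"
      "\<psi> y * wedge U p' + wedge V U' = 0" "wedge V p' + \<psi> y * wedge U V' = 0" "wedge p p' = 0"
    using y(2) coeffs [OF y(1)] by (simp_all add: p_def p'_def)
  have \<eta>: "\<psi> y \<noteq> 0" using y Y nz by blast
  from UV'(2) show ?thesis
  proof
    assume U': "U' \<noteq> 0"
    have "wedge U p = 0" using co(1,3) U' wedge_trans wedge_swap_eq_0 by metis
    then have "wedge U p' = 0" using co(7) p0 wedge_trans by metis
    with co(5) have "wedge V U' = 0" by simp
    then show ?thesis using co(1) U' wedge_trans wedge_swap_eq_0 by metis
  next
    assume V': "V' \<noteq> 0"
    have "wedge V p = 0" using co(2,4) V' wedge_trans wedge_swap_eq_0 by metis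
    then have "wedge V p' = 0" using co(7) p0 wedge_trans by metis
    with co(6) \<eta> have "wedge U V' = 0" by simp
    then show ?thesis using co(2) V' wedge_trans wedge_swap_eq_0 by metis
  qed
qed

text \<open>The coincidences left open by \<open>aligned_generic\<close> are
  \<open>\<psi> = \<phi>\<close>, \<open>\<psi> = \<phi>^2\<close> and the same two for
  \<open>1 / \<psi>\<close>; the latter reduce to the former by \<open>inverted\<close>.\<close>

lemma wedge_UV: "wedge U V = 0"
proof -
  interpret I: pair_relation H \<phi> "\<lambda>x. 1 / \<psi> x" c c' U V V' U' Y e by (rule inverted)
  consider "\<forall>x\<in>carrier H. \<phi> x = \<psi> x" | "\<forall>x\<in>carrier H. \<phi> x * \<psi> x = 1"
    | "\<forall>x\<in>carrier H. \<phi> x ^ 2 = \<psi> x" | "\<forall>x\<in>carrier H. \<phi> x ^ 2 * \<psi> x = 1"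
    | "\<exists>x\<in>carrier H. \<phi> x * \<psi> x \<noteq> 1" "\<exists>x\<in>carrier H. \<phi> x \<noteq> \<psi> x"
      "\<exists>x\<in>carrier H. \<phi> x ^ 2 * \<psi> x \<noteq> 1" "\<exists>x\<in>carrier H. \<phi> x ^ 2 \<noteq> \<psi> x"
    by blast
  then show ?thesis
  proof cases
    case 1
    then show ?thesis by (intro equal_wedge) simp
  next
    case 2
    then show ?thesis using nz by (intro I.equal_wedge) (simp add: divide_eq_eq)
  next
    case 3
    then show ?thesis by (intro double_wedge) simp
  next
    case 4
    then show ?thesis using nz by (intro I.double_wedge) (simp add: divide_eq_eq)
  next
    case 5
    then show ?thesis by (intro collapse_left aligned_generic)
  qed
qed

text \<open>Only the characters 1, \<open>\<phi>\<close>, \<open>\<psi>\<close> and their product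
  remain. If the product is nontrivial, a character sum isolates \<open>wedge U U'\<close>. If it is
  trivial, this coefficient merges with the constant one; but then the coefficients of
  \<open>\<phi>\<close> and \<open>\<psi>\<close> vanish, which makes all differences of the points
  \<open>e y\<close> parallel to both \<open>U\<close> and \<open>U'\<close>.\<close>

lemma aligned_base:
  assumes V: "V = 0" "V' = 0"
  shows "wedge U U' = 0"
proof (cases "\<exists>x\<in>carrier H. \<phi> x * \<psi> x \<noteq> 1")
  case True
  obtain y where y: "y \<in> Y" "y \<in> carrier H" using Y by (metis card.empty ex_in_conv not_numeral_le_zero subsetD)
  let ?H = "carrier H"
  have ch: "grp_char H (\<lambda>x. inverse (\<phi> x))" "grp_char H (\<lambda>x. inverse (\<psi> x))"
    "grp_char H (\<lambda>x. inverse (\<phi> x) * inverse (\<psi> x))"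
    by (intro grp_char_mult grp_char_inverse \<phi> \<psi>)+
  have "\<exists>x\<in>?H. \<phi> x ^ 1 \<noteq> 1" "\<exists>x\<in>?H. \<psi> x ^ 1 \<noteq> 1" by (rule distinct_of_order; simp)+
  then have s: "(\<Sum>x\<in>?H. inverse (\<phi> x)) = 0" "(\<Sum>x\<in>?H. inverse (\<psi> x)) = 0"
    "(\<Sum>x\<in>?H. inverse (\<phi> x) * inverse (\<psi> x)) = 0"
    using sum_grp_char [OF ch(1)] sum_grp_char [OF ch(2)] sum_grp_char [OF ch(3)] True
    by (auto simp flip: inverse_mult_distrib)
  have "0 = (\<Sum>x\<in>?H. inverse (\<phi> x) * inverse (\<psi> x) * wedge (c - e y) (c' - e y)
    + inverse (\<psi> x) * wedge U (c' - e y) + inverse (\<phi> x) * (1 / \<psi> y * wedge (c - e y) U')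
    + 1 / \<psi> y * wedge U U')"
  proof (rule sum.neutral [symmetric], rule ballI)
    fix x assume x: "x \<in> ?H"
    have "inverse (\<phi> x) * \<phi> x = 1" "inverse (\<psi> x) * \<psi> x = 1" using nz [OF x] by simp_all
    with expand [OF x y(1)] show "inverse (\<phi> x) * inverse (\<psi> x) * wedge (c - e y) (c' - e y)
      + inverse (\<psi> x) * wedge U (c' - e y) + inverse (\<phi> x) * (1 / \<psi> y * wedge (c - e y) U')
      + 1 / \<psi> y * wedge U U' = 0"
      unfolding V wedge_simps mult_zero_right add_0_right by algebra
  qed
  also have "\<dots> = of_nat (card ?H) * (1 / \<psi> y * wedge U U')"
    by (simp add: sum.distrib s flip: sum_distrib_right sum_divide_distrib)
  finally show ?thesis using char nz(2) [OF y(2)] by simp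
next
  case False
  then have eq: "\<psi> x = inverse (\<phi> x)" if "x \<in> carrier H" for x
    using that nz by (metis inverse_unique)
  let ?H = "carrier H"
  have ch: "grp_char H (\<lambda>x. inverse (\<phi> x) ^ 2)" "grp_char H (\<lambda>x. inverse (\<phi> x))" "grp_char H (\<lambda>x. \<phi> x ^ 2)"
    by (intro grp_char_power grp_char_inverse \<phi>)+
  have "\<exists>x\<in>?H. \<phi> x ^ 1 \<noteq> 1" "\<exists>x\<in>?H. \<phi> x ^ 2 \<noteq> 1" by (rule distinct_of_order; simp)+
  then obtain t1 t2 where t: "t1 \<in> ?H" "\<phi> t1 \<noteq> 1" "t2 \<in> ?H" "\<phi> t2 ^ 2 \<noteq> 1" by auto
  then have "inverse (\<phi> t1) \<noteq> 1" "inverse (\<phi> t2) ^ 2 \<noteq> 1"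
    by (simp_all add: power_inverse)
  then have s: "(\<Sum>x\<in>?H. inverse (\<phi> x)) = 0" "(\<Sum>x\<in>?H. inverse (\<phi> x) ^ 2) = 0"
    "(\<Sum>x\<in>?H. \<phi> x) = 0" "(\<Sum>x\<in>?H. \<phi> x ^ 2) = 0"
    using sum_grp_char [OF ch(1) t(3)] sum_grp_char [OF ch(2) t(1)] sum_grp_char [OF ch(3) t(3)]
      sum_grp_char [OF \<phi>(1) t(1)] t by blast+
  have co: "wedge U (c' - e y) = 0" "wedge (c - e y) U' = 0" if y: "y \<in> Y" for y
  proof -
    have E: "wedge (c - e y) (c' - e y) + \<phi> x * wedge U (c' - e y)
      + inverse (\<phi> x) * (1 / \<psi> y * wedge (c - e y) U') + 1 / \<psi> y * wedge U U' = 0"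
      "inverse (\<phi> x) * \<phi> x = 1" if x: "x \<in> ?H" for x
      using expand [OF x y] nz [OF x] unfolding V wedge_simps mult_zero_right add_0_right eq [OF x] by auto
    have "0 = (\<Sum>x\<in>?H. inverse (\<phi> x) * (wedge (c - e y) (c' - e y) + 1 / \<psi> y * wedge U U') + wedge U (c' - e y)
      + inverse (\<phi> x) ^ 2 * (1 / \<psi> y * wedge (c - e y) U'))"
    proof (rule sum.neutral [symmetric], rule ballI)
      fix x assume "x \<in> ?H"
      from E [OF this] show "inverse (\<phi> x) * (wedge (c - e y) (c' - e y) + 1 / \<psi> y * wedge U U') + wedge U (c' - e y)
        + inverse (\<phi> x) ^ 2 * (1 / \<psi> y * wedge (c - e y) U') = 0"
        by algebra
    qed
    also have "\<dots> = of_nat (card ?H) * wedge U (c' - e y)"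
      by (simp only: sum.distrib s flip: sum_distrib_right) simp
    finally show "wedge U (c' - e y) = 0" using char by simp
    have "0 = (\<Sum>x\<in>?H. \<phi> x * (wedge (c - e y) (c' - e y) + 1 / \<psi> y * wedge U U') + \<phi> x ^ 2 * wedge U (c' - e y)
      + (1 / \<psi> y * wedge (c - e y) U'))"
    proof (rule sum.neutral [symmetric], rule ballI)
      fix x assume "x \<in> ?H"
      from E [OF this] show "\<phi> x * (wedge (c - e y) (c' - e y) + 1 / \<psi> y * wedge U U') + \<phi> x ^ 2 * wedge U (c' - e y)
        + (1 / \<psi> y * wedge (c - e y) U') = 0"
        by algebra
    qed
    also have "\<dots> = of_nat (card ?H) * (1 / \<psi> y * wedge (c - e y) U')"
      by (simp only: sum.distrib s flip: sum_distrib_right) simp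
    finally show "wedge (c - e y) U' = 0" using char y Y nz by auto
  qed
  show ?thesis
  proof (rule ccontr)
    assume ne: "wedge U U' \<noteq> 0"
    obtain y0 where y0: "y0 \<in> Y" using Y by (metis card.empty ex_in_conv not_numeral_le_zero)
    have "e y = e y0" if y: "y \<in> Y" for y
    proof -
      have "wedge U (e y0 - e y) = 0" "wedge (e y0 - e y) U' = 0"
        using co [OF y] co [OF y0] by (auto simp: wedge_distribs)
      then have "e y0 - e y = 0"
        using ne wedge_zero_unique wedge_swap_eq_0 by metis
      then show ?thesis by simp
    qed
    then show False by (rule not_constant_e)
  qed
qed

text \<open>By the first two claims one of \<open>U\<close>, \<open>V\<close> is 0, and likewise for
  \<open>U'\<close>, \<open>V'\<close>. The sum \<open>U + V\<close> is thus the nonzero one of the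
  two, and the third claim covers four cases at once; inversion and swapping reduce each to
  \<open>aligned_base\<close>.\<close>

theorem aligned: "wedge U V = 0" "wedge U' V' = 0" "wedge (U + V) (U' + V') = 0"
proof -
  interpret S: pair_relation H \<psi> \<phi> c' c U' V' U V "(\<lambda>y. inv y) ` Y" "\<lambda>y. e (inv y)" by (rule swapped)
  show UV0: "wedge U V = 0" and UV0': "wedge U' V' = 0" by (rule wedge_UV S.wedge_UV)+
  note I = inverted and SI = S.inverted
  note SIS = pair_relation.swapped [OF SI]
  note SISI = pair_relation.inverted [OF SIS]
  show "wedge (U + V) (U' + V') = 0"
    using UV(1) [OF UV0] UV'(1) [OF UV0'] aligned_base pair_relation.aligned_base [OF I]
      pair_relation.aligned_base [OF SI] pair_relation.aligned_base [OF SISI] wedge_swap_eq_0 [of U' V]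
    by auto
qed

end

section \<open>Affine multinets with a long line at infinity\<close>

lemma (in group) cancel_assoc:
  "a \<in> carrier G \<Longrightarrow> b \<in> carrier G \<Longrightarrow> a \<otimes> (inv a \<otimes> b) = b"
  "a \<in> carrier G \<Longrightarrow> b \<in> carrier G \<Longrightarrow> inv a \<otimes> (a \<otimes> b) = b"
  by (simp_all flip: m_assoc)

text \<open>The points with index in the subgroup \<open>H\<close> lie at infinity and are given by their directions
  \<open>d1\<close>, \<open>d2\<close>, \<open>d3\<close>; the other ones are the affine points \<open>A1\<close>, \<open>A2\<close>, \<open>A3\<close>.\<close>

locale affine_multinet = group G for G (structure) +
  fixes H :: "'a set" and A1 A2 A3 d1 d2 d3 :: "'a \<Rightarrow> 'k::alg_closed_field ^ 2"
  assumes fin: "finite (carrier G)" and H: "subgroup H G" and order_ge_9: "card H \<ge> 9"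
    and char: "\<And>m. 0 < m \<Longrightarrow> m \<le> card (carrier G) \<Longrightarrow> of_nat m \<noteq> (0::'k)"
    and inj: "inj_on A1 (carrier G - H)" "inj_on A2 (carrier G - H)" "inj_on A3 (carrier G - H)"
    and nonparallel: "\<And>x y. x \<in> H \<Longrightarrow> y \<in> H \<Longrightarrow> x \<noteq> y \<Longrightarrow> wedge (d1 x) (d1 y) \<noteq> 0"
      "\<And>x y. x \<in> H \<Longrightarrow> y \<in> H \<Longrightarrow> x \<noteq> y \<Longrightarrow> wedge (d2 x) (d2 y) \<noteq> 0"
      "\<And>x y. x \<in> H \<Longrightarrow> y \<in> H \<Longrightarrow> x \<noteq> y \<Longrightarrow> wedge (d3 x) (d3 y) \<noteq> 0"
    and join23: "\<And>x y. x \<in> H \<Longrightarrow> y \<in> carrier G - H \<Longrightarrow> wedge (A3 (x \<otimes> y) - A2 y) (d1 x) = 0"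
    and join13: "\<And>x y. x \<in> carrier G - H \<Longrightarrow> y \<in> H \<Longrightarrow> wedge (A3 (x \<otimes> y) - A1 x) (d2 y) = 0"
    and join12: "\<And>x y. x \<in> carrier G - H \<Longrightarrow> y \<in> carrier G - H \<Longrightarrow> x \<otimes> y \<in> H \<Longrightarrow>
      wedge (A1 x - A2 y) (d3 (x \<otimes> y)) = 0"
    and join123: "\<And>x y. x \<in> carrier G - H \<Longrightarrow> y \<in> carrier G - H \<Longrightarrow> x \<otimes> y \<in> carrier G - H \<Longrightarrow>
      wedge (A1 x - A3 (x \<otimes> y)) (A2 y - A3 (x \<otimes> y)) = 0"
begin

abbreviation "X \<equiv> carrier G - H"
abbreviation "HG \<equiv> G\<lparr>carrier := H\<rparr>"

lemma H_carrier: "k \<in> H \<Longrightarrow> k \<in> carrier G"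
  using H by (rule subgroup.mem_carrier)

lemma H_closed [simp]: "\<one> \<in> H" "k \<in> H \<Longrightarrow> l \<in> H \<Longrightarrow> k \<otimes> l \<in> H" "k \<in> H \<Longrightarrow> inv k \<in> H"
  using H by (auto intro: subgroup.one_closed subgroup.m_closed subgroup.m_inv_closed)

lemma X_carrier: "g \<in> X \<Longrightarrow> g \<in> carrier G"
  by simp

lemma X_left: "k \<in> H \<Longrightarrow> g \<in> X \<Longrightarrow> k \<otimes> g \<in> X"
proof -
  assume k: "k \<in> H" and g: "g \<in> X"
  have "inv k \<otimes> (k \<otimes> g) = g" using k g H_carrier by (simp add: m_assoc [symmetric])
  then have "k \<otimes> g \<notin> H" using k g H_closed(2,3) by (metis DiffD2)
  then show ?thesis using k g H_carrier by simp
qed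

lemma X_right: "g \<in> X \<Longrightarrow> k \<in> H \<Longrightarrow> g \<otimes> k \<in> X"
proof -
  assume k: "k \<in> H" and g: "g \<in> X"
  have "(g \<otimes> k) \<otimes> inv k = g" using k g H_carrier by (simp add: m_assoc)
  then have "g \<otimes> k \<notin> H" using k g H_closed(2,3) by (metis DiffD2)
  then show ?thesis using k g H_carrier by simp
qed

lemma X_inv: "g \<in> X \<Longrightarrow> inv g \<in> X"
  using H_closed(3) by (metis Diff_iff inv_closed inv_inv)

lemma fin_H: "finite H"
  using fin H by (metis finite_subset subgroup.subset)

lemma card_H_le: "card H \<le> card (carrier G)"
  using fin H by (metis card_mono subgroup.subset)

lemma inv_HG: "k \<in> H \<Longrightarrow> inv\<^bsub>HG\<^esub> k = inv k"
  using m_inv_consistent [OF H] by simp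

lemma HG_group: "group HG"
  using H group_axioms by (rule subgroup.subgroup_is_group)

lemma card_H_char: "of_nat (card H) \<noteq> (0::'k)"
  using char [of "card H"] card_H_le order_ge_9 by auto

lemma sum_H_inv: "(\<Sum>k\<in>H. f (inv k)) = (\<Sum>k\<in>H. f k)"
  using group.sum_inv [OF HG_group, of f] by (simp add: inv_HG cong: sum.cong)

lemma exists_nontrivial: obtains k where "k \<in> H" "k \<noteq> \<one>"
proof -
  have "card (H - {\<one>}) \<noteq> 0" using order_ge_9 fin_H by (simp add: card_Diff_singleton)
  then show thesis using that by (metis Diff_iff card_eq_0_iff ex_in_conv insertI1)
qed

text \<open>The relation \<open>x y = z\<close> reads \<open>z y\<inverse> = x\<close> and \<open>y\<inverse> x\<inverse> = z\<inverse>\<close>, so the three components can be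
  permuted at the cost of inverting some of the labels.\<close>

lemma para_rho: "affine_multinet G H A3 (\<lambda>x. A2 (inv x)) A1 d3 (\<lambda>x. d2 (inv x)) d1"
proof (intro affine_multinet.intro affine_multinet_axioms.intro group_axioms; (rule fin H order_ge_9 char inj)?)
  have "inj_on (\<lambda>x. inv x) X" by (intro inj_onI) (metis Diff_iff inv_inv)
  then show "inj_on (\<lambda>x. A2 (inv x)) X"
    using inj(2) X_inv by (intro inj_onI) (metis inj_onD inv_inv X_carrier)
  fix x y
  show "wedge (d2 (inv x)) (d2 (inv y)) \<noteq> 0" if "x \<in> H" "y \<in> H" "x \<noteq> y"
    using that nonparallel(2) [of "inv x" "inv y"] H_carrier by (metis H_closed(3) inv_inv)
  show "wedge (d3 x) (d3 y) \<noteq> 0" "wedge (d1 x) (d1 y) \<noteq> 0" if "x \<in> H" "y \<in> H" "x \<noteq> y"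
    using that nonparallel by auto
  show "wedge (A1 (x \<otimes> y) - A2 (inv y)) (d3 x) = 0" if "x \<in> H" "y \<in> X"
    using join12 [of "x \<otimes> y" "inv y"] that X_left [OF that] X_inv [of y] H_carrier by (simp add: m_assoc)
  show "wedge (A1 (x \<otimes> y) - A3 x) (d2 (inv y)) = 0" if "x \<in> X" "y \<in> H"
  proof -
    have "wedge (A3 x - A1 (x \<otimes> y)) (d2 (inv y)) = 0"
      using join13 [of "x \<otimes> y" "inv y"] that X_right [OF that] H_carrier by (simp add: m_assoc)
    then show ?thesis by (simp add: wedge_distribs)
  qed
  show "wedge (A3 x - A2 (inv y)) (d1 (x \<otimes> y)) = 0" if "x \<in> X" "y \<in> X" "x \<otimes> y \<in> H"
    using join23 [of "x \<otimes> y" "inv y"] that X_inv [of y] by (simp add: m_assoc)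
  show "wedge (A3 x - A1 (x \<otimes> y)) (A2 (inv y) - A1 (x \<otimes> y)) = 0" if "x \<in> X" "y \<in> X" "x \<otimes> y \<in> X"
  proof -
    have "wedge (A1 (x \<otimes> y) - A3 x) (A2 (inv y) - A3 x) = 0"
      using join123 [of "x \<otimes> y" "inv y"] that X_inv [of y] by (simp add: m_assoc)
    then show ?thesis by (simp add: wedge_def algebra_simps)
  qed
qed

lemma para_sigma: "affine_multinet G H (\<lambda>x. A2 (inv x)) (\<lambda>x. A1 (inv x)) (\<lambda>x. A3 (inv x))
  (\<lambda>x. d2 (inv x)) (\<lambda>x. d1 (inv x)) (\<lambda>x. d3 (inv x))"
proof (intro affine_multinet.intro affine_multinet_axioms.intro group_axioms; (rule fin H order_ge_9 char)?)
  have I: "inj_on (\<lambda>x. B (inv x)) X" if "inj_on B X" for B :: "'a \<Rightarrow> 'k ^ 2"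
    using that X_inv by (intro inj_onI) (metis inj_onD inv_inv X_carrier)
  show "inj_on (\<lambda>x. A2 (inv x)) X" "inj_on (\<lambda>x. A1 (inv x)) X" "inj_on (\<lambda>x. A3 (inv x)) X"
    using inj by (simp_all only: I)
  fix x y
  show "wedge (d2 (inv x)) (d2 (inv y)) \<noteq> 0" "wedge (d1 (inv x)) (d1 (inv y)) \<noteq> 0"
    "wedge (d3 (inv x)) (d3 (inv y)) \<noteq> 0" if "x \<in> H" "y \<in> H" "x \<noteq> y"
    using that nonparallel [of "inv x" "inv y"] H_carrier by (metis H_closed(3) inv_inv)+
  show "wedge (A3 (inv (x \<otimes> y)) - A1 (inv y)) (d2 (inv x)) = 0" if "x \<in> H" "y \<in> X"
    using join13 [of "inv y" "inv x"] that X_inv [of y] H_carrier by (simp add: inv_mult_group)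
  show "wedge (A3 (inv (x \<otimes> y)) - A2 (inv x)) (d1 (inv y)) = 0" if "x \<in> X" "y \<in> H"
    using join23 [of "inv y" "inv x"] that X_inv [of x] H_carrier by (simp add: inv_mult_group)
  show "wedge (A2 (inv x) - A1 (inv y)) (d3 (inv (x \<otimes> y))) = 0" if "x \<in> X" "y \<in> X" "x \<otimes> y \<in> H"
  proof -
    have "inv y \<otimes> inv x \<in> H" using H_closed(3) [OF that(3)] that inv_mult_group [of x y] by (metis DiffD1)
    then have "wedge (A1 (inv y) - A2 (inv x)) (d3 (inv (x \<otimes> y))) = 0"
      using join12 [of "inv y" "inv x"] that X_inv [of x] X_inv [of y] by (simp add: inv_mult_group)
    then show ?thesis by (simp add: wedge_distribs)
  qed
  show "wedge (A2 (inv x) - A3 (inv (x \<otimes> y))) (A1 (inv y) - A3 (inv (x \<otimes> y))) = 0"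
    if "x \<in> X" "y \<in> X" "x \<otimes> y \<in> X"
  proof -
    have "inv y \<otimes> inv x \<in> X" using X_inv [OF that(3)] that by (simp add: inv_mult_group)
    then have "wedge (A1 (inv y) - A3 (inv (x \<otimes> y))) (A2 (inv x) - A3 (inv (x \<otimes> y))) = 0"
      using join123 [of "inv y" "inv x"] that X_inv [of x] X_inv [of y] by (simp add: inv_mult_group)
    then show ?thesis using wedge_swap_eq_0 by blast
  qed
qed

text \<open>For each \<open>g\<close> the families \<open>A2\<close> and \<open>A3\<close> on the
  right coset of \<open>g\<close> are a solution for the same directions \<open>d1\<close>. This is
  why a single character and frame serve all right cosets; injectivity of \<open>A2\<close> supplies
  the nonconstant solution that \<open>net_form\<close> requires.\<close>

lemma right_form:
  assumes "g0 \<in> X"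
  obtains \<theta> P Q where "grp_char HG \<theta>" "inj_on \<theta> H" "wedge P Q \<noteq> 0"
    "\<And>g. g \<in> X \<Longrightarrow> \<exists>c u v. \<forall>k\<in>H. A2 (k \<otimes> g) = c + (u * \<theta> k) *s P + (v / \<theta> k) *s Q \<and>
      A3 (k \<otimes> g) = c + (u * \<theta> k) *s Q + (v / \<theta> k) *s P"
proof -
  interpret N: line_net HG d1
    using HG_group fin_H order_ge_9 char card_H_le nonparallel(1)
    by (intro line_net.intro line_net_axioms.intro) simp_all
  have s: "N.sol (\<lambda>k. A2 (k \<otimes> g)) (\<lambda>k. A3 (k \<otimes> g))" if g: "g \<in> X" for g
    unfolding N.sol_def using join23 g X_left [OF _ g] H_carrier by (simp add: m_assoc)
  obtain k where k: "k \<in> H" "k \<noteq> \<one>" by (rule exists_nontrivial)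
  have "k \<otimes> g0 \<noteq> \<one> \<otimes> g0" using k assms H_carrier by (simp only: right_cancel X_carrier one_closed) simp
  then have "N.nonconst (\<lambda>k. A2 (k \<otimes> g0))"
    unfolding N.nonconst_def using k assms inj_onD [OF inj(2)] X_left [OF _ assms]
    by simp (metis H_closed(1))
  from N.net_form [OF s [OF assms] this] obtain \<theta> P Q where *: "grp_char HG \<theta>" "inj_on \<theta> (carrier HG)" "wedge P Q \<noteq> 0"
    "\<And>a b. N.sol a b \<Longrightarrow> \<exists>c u v. \<forall>y\<in>carrier HG.
      a y = c + (u * \<theta> y) *s P + (v / \<theta> y) *s Q \<and> b y = c + (u * \<theta> y) *s Q + (v / \<theta> y) *s P" by blast
  show thesis
    by (rule that [of \<theta> P Q]) (use * s in auto)
qed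

text \<open>The mirror image of \<open>right_form\<close> under \<open>para_sigma\<close>. Labels
  are inverted there, hence the parametrisation by \<open>g \<otimes> inv k\<close>.\<close>

lemma left_form:
  assumes "g0 \<in> X"
  obtains \<theta> P Q where "grp_char HG \<theta>" "inj_on \<theta> H" "wedge P Q \<noteq> 0"
    "\<And>g. g \<in> X \<Longrightarrow> \<exists>c u v. \<forall>k\<in>H. A1 (g \<otimes> inv k) = c + (u * \<theta> k) *s P + (v / \<theta> k) *s Q \<and>
      A3 (g \<otimes> inv k) = c + (u * \<theta> k) *s Q + (v / \<theta> k) *s P"
proof -
  interpret S: affine_multinet G H "\<lambda>x. A2 (inv x)" "\<lambda>x. A1 (inv x)" "\<lambda>x. A3 (inv x)"
    "\<lambda>x. d2 (inv x)" "\<lambda>x. d1 (inv x)" "\<lambda>x. d3 (inv x)" by (rule para_sigma)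
  obtain \<theta> P Q where *: "grp_char HG \<theta>" "inj_on \<theta> H" "wedge P Q \<noteq> 0"
    "\<And>g. g \<in> X \<Longrightarrow> \<exists>c u v. \<forall>k\<in>H. A1 (inv (k \<otimes> g)) = c + (u * \<theta> k) *s P + (v / \<theta> k) *s Q \<and>
      A3 (inv (k \<otimes> g)) = c + (u * \<theta> k) *s Q + (v / \<theta> k) *s P"
    by (rule S.right_form [OF assms]) blast
  have "\<exists>c u v. \<forall>k\<in>H. A1 (g \<otimes> inv k) = c + (u * \<theta> k) *s P + (v / \<theta> k) *s Q \<and>
      A3 (g \<otimes> inv k) = c + (u * \<theta> k) *s Q + (v / \<theta> k) *s P" if g: "g \<in> X" for g
    using *(4) [OF X_inv [OF g]] g H_carrier by (simp add: inv_mult_group cong: ball_cong)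
  with * that show thesis by blast
qed

lemma HG_char:
  assumes "grp_char HG \<theta>"
  shows "\<theta> \<one> = 1" "k \<in> H \<Longrightarrow> \<theta> k \<noteq> 0" "k \<in> H \<Longrightarrow> \<theta> (inv k) = 1 / \<theta> k"
    "k \<in> H \<Longrightarrow> l \<in> H \<Longrightarrow> \<theta> (k \<otimes> l) = \<theta> k * \<theta> l"
  using group.grp_char_one [OF HG_group assms] group.grp_char_inv [OF HG_group assms, of k] assms
  by (auto simp: grp_char_def inv_HG)

lemma HG_char_sum:
  assumes "grp_char HG \<theta>" "inj_on \<theta> H"
  shows "(\<Sum>k\<in>H. \<theta> k) = 0" "(\<Sum>k\<in>H. 1 / \<theta> k) = 0"
proof -
  obtain k where k: "k \<in> H" "k \<noteq> \<one>" by (rule exists_nontrivial)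
  then have "\<theta> k \<noteq> 1" using assms(2) HG_char(1) [OF assms(1)] by (metis H_closed(1) inj_onD)
  then show 1: "(\<Sum>k\<in>H. \<theta> k) = 0"
    using group.sum_grp_char [OF HG_group assms(1), of k] k by simp
  show "(\<Sum>k\<in>H. 1 / \<theta> k) = 0"
    using sum_H_inv [of \<theta>] 1 HG_char(3) [OF assms(1)] by (simp cong: sum.cong)
qed

text \<open>The indices \<open>y\<close> with \<open>g y q \<in> H\<close> are at most as many as the others, since together they form a
  coset of a proper subgroup of \<open>H\<close>.\<close>

lemma large_intersection:
  assumes g: "g \<in> X" and q: "q \<in> X" and y: "y \<in> H" "g \<otimes> y \<otimes> q \<in> X"
  shows "card {y \<in> H. g \<otimes> inv y \<otimes> q \<in> X} \<ge> 5"
proof -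
  let ?Y = "{y \<in> H. g \<otimes> y \<otimes> q \<in> X}" and ?Z = "{y \<in> H. g \<otimes> y \<otimes> q \<in> H}"
  have HYZ: "H = ?Y \<union> ?Z" using g q H_carrier by auto
  have disj: "?Y \<inter> ?Z = {}" by auto
  have "card ?Z \<le> card ?Y"
  proof (cases "?Z = {}")
    case False
    then obtain z where z: "z \<in> H" "g \<otimes> z \<otimes> q \<in> H" by auto
    show ?thesis
    proof (rule card_inj_on_le [of "\<lambda>x. y \<otimes> inv z \<otimes> x"])
      show "inj_on (\<lambda>x. y \<otimes> inv z \<otimes> x) ?Z"
        using y z by (intro inj_onI) (simp add: H_carrier)
      show "(\<lambda>x. y \<otimes> inv z \<otimes> x) ` ?Z \<subseteq> ?Y"
      proof clarsimp
        fix x assume x: "x \<in> H" "g \<otimes> x \<otimes> q \<in> H"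
        have e: "g \<otimes> (y \<otimes> inv z \<otimes> x) \<otimes> q = (g \<otimes> y \<otimes> q) \<otimes> (inv (g \<otimes> z \<otimes> q) \<otimes> (g \<otimes> x \<otimes> q))"
          using g q x(1) y(1) z(1)
          by (simp add: H_carrier inv_mult_group m_assoc cancel_assoc)
        have "(g \<otimes> y \<otimes> q) \<otimes> (inv (g \<otimes> z \<otimes> q) \<otimes> (g \<otimes> x \<otimes> q)) \<in> X"
          by (rule X_right [OF y(2)]) (use x z in simp)
        then show "y \<otimes> inv z \<otimes> x \<in> H \<and> g \<otimes> (y \<otimes> inv z \<otimes> x) \<otimes> q \<in> carrier G \<and> g \<otimes> (y \<otimes> inv z \<otimes> x) \<otimes> q \<notin> H"
          unfolding e [symmetric] using x(1) y(1) z(1) by auto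
      qed
    qed (use fin_H in simp)
  next
    case True
    show ?thesis unfolding True by simp
  qed
  moreover have "card H = card ?Y + card ?Z"
    using HYZ disj fin_H by (metis (no_types, lifting) card_Un_disjoint finite_Un)
  ultimately have "card ?Y \<ge> 5" using order_ge_9 by linarith
  moreover have "card {y \<in> H. g \<otimes> inv y \<otimes> q \<in> X} = card ?Y"
    by (rule bij_betw_same_card [of "\<lambda>y. inv y"], rule bij_betw_byWitness [where f' = "\<lambda>y. inv y"])
      (use H_carrier in auto)
  ultimately show ?thesis by simp
qed

text \<open>The product of \<open>g \<otimes> inv x\<close> and
  \<open>x \<otimes> inv y \<otimes> q\<close> does not depend on \<open>x\<close>. So for fixed
  \<open>y\<close> the point \<open>A3 (g \<otimes> inv y \<otimes> q)\<close> sees the left coset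
  of \<open>g\<close> in \<open>A1\<close> and the right coset of \<open>q\<close> in
  \<open>A2\<close> in perspective, which is the situation of \<open>pair_relation\<close>.\<close>

lemma pair_parallel:
  assumes g: "g \<in> X" and q: "q \<in> X" and y: "y \<in> H" "g \<otimes> y \<otimes> q \<in> X" and k: "k \<in> H" "l \<in> H"
  shows "wedge (A1 (g \<otimes> k) - A1 g) (A2 (l \<otimes> q) - A2 q) = 0"
proof -
  obtain \<phi> P Q where \<phi>: "grp_char HG \<phi>" "inj_on \<phi> H" and PQ: "wedge P Q \<noteq> 0" and
    *: "\<And>g. g \<in> X \<Longrightarrow> \<exists>c u v. \<forall>k\<in>H. A1 (g \<otimes> inv k) = c + (u * \<phi> k) *s P + (v / \<phi> k) *s Q \<and>
      A3 (g \<otimes> inv k) = c + (u * \<phi> k) *s Q + (v / \<phi> k) *s P"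
    by (rule left_form [OF g]) blast
  obtain c u v where 1: "\<And>k. k \<in> H \<Longrightarrow> A1 (g \<otimes> inv k) = c + (u * \<phi> k) *s P + (v / \<phi> k) *s Q"
    using * [OF g] by blast
  obtain \<psi> P' Q' where \<psi>: "grp_char HG \<psi>" "inj_on \<psi> H" and PQ': "wedge P' Q' \<noteq> 0" and
    *: "\<And>g. g \<in> X \<Longrightarrow> \<exists>c u v. \<forall>k\<in>H. A2 (k \<otimes> g) = c + (u * \<psi> k) *s P' + (v / \<psi> k) *s Q' \<and>
      A3 (k \<otimes> g) = c + (u * \<psi> k) *s Q' + (v / \<psi> k) *s P'"
    by (rule right_form [OF q]) blast
  obtain c' u' v' where 2: "\<And>k. k \<in> H \<Longrightarrow> A2 (k \<otimes> q) = c' + (u' * \<psi> k) *s P' + (v' / \<psi> k) *s Q'"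
    using * [OF q] by blast
  obtain t where t: "t \<in> H" "t \<noteq> \<one>" by (rule exists_nontrivial)
  have uv: "u \<noteq> 0 \<or> v \<noteq> 0"
  proof (rule ccontr)
    assume "\<not> ?thesis"
    then have "A1 (g \<otimes> inv t) = A1 (g \<otimes> inv \<one>)" using 1 [OF t(1)] 1 [of \<one>] by simp
    then have "g \<otimes> inv t = g \<otimes> inv \<one>" using g t X_right by (metis H_closed inj_onD inj(1))
    then show False using g t H_carrier by (metis Units_eq Units_l_cancel X_carrier inv_closed inv_inv one_closed)
  qed
  have uv': "u' \<noteq> 0 \<or> v' \<noteq> 0"
  proof (rule ccontr)
    assume "\<not> ?thesis"
    then have "A2 (t \<otimes> q) = A2 (\<one> \<otimes> q)" using 2 [OF t(1)] 2 [of \<one>] by simp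
    then have "t \<otimes> q = \<one> \<otimes> q" using q t X_left by (metis H_closed(1) inj_onD inj(2))
    then show False using q t H_carrier by (metis X_carrier one_closed right_cancel)
  qed
  define Y where "Y = {y \<in> H. g \<otimes> inv y \<otimes> q \<in> X}"
  interpret pair_relation HG \<phi> \<psi> c c' "u *s P" "v *s Q" "u' *s P'" "v' *s Q'" Y "\<lambda>y. A3 (g \<otimes> inv y \<otimes> q)"
  proof (intro pair_relation.intro pair_relation_axioms.intro HG_group)
    show "inj_on (\<lambda>y. A3 (g \<otimes> inv y \<otimes> q)) Y"
    proof (rule inj_onI)
      fix x y assume xy: "x \<in> Y" "y \<in> Y" "A3 (g \<otimes> inv x \<otimes> q) = A3 (g \<otimes> inv y \<otimes> q)"
      then have "g \<otimes> inv x \<otimes> q = g \<otimes> inv y \<otimes> q" using inj(3) by (auto simp: Y_def inj_on_def)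
      then show "x = y" using xy g q H_carrier unfolding Y_def
        by (metis (no_types, lifting) X_carrier Units_eq Units_l_cancel inv_closed inv_inv m_closed mem_Collect_eq right_cancel)
    qed
    show "5 \<le> card Y" unfolding Y_def by (rule large_intersection [OF g q y])
    show "Y \<subseteq> carrier HG" by (auto simp: Y_def)
    show "u *s P = 0 \<or> v *s Q = 0" if "wedge (u *s P) (v *s Q) = 0" using that PQ by auto
    show "u' *s P' = 0 \<or> v' *s Q' = 0" if "wedge (u' *s P') (v' *s Q') = 0" using that PQ' by auto
    have "P \<noteq> 0" "Q \<noteq> 0" "P' \<noteq> 0" "Q' \<noteq> 0" using PQ PQ' by auto
    then show "u *s P \<noteq> 0 \<or> v *s Q \<noteq> 0" "u' *s P' \<noteq> 0 \<or> v' *s Q' \<noteq> 0" using uv uv' by auto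
    fix x y assume x: "x \<in> carrier HG" and y: "y \<in> Y"
    then have xy: "x \<in> H" "y \<in> H" "g \<otimes> inv y \<otimes> q \<in> X" by (auto simp: Y_def)
    have e: "g \<otimes> inv x \<otimes> (x \<otimes> inv y \<otimes> q) = g \<otimes> inv y \<otimes> q"
      using xy g q H_carrier by (simp add: m_assoc) (simp add: m_assoc [symmetric])
    have "\<psi> (x \<otimes> inv y) = \<psi> x / \<psi> y" using HG_char [OF \<psi>(1)] xy by simp
    then have "wedge (c + (u * \<phi> x) *s P + (v / \<phi> x) *s Q - A3 (g \<otimes> inv y \<otimes> q))
      (c' + (u' * (\<psi> x / \<psi> y)) *s P' + (v' / (\<psi> x / \<psi> y)) *s Q' - A3 (g \<otimes> inv y \<otimes> q)) = 0"
      using join123 [of "g \<otimes> inv x" "x \<otimes> inv y \<otimes> q"] xy g q X_left [of "x \<otimes> inv y" q] X_right [of g "inv x"]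
        1 [of x] 2 [of "x \<otimes> inv y"] unfolding e by simp
    then show "wedge (c + \<phi> x *s (u *s P) + (1 / \<phi> x) *s (v *s Q) - A3 (g \<otimes> inv y \<otimes> q))
      (c' + (\<psi> x / \<psi> y) *s (u' *s P') + (\<psi> y / \<psi> x) *s (v' *s Q') - A3 (g \<otimes> inv y \<otimes> q)) = 0"
      by (simp add: mult.commute)
  qed (use fin_H order_ge_9 card_H_char \<phi> \<psi> in simp_all)
  have uv0: "u = 0 \<or> v = 0" "u' = 0 \<or> v' = 0"
    using aligned(1,2) PQ PQ' by auto
  have a: "A1 (g \<otimes> k) - A1 g = (u * (\<phi> (inv k) - 1)) *s P + (v * (1 / \<phi> (inv k) - 1)) *s Q"
    using 1 [of "inv k"] 1 [of \<one>] k g HG_char(1) [OF \<phi>(1)] H_carrier by (simp add: vec2_eq_iff algebra_simps)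
  have b: "A2 (l \<otimes> q) - A2 q = (u' * (\<psi> l - 1)) *s P' + (v' * (1 / \<psi> l - 1)) *s Q'"
    using 2 [of l] 2 [of \<one>] k q HG_char(1) [OF \<psi>(1)] H_carrier by (simp add: vec2_eq_iff algebra_simps)
  show ?thesis using uv0 aligned(3) unfolding a b by auto
qed

end

lemma wedge_combine:
  "wedge (a *s P + b *s Q) (a' *s P + b' *s Q) = (a * b' - b * a') * wedge P Q"
  by (simp add: wedge_def algebra_simps)

lemma wedge_common: "wedge p u = 0 \<Longrightarrow> wedge p v = 0 \<Longrightarrow> p \<noteq> 0 \<Longrightarrow> wedge u v = 0"
  using wedge_trans wedge_swap_eq_0 by blast

section \<open>Centroids, collinear cosets and the spread configuration\<close>

context affine_multinet
begin

lemma left_translate_X_ne: "g \<in> X \<Longrightarrow> k \<in> H \<Longrightarrow> k \<noteq> \<one> \<Longrightarrow> k \<otimes> g \<noteq> g"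
  using H_carrier by auto

lemma right_translate_X_ne: "g \<in> X \<Longrightarrow> k \<in> H \<Longrightarrow> k \<noteq> \<one> \<Longrightarrow> g \<otimes> k \<noteq> g"
  using H_carrier by auto

lemma A_translate_ne:
  assumes "g \<in> X" "k \<in> H" "k \<noteq> \<one>"
  shows "A1 (k \<otimes> g) - A1 g \<noteq> 0" "A2 (k \<otimes> g) - A2 g \<noteq> 0" "A3 (k \<otimes> g) - A3 g \<noteq> 0"
    "A1 (g \<otimes> k) - A1 g \<noteq> 0" "A2 (g \<otimes> k) - A2 g \<noteq> 0" "A3 (g \<otimes> k) - A3 g \<noteq> 0"
  using inj [THEN inj_onD, OF _ X_left [OF assms(2,1)] assms(1)]
    inj [THEN inj_onD, OF _ X_right [OF assms(1,2)] assms(1)]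
    left_translate_X_ne [OF assms] right_translate_X_ne [OF assms] by auto

text \<open>Since \<open>\<theta>\<close> and its inverse sum to 0 over \<open>H\<close>, the
  constant \<open>c\<close> is the common centroid of the \<open>A2\<close> and the
  \<open>A3\<close> points of the coset.\<close>

lemma right_form_at:
  assumes g: "g \<in> X"
  obtains \<theta> P Q c u v where "grp_char HG \<theta>" "inj_on \<theta> H" "wedge P Q \<noteq> 0" "u \<noteq> 0 \<or> v \<noteq> 0"
    "\<And>k. k \<in> H \<Longrightarrow> A2 (k \<otimes> g) = c + (u * \<theta> k) *s P + (v / \<theta> k) *s Q"
    "\<And>k. k \<in> H \<Longrightarrow> A3 (k \<otimes> g) = c + (u * \<theta> k) *s Q + (v / \<theta> k) *s P"
    "(\<Sum>k\<in>H. A2 (k \<otimes> g)) = of_nat (card H) *s c" "(\<Sum>k\<in>H. A3 (k \<otimes> g)) = of_nat (card H) *s c"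
proof -
  obtain \<theta> P Q where \<theta>: "grp_char HG \<theta>" "inj_on \<theta> H" and PQ: "wedge P Q \<noteq> 0" and
    *: "\<And>g. g \<in> X \<Longrightarrow> \<exists>c u v. \<forall>k\<in>H. A2 (k \<otimes> g) = c + (u * \<theta> k) *s P + (v / \<theta> k) *s Q \<and>
      A3 (k \<otimes> g) = c + (u * \<theta> k) *s Q + (v / \<theta> k) *s P"
    by (rule right_form [OF g]) blast
  obtain c u v where 2: "\<And>k. k \<in> H \<Longrightarrow> A2 (k \<otimes> g) = c + (u * \<theta> k) *s P + (v / \<theta> k) *s Q"
    and 3: "\<And>k. k \<in> H \<Longrightarrow> A3 (k \<otimes> g) = c + (u * \<theta> k) *s Q + (v / \<theta> k) *s P"
    using * [OF g] by blast
  obtain t where t: "t \<in> H" "t \<noteq> \<one>" by (rule exists_nontrivial)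
  have uv: "u \<noteq> 0 \<or> v \<noteq> 0"
  proof (rule ccontr)
    assume "\<not> ?thesis"
    then show False using 2 [OF t(1)] 2 [of \<one>] A_translate_ne(2) [OF g t] g by simp
  qed
  have S: "(\<Sum>k\<in>H. c + (u * \<theta> k) *s R + (v / \<theta> k) *s T) = of_nat (card H) *s c" for R T :: "'k ^ 2"
  proof -
    have "(\<Sum>k\<in>H. c $ i + u * \<theta> k * R $ i + v / \<theta> k * T $ i)
        = of_nat (card H) * c $ i + u * R $ i * (\<Sum>k\<in>H. \<theta> k) + v * T $ i * (\<Sum>k\<in>H. 1 / \<theta> k)" for i
      by (simp add: sum.distrib sum_distrib_left mult_ac)
    then show ?thesis
      by (simp add: vec_eq_iff HG_char_sum [OF \<theta>])
  qed
  show thesis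
    by (rule that [OF \<theta> PQ uv 2 3]) (simp_all add: 2 3 S cong: sum.cong)
qed

lemma right_sum: "g \<in> X \<Longrightarrow> (\<Sum>k\<in>H. A2 (k \<otimes> g)) = (\<Sum>k\<in>H. A3 (k \<otimes> g))"
  by (erule right_form_at) simp

text \<open>Independence of \<open>P\<close> and \<open>Q\<close> keeps the points of the coset away
  from the centroid \<open>c\<close>. The left version of this fact makes the function
  \<open>b\<close> in \<open>spread_contradiction\<close> nonzero.\<close>

lemma right_center_ne: 
  assumes g: "g \<in> X" shows "(\<Sum>k\<in>H. A3 (k \<otimes> g)) \<noteq> of_nat (card H) *s A3 g"
proof
  assume eq: "(\<Sum>k\<in>H. A3 (k \<otimes> g)) = of_nat (card H) *s A3 g"
  obtain \<theta> P Q c u v where *: "grp_char HG \<theta>" "wedge P Q \<noteq> 0" "u \<noteq> 0 \<or> v \<noteq> 0"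
    "\<And>k. k \<in> H \<Longrightarrow> A3 (k \<otimes> g) = c + (u * \<theta> k) *s Q + (v / \<theta> k) *s P"
    "(\<Sum>k\<in>H. A3 (k \<otimes> g)) = of_nat (card H) *s c"
    by (rule right_form_at [OF g]) blast
  have "A3 g = c" using eq *(5) card_H_char by simp
  then have "v *s P + u *s Q = 0"
    using *(4) [of \<one>] HG_char(1) [OF *(1)] g by (simp add: add_ac)
  then show False using wedge_basis_unique [OF *(2)] *(3) by blast
qed

lemma char_not_involution:
  assumes "grp_char HG \<theta>" "inj_on \<theta> H"
  obtains k l where "k \<in> H" "l \<in> H" "\<theta> k \<noteq> 1" "\<theta> l \<noteq> 1" "\<theta> k \<noteq> \<theta> l"
proof -
  obtain k where k: "k \<in> H" "k \<noteq> \<one>" by (rule exists_nontrivial)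
  have "card (H - {\<one>, k}) > 0" using order_ge_9 fin_H k by (simp add: card_Diff_subset)
  then obtain l where l: "l \<in> H" "l \<noteq> \<one>" "l \<noteq> k"
    by (metis Diff_iff card_gt_0_iff ex_in_conv insertCI)
  then show thesis using k assms(2) HG_char(1) [OF assms(1)] by (intro that [of k l]) (metis H_closed(1) inj_onD)+
qed

text \<open>With \<open>u\<close> and \<open>v\<close> both nonzero the points lie on a hyperbola,
  which has no three collinear points, whereas \<open>\<theta>\<close> takes at least three
  values.\<close>

lemma line_form_degenerate:
  assumes \<theta>: "grp_char HG \<theta>" "inj_on \<theta> H" and PQ: "wedge P Q \<noteq> 0"
    and B: "\<And>k. k \<in> H \<Longrightarrow> B k = c + (u * \<theta> k) *s P + (v / \<theta> k) *s Q"
    and coll: "\<And>k l. k \<in> H \<Longrightarrow> l \<in> H \<Longrightarrow> wedge (B k - B \<one>) (B l - B \<one>) = 0"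
  shows "u = 0 \<or> v = 0"
proof -
  obtain k l where kl: "k \<in> H" "l \<in> H" and ne: "\<theta> k \<noteq> 1" "\<theta> l \<noteq> 1" "\<theta> k \<noteq> \<theta> l"
    by (rule char_not_involution [OF \<theta>])
  have nz: "\<theta> k \<noteq> 0" "\<theta> l \<noteq> 0" using HG_char(2) [OF \<theta>(1)] kl by auto
  have d: "B k - B \<one> = (u * (\<theta> k - 1)) *s P + (v * (1 / \<theta> k - 1)) *s Q" if "k \<in> H" for k
    using B [OF that] B [of \<one>] HG_char(1) [OF \<theta>(1)] by (simp add: vec2_eq_iff algebra_simps)
  have "0 = wedge (B k - B \<one>) (B l - B \<one>)" using coll [OF kl] by simp
  also have "\<dots> = (u * (\<theta> k - 1) * (v * (1 / \<theta> l - 1)) - v * (1 / \<theta> k - 1) * (u * (\<theta> l - 1))) * wedge P Q"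
    unfolding d [OF kl(1)] d [OF kl(2)] wedge_combine ..
  also have "\<dots> = u * v * ((\<theta> k - 1) * (1 / \<theta> l - 1) - (1 / \<theta> k - 1) * (\<theta> l - 1)) * wedge P Q"
    by (simp only: right_diff_distrib left_diff_distrib mult_ac)
  also have "(\<theta> k - 1) * (1 / \<theta> l - 1) - (1 / \<theta> k - 1) * (\<theta> l - 1) = (\<theta> k - 1) * (\<theta> l - 1) * (\<theta> l - \<theta> k) / (\<theta> k * \<theta> l)"
    using nz by (simp add: field_simps)
  finally show ?thesis using ne nz PQ by simp
qed

text \<open>The families \<open>A2\<close> and \<open>A3\<close> exchange the roles of
  \<open>P\<close> and \<open>Q\<close>: if one runs along \<open>P\<close>, the other runs along
  \<open>Q\<close>.\<close>

lemma right_transversal: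
  assumes g: "g \<in> X" and coll: "\<And>k l. k \<in> H \<Longrightarrow> l \<in> H \<Longrightarrow> wedge (A2 (k \<otimes> g) - A2 g) (A2 (l \<otimes> g) - A2 g) = 0"
    and k: "k \<in> H" "k \<noteq> \<one>"
  shows "wedge (A2 (k \<otimes> g) - A2 g) (A3 (k \<otimes> g) - A3 g) \<noteq> 0"
proof -
  obtain \<theta> P Q c u v where \<theta>: "grp_char HG \<theta>" "inj_on \<theta> H" and PQ: "wedge P Q \<noteq> 0" and uv: "u \<noteq> 0 \<or> v \<noteq> 0"
    and 2: "\<And>k. k \<in> H \<Longrightarrow> A2 (k \<otimes> g) = c + (u * \<theta> k) *s P + (v / \<theta> k) *s Q"
    and 3: "\<And>k. k \<in> H \<Longrightarrow> A3 (k \<otimes> g) = c + (u * \<theta> k) *s Q + (v / \<theta> k) *s P"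
    by (rule right_form_at [OF g]) blast
  have "u = 0 \<or> v = 0"
    by (rule line_form_degenerate [OF \<theta> PQ 2]) (use coll g in auto)
  moreover have "\<theta> k \<noteq> 1" using k \<theta>(2) HG_char(1) [OF \<theta>(1)] by (metis H_closed(1) inj_onD)
  moreover have "\<theta> k \<noteq> 0" using HG_char(2) [OF \<theta>(1)] k by auto
  moreover have "A2 (k \<otimes> g) - A2 g = (u * (\<theta> k - 1)) *s P + (v * (1 / \<theta> k - 1)) *s Q"
    using 2 [OF k(1)] 2 [of \<one>] HG_char(1) [OF \<theta>(1)] g by (simp add: vec2_eq_iff algebra_simps)
  moreover have "A3 (k \<otimes> g) - A3 g = (u * (\<theta> k - 1)) *s Q + (v * (1 / \<theta> k - 1)) *s P"
    using 3 [OF k(1)] 3 [of \<one>] HG_char(1) [OF \<theta>(1)] g by (simp add: vec2_eq_iff algebra_simps)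
  ultimately show ?thesis using uv PQ wedge_swap_eq_0 [of P Q] by (auto simp: divide_eq_eq)
qed

text \<open>On a collinear coset the displacement at \<open>l \<otimes> g\<close> is a fixed vector
  times \<open>\<theta> l\<close> or its inverse, so the reciprocals form a multiple of a character
  sum. Vanishing displacements are covered by the convention \<open>1 / 0 = 0\<close>.\<close>

lemma right_inverse_sum:
  assumes g: "g \<in> X" and coll: "\<And>k l. k \<in> H \<Longrightarrow> l \<in> H \<Longrightarrow> wedge (A3 (k \<otimes> g) - A3 g) (A3 (l \<otimes> g) - A3 g) = 0"
    and k: "k \<in> H" 
  shows "(\<Sum>l\<in>H. 1 / wedge N (A3 (k \<otimes> (l \<otimes> g)) - A3 (l \<otimes> g))) = 0"
proof -
  obtain \<theta> P Q c u v where \<theta>: "grp_char HG \<theta>" "inj_on \<theta> H" and PQ: "wedge P Q \<noteq> 0" and uv: "u \<noteq> 0 \<or> v \<noteq> 0"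
    and 3: "\<And>k. k \<in> H \<Longrightarrow> A3 (k \<otimes> g) = c + (u * \<theta> k) *s Q + (v / \<theta> k) *s P"
    by (rule right_form_at [OF g]) blast
  have uv0: "u = 0 \<or> v = 0"
    by (rule line_form_degenerate [OF \<theta> _ 3]) (use coll g PQ wedge_swap_eq_0 in auto)
  have e: "A3 (k \<otimes> (l \<otimes> g)) - A3 (l \<otimes> g) = (u * \<theta> l * (\<theta> k - 1)) *s Q + (v / \<theta> l * (1 / \<theta> k - 1)) *s P"
    if "l \<in> H" for l
    using 3 [of "k \<otimes> l"] 3 [OF that] k that g H_carrier HG_char(4) [OF \<theta>(1) k that]
    by (simp add: m_assoc vec2_eq_iff algebra_simps)
  have "(\<Sum>l\<in>H. 1 / wedge N (A3 (k \<otimes> (l \<otimes> g)) - A3 (l \<otimes> g))) =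
      (\<Sum>l\<in>H. 1 / (u * \<theta> l * (\<theta> k - 1) * wedge N Q + v / \<theta> l * (1 / \<theta> k - 1) * wedge N P))"
    by (intro sum.cong refl) (simp add: e wedge_distribs)
  also have "\<dots> = 0"
    using uv0
  proof
    assume "u = 0"
    then have "(\<Sum>l\<in>H. 1 / (u * \<theta> l * (\<theta> k - 1) * wedge N Q + v / \<theta> l * (1 / \<theta> k - 1) * wedge N P)) =
      (\<Sum>l\<in>H. \<theta> l) * (1 / (v * (1 / \<theta> k - 1) * wedge N P))"
      by (simp add: sum_divide_distrib)
    then show ?thesis by (simp add: HG_char_sum [OF \<theta>])
  next
    assume "v = 0"
    then have "(\<Sum>l\<in>H. 1 / (u * \<theta> l * (\<theta> k - 1) * wedge N Q + v / \<theta> l * (1 / \<theta> k - 1) * wedge N P)) =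
      (\<Sum>l\<in>H. 1 / \<theta> l) * (1 / (u * (\<theta> k - 1) * wedge N Q))"
      by (simp add: sum_distrib_right sum_divide_distrib mult_ac)
    then show ?thesis by (simp add: HG_char_sum [OF \<theta>])
  qed
  finally show ?thesis .
qed

lemma left_sum: 
  assumes g: "g \<in> X" shows "(\<Sum>k\<in>H. A1 (g \<otimes> k)) = (\<Sum>k\<in>H. A3 (g \<otimes> k))"
proof -
  have 1: "(\<Sum>k\<in>H. B (inv (k \<otimes> inv g))) = (\<Sum>k\<in>H. B (g \<otimes> k))" for B :: "'a \<Rightarrow> 'k ^ 2"
    using sum_H_inv [of "\<lambda>k. B (g \<otimes> k)"] g H_carrier by (simp add: inv_mult_group cong: sum.cong)
  show ?thesis
    using affine_multinet.right_sum [OF para_sigma X_inv [OF g]] 1 [of A1] 1 [of A3] by simp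
qed

lemma left_center_ne: 
  assumes g: "g \<in> X" shows "(\<Sum>k\<in>H. A3 (g \<otimes> k)) \<noteq> of_nat (card H) *s A3 g"
proof -
  have "(\<Sum>k\<in>H. A3 (inv (k \<otimes> inv g))) = (\<Sum>k\<in>H. A3 (g \<otimes> k))"
    using sum_H_inv [of "\<lambda>k. A3 (g \<otimes> k)"] g H_carrier by (simp add: inv_mult_group cong: sum.cong)
  then show ?thesis
    using affine_multinet.right_center_ne [OF para_sigma X_inv [OF g]] g by simp
qed

text \<open>For a fixed \<open>k \<noteq> 1\<close> in \<open>H\<close>, the displacements \<open>W g\<close> and \<open>F g\<close> of the points \<open>A1 g\<close> and \<open>A3 g\<close> under
  left translation by \<open>k\<close> only depend on \<open>gH\<close>. Averaging the collinearity of \<open>A1 g\<close>, \<open>A2 q\<close>,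
  \<open>A3 (g q)\<close> over cosets yields \<open>b (g q) = (1 - F (g q) / W g) b q\<close>, where \<open>b\<close> measures the distance of
  \<open>A3\<close> from the centroid of its left coset. In terms of \<open>1 / b\<close> this is affine, and
  \<open>B g = 1 / W (g\<inverse>)\<close>, extended by 0 to \<open>H\<close>, satisfies \<open>B (g' g) = B g + \<Psi> g B g'\<close>. Since \<open>B\<close> sums to 0,
  summing over \<open>g'\<close> gives \<open>B g = 0\<close>.\<close>

lemma spread_contradiction:
  assumes g0: "g0 \<in> X"
    and par12: "\<And>g q k l. g \<in> X \<Longrightarrow> q \<in> X \<Longrightarrow> k \<in> H \<Longrightarrow> l \<in> H \<Longrightarrow> wedge (A1 (g \<otimes> k) - A1 g) (A2 (l \<otimes> q) - A2 q) = 0"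
    and par13: "\<And>g q k l. g \<in> X \<Longrightarrow> q \<in> X \<Longrightarrow> k \<in> H \<Longrightarrow> l \<in> H \<Longrightarrow> wedge (A1 (k \<otimes> g) - A1 g) (A3 (l \<otimes> q) - A3 q) = 0"
    and par23: "\<And>g q k l. g \<in> X \<Longrightarrow> q \<in> X \<Longrightarrow> k \<in> H \<Longrightarrow> l \<in> H \<Longrightarrow> wedge (A2 (g \<otimes> k) - A2 g) (A3 (q \<otimes> l) - A3 q) = 0"
  shows False
proof -
  obtain k where k: "k \<in> H" "k \<noteq> \<one>" by (rule exists_nontrivial)
  note tr = wedge_trans wedge_swap_eq_0
  define h :: 'k where "h = of_nat (card H)"
  have h: "h \<noteq> 0" using card_H_char by (simp add: h_def)
  \<comment> \<open>These are the common directions of the cosets: \<open>P\<close> for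
    \<open>A1\<close> on left and \<open>A2\<close> on right cosets, \<open>P'\<close> for
    \<open>A1\<close> and \<open>A3\<close> on right cosets, \<open>P''\<close> for
    \<open>A2\<close> and \<open>A3\<close> on left cosets.\<close>
  define P P' P'' where "P = A2 (k \<otimes> g0) - A2 g0" and "P' = A3 (k \<otimes> g0) - A3 g0" and "P'' = A3 (g0 \<otimes> k) - A3 g0"
  have P0: "P \<noteq> 0" "P' \<noteq> 0" "P'' \<noteq> 0"
    using A_translate_ne [OF g0 k] by (simp_all add: P_def P'_def P''_def)
  have P1: "wedge P (A1 (g \<otimes> l) - A1 g) = 0" if "g \<in> X" "l \<in> H" for g l
    using par12 [OF that(1) g0 that(2) k(1)] wedge_swap_eq_0 unfolding P_def by blast
  have P'1: "wedge P' (A1 (l \<otimes> g) - A1 g) = 0" if "g \<in> X" "l \<in> H" for g l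
    using par13 [OF that(1) g0 that(2) k(1)] wedge_swap_eq_0 unfolding P'_def by blast
  have P''2: "wedge P'' (A2 (g \<otimes> l) - A2 g) = 0" if "g \<in> X" "l \<in> H" for g l
    using par23 [OF that(1) g0 that(2) k(1)] wedge_swap_eq_0 unfolding P''_def by blast
  have P'3: "wedge P' (A3 (l \<otimes> g) - A3 g) = 0" if "g \<in> X" "l \<in> H" for g l
    using par13 [OF g0 that(1) k(1) that(2)] P'1 [OF g0 k(1)] A_translate_ne(1) [OF g0 k] tr by metis
  have P''3: "wedge P'' (A3 (g \<otimes> l) - A3 g) = 0" if "g \<in> X" "l \<in> H" for g l
    using par23 [OF g0 that(1) k(1) that(2)] P''2 [OF g0 k(1)] A_translate_ne(5) [OF g0 k] tr by metis
  have P2: "wedge P (A2 (l \<otimes> g) - A2 g) = 0" if "g \<in> X" "l \<in> H" for g l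
    using par12 [OF g0 that(1) k(1) that(2)] P1 [OF g0 k(1)] A_translate_ne(4) [OF g0 k] tr by metis
  have PP': "wedge P P' \<noteq> 0"
    unfolding P_def P'_def using P2 [OF g0] P0(1) by (intro right_transversal g0 k) (rule wedge_common)
  have P'P'': "wedge P' P'' \<noteq> 0"
  proof
    assume 0: "wedge P' P'' = 0"
    interpret R: affine_multinet G H A3 "\<lambda>x. A2 (inv x)" A1 d3 "\<lambda>x. d2 (inv x)" d1 by (rule para_rho)
    have e: "A2 (inv (l \<otimes> g0)) - A2 (inv g0) = A2 (inv g0 \<otimes> inv l) - A2 (inv g0)" if "l \<in> H" for l
      using that g0 H_carrier by (simp add: inv_mult_group)
    have p: "wedge P'' (A2 (inv (l \<otimes> g0)) - A2 (inv g0)) = 0" if "l \<in> H" for l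
      using P''2 [OF X_inv [OF g0], of "inv l"] that e by simp
    have "wedge (A2 (inv (k \<otimes> g0)) - A2 (inv g0)) (A1 (k \<otimes> g0) - A1 g0) \<noteq> 0"
      using p P0(3) by (intro R.right_transversal g0 k) (rule wedge_common)
    moreover have "wedge P'' (A1 (k \<otimes> g0) - A1 g0) = 0"
      using P'1 [OF g0 k(1)] 0 P0(2) tr by metis
    ultimately show False using p [OF k(1)] P0(3) tr by metis
  qed
  define W F where "W = (\<lambda>g. wedge P (A1 (k \<otimes> g) - A1 g) / wedge P P')"
    and "F = (\<lambda>g. wedge P (A3 (k \<otimes> g) - A3 g) / wedge P P')"
  have W: "A1 (k \<otimes> g) - A1 g = W g *s P'" if "g \<in> X" for g
    using wedge_expand [OF PP', of "A1 (k \<otimes> g) - A1 g"] P'1 [OF that k(1)]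
      wedge_swap_eq_0 [of P' "A1 (k \<otimes> g) - A1 g"] by (simp add: W_def)
  have F: "A3 (k \<otimes> g) - A3 g = F g *s P'" if "g \<in> X" for g
    using wedge_expand [OF PP', of "A3 (k \<otimes> g) - A3 g"] P'3 [OF that k(1)]
      wedge_swap_eq_0 [of P' "A3 (k \<otimes> g) - A3 g"] by (simp add: F_def)
  have W0: "W g \<noteq> 0" if "g \<in> X" for g using W [OF that] A_translate_ne(1) [OF that k] by auto
  have F0: "F g \<noteq> 0" if "g \<in> X" for g using F [OF that] A_translate_ne(3) [OF that k] by auto
  \<comment> \<open>Moving \<open>g\<close> within its left coset shifts \<open>A1\<close> along
    \<open>P\<close>, which \<open>wedge P\<close> does not see.\<close>
  have WH: "W (g \<otimes> l) = W g" if g: "g \<in> X" and l: "l \<in> H" for g l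
  proof -
    have "wedge P (A1 (k \<otimes> (g \<otimes> l)) - A1 (g \<otimes> l)) = wedge P (A1 (k \<otimes> g \<otimes> l) - A1 (k \<otimes> g))
        + wedge P (A1 (k \<otimes> g) - A1 g) - wedge P (A1 (g \<otimes> l) - A1 g)"
      using g l k H_carrier by (simp add: m_assoc wedge_distribs)
    then show ?thesis using P1 [OF g l] P1 [OF X_left [OF k(1) g] l] by (simp add: W_def)
  qed
  \<comment> \<open>The change of the displacement is parallel to \<open>P'\<close> by definition of
    \<open>F\<close> and to \<open>P''\<close> as a difference within left cosets, so it is
    0.\<close>
  have FH: "F (g \<otimes> l) = F g" if g: "g \<in> X" and l: "l \<in> H" for g l
  proof -
    have "F (g \<otimes> l) *s P' - F g *s P' = (A3 (k \<otimes> g \<otimes> l) - A3 (k \<otimes> g)) - (A3 (g \<otimes> l) - A3 g)"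
      using F [OF g] F [OF X_right [OF g l]] g l k H_carrier by (simp add: m_assoc algebra_simps)
    then have "wedge P'' (F (g \<otimes> l) *s P' - F g *s P') = 0"
      using P''3 [OF g l] P''3 [OF X_left [OF k(1) g] l] by (simp add: wedge_distribs)
    then show ?thesis using P'P'' wedge_swap_eq_0 [of P' P''] by (simp add: wedge_distribs)
  qed
  define y where "y = wedge P'"
  \<comment> \<open>Similar triangles with apex \<open>A2 q\<close>: replacing \<open>g\<close> by
    \<open>k \<otimes> g\<close> fixes the apex and moves the other two points parallel to
    \<open>P'\<close>, by \<open>W\<close> and \<open>F\<close>. The functional \<open>y\<close>
    measures distances transversally to \<open>P'\<close>.\<close>
  have I: "F (g \<otimes> q) * (y (A1 g) - y (A2 q)) = W g * (y (A3 (g \<otimes> q)) - y (A2 q))"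
    if "g \<in> X" "q \<in> X" "g \<otimes> q \<in> X" for g q
  proof -
    have 1: "wedge (A1 g - A3 (g \<otimes> q)) (A2 q - A3 (g \<otimes> q)) = 0" by (rule join123 [OF that])
    have a: "k \<otimes> g \<otimes> q = k \<otimes> (g \<otimes> q)" using that k H_carrier by (simp add: m_assoc)
    have "A1 (k \<otimes> g) = A1 g + W g *s P'" "A3 (k \<otimes> (g \<otimes> q)) = A3 (g \<otimes> q) + F (g \<otimes> q) *s P'"
      using W [OF that(1)] F [OF that(3)] by (simp_all add: algebra_simps)
    then have "wedge ((A1 g - A3 (g \<otimes> q)) + (W g - F (g \<otimes> q)) *s P') ((A2 q - A3 (g \<otimes> q)) - F (g \<otimes> q) *s P') = 0"
      using join123 [OF X_left [OF k(1) that(1)] that(2)] X_left [OF k(1) that(3)]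
      by (simp add: a algebra_simps vec.scale_left_diff_distrib)
    then have "(W g - F (g \<otimes> q)) * wedge P' (A2 q - A3 (g \<otimes> q)) + F (g \<otimes> q) * wedge P' (A1 g - A3 (g \<otimes> q)) = 0"
      using 1 wedge_swap [of "A1 g - A3 (g \<otimes> q)" P']
      by (simp only: wedge_distribs(1) wedge_distribs(4) wedge_simps) (simp add: algebra_simps)
    then show ?thesis unfolding y_def wedge_distribs by (simp add: algebra_simps)
  qed
  have y_sum: "y (sum f H) = (\<Sum>x\<in>H. y (f x))" for f
    unfolding y_def using wedge_sum_left [of f H P'] wedge_swap [of P'] by (simp add: sum_negf)
  have y3: "y (A3 (l \<otimes> q)) = y (A3 q)" if "q \<in> X" "l \<in> H" for q l
    using P'3 [OF that] by (simp add: y_def wedge_distribs)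
  define p where "p = (\<lambda>g. \<Sum>l\<in>H. y (A3 (g \<otimes> l)))"
  \<comment> \<open>Averaging fact I over the pairs \<open>g \<otimes> inv l\<close>,
    \<open>l \<otimes> q\<close>, whose product is fixed. Equality of centroids replaces
    \<open>A1\<close> and \<open>A2\<close> by \<open>A3\<close>.\<close>
  have II: "F (g \<otimes> q) * (p g - h * y (A3 q)) = W g * (h * y (A3 (g \<otimes> q)) - h * y (A3 q))"
    if gq: "g \<in> X" "q \<in> X" "g \<otimes> q \<in> X" for g q
  proof -
    have e: "g \<otimes> inv l \<otimes> (l \<otimes> q) = g \<otimes> q" if "l \<in> H" for l
      using that gq H_carrier by (simp add: m_assoc cancel_assoc)
    have "F (g \<otimes> q) * (y (A1 (g \<otimes> inv l)) - y (A2 (l \<otimes> q))) = W g * (y (A3 (g \<otimes> q)) - y (A2 (l \<otimes> q)))"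
      if l: "l \<in> H" for l
      using I [OF X_right [OF gq(1)] X_left [OF l gq(2)], of "inv l"] gq l by (simp add: e WH)
    then have "(\<Sum>l\<in>H. F (g \<otimes> q) * (y (A1 (g \<otimes> inv l)) - y (A2 (l \<otimes> q))))
        = (\<Sum>l\<in>H. W g * (y (A3 (g \<otimes> q)) - y (A2 (l \<otimes> q))))"
      by (intro sum.cong) simp_all
    then have "F (g \<otimes> q) * ((\<Sum>l\<in>H. y (A1 (g \<otimes> inv l))) - (\<Sum>l\<in>H. y (A2 (l \<otimes> q))))
        = W g * (h * y (A3 (g \<otimes> q)) - (\<Sum>l\<in>H. y (A2 (l \<otimes> q))))"
      by (simp add: sum_distrib_left [symmetric] sum_subtractf h_def)
    moreover have "(\<Sum>l\<in>H. y (A1 (g \<otimes> inv l))) = p g"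
      using sum_H_inv [of "\<lambda>l. y (A1 (g \<otimes> l))"] left_sum [OF gq(1)] by (simp add: p_def flip: y_sum)
    moreover have "(\<Sum>l\<in>H. y (A2 (l \<otimes> q))) = h * y (A3 q)"
      using right_sum [OF gq(2)] y3 [OF gq(2)] by (simp add: h_def y_sum flip: y_sum [of "\<lambda>l. A2 (l \<otimes> q)"] cong: sum.cong)
    ultimately show ?thesis by simp
  qed
  \<comment> \<open>A second average, now over \<open>q \<otimes> l\<close>.\<close>
  have III: "F (g \<otimes> q) * (p g - p q) = W g * (p (g \<otimes> q) - p q)"
    if gq: "g \<in> X" "q \<in> X" "g \<otimes> q \<in> X" for g q
  proof -
    have "F (g \<otimes> q) * (p g - h * y (A3 (q \<otimes> l))) = W g * (h * y (A3 (g \<otimes> q \<otimes> l)) - h * y (A3 (q \<otimes> l)))"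
      if l: "l \<in> H" for l
      using II [OF gq(1) X_right [OF gq(2) l]] gq l X_right [OF gq(3) l] FH [OF gq(3) l] H_carrier [OF l]
      by (simp add: m_assoc [symmetric])
    then have "(\<Sum>l\<in>H. F (g \<otimes> q) * (p g - h * y (A3 (q \<otimes> l))))
        = (\<Sum>l\<in>H. W g * (h * y (A3 (g \<otimes> q \<otimes> l)) - h * y (A3 (q \<otimes> l))))"
      by (intro sum.cong) simp_all
    then have "F (g \<otimes> q) * (h * p g - h * p q) = W g * (h * p (g \<otimes> q) - h * p q)"
      by (simp add: sum_distrib_left [symmetric] sum_subtractf flip: h_def p_def) (simp add: p_def)
    then have "h * (F (g \<otimes> q) * (p g - p q)) = h * (W g * (p (g \<otimes> q) - p q))"
      by (simp add: algebra_simps)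
    then show ?thesis using h by simp
  qed
  define b where "b = (\<lambda>g. h * y (A3 g) - p g)"
  \<comment> \<open>If \<open>b q = 0\<close>, then \<open>A3 q\<close> and the centroid of its left
    coset differ by a vector parallel to both \<open>P'\<close> and \<open>P''\<close>, so they
    coincide.\<close>
  have b0: "b q \<noteq> 0" if q: "q \<in> X" for q
  proof
    assume "b q = 0"
    then have "y (h *s A3 q - (\<Sum>l\<in>H. A3 (q \<otimes> l))) = 0"
      unfolding b_def p_def y_sum [symmetric] by (simp add: y_def wedge_distribs)
    moreover have "wedge P'' (h *s A3 q - (\<Sum>l\<in>H. A3 (q \<otimes> l))) = 0"
    proof -
      have "wedge (h *s A3 q - (\<Sum>l\<in>H. A3 (q \<otimes> l))) P'' = h * wedge (A3 q) P'' - (\<Sum>l\<in>H. wedge (A3 (q \<otimes> l)) P'')"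
        by (simp add: wedge_distribs wedge_sum_left)
      also have "(\<Sum>l\<in>H. wedge (A3 (q \<otimes> l)) P'') = (\<Sum>l\<in>H. wedge (A3 q) P'')"
        using P''3 [OF q] wedge_swap [of _ P''] by (intro sum.cong) (simp_all add: wedge_distribs)
      finally have "wedge (h *s A3 q - (\<Sum>l\<in>H. A3 (q \<otimes> l))) P'' = 0" by (simp add: h_def)
      then show ?thesis using wedge_swap_eq_0 by blast
    qed
    ultimately have "h *s A3 q - (\<Sum>l\<in>H. A3 (q \<otimes> l)) = 0"
      using wedge_zero_unique [OF _ _ P'P''] wedge_swap_eq_0 unfolding y_def by metis
    then show False using left_center_ne [OF q] by (simp add: h_def)
  qed
  have b: "b (g \<otimes> q) = (1 - F (g \<otimes> q) / W g) * b q" if gq: "g \<in> X" "q \<in> X" "g \<otimes> q \<in> X" for g q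
  proof -
    have "W g * (b (g \<otimes> q) - b q) = - F (g \<otimes> q) * b q"
      using II [OF gq] III [OF gq] unfolding b_def by algebra
    then show ?thesis using W0 [OF gq(1)] by (simp add: field_simps)
  qed
  \<comment> \<open>Taking reciprocals turns the multiplicative recursion for \<open>b\<close> into
    an affine one. The default value 0 of \<open>B\<close> on \<open>H\<close> is what lets the law
    \<open>cocycle\<close> hold for every \<open>g1\<close> in \<open>G\<close>.\<close>
  define \<gamma> \<Phi> B where "\<gamma> = (\<lambda>z. 1 / b z)" and "\<Phi> = (\<lambda>z. - F z / b z)"
    and "B = (\<lambda>g. if g \<in> X then 1 / W (inv g) else 0)"
  have \<Phi>0: "\<Phi> z \<noteq> 0" if "z \<in> X" for z using b0 [OF that] F0 [OF that] by (simp add: \<Phi>_def)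
  have B0: "B g \<noteq> 0" if "g \<in> X" for g using that W0 [OF X_inv [OF that]] by (simp add: B_def)
  have \<gamma>: "\<gamma> (g \<otimes> z) = \<gamma> z + \<Phi> z * B g" if gz: "g \<in> X" "z \<in> X" "g \<otimes> z \<in> X" for g z
  proof -
    have "b z = (1 - F z / W (inv g)) * b (g \<otimes> z)"
      using b [OF X_inv [OF gz(1)] gz(3)] gz by (simp add: cancel_assoc)
    then show ?thesis
      using b0 [OF gz(2)] b0 [OF gz(3)] gz(1) W0 [OF X_inv [OF gz(1)]] by (simp add: \<gamma>_def \<Phi>_def B_def field_simps)
  qed
  have BH: "B (l \<otimes> g) = B g" if "g \<in> X" "l \<in> H" for g l
    using that X_left [OF that(2,1)] WH [OF X_inv [OF that(1)], of "inv l"] H_carrier by (simp add: B_def inv_mult_group)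
  \<comment> \<open>The elements \<open>l \<otimes> g0 \<otimes> m\<close> are distinct for
    different pairs: a coincidence would give an element of both cosets of \<open>g0\<close>
    displaced from \<open>A1 g0\<close> along \<open>P'\<close> and along \<open>P\<close>.\<close>
  have large: "card (carrier G) > 3 * card H"
  proof -
    have "inj_on (\<lambda>(l, m). l \<otimes> g0 \<otimes> m) (H \<times> H)"
    proof (rule inj_onI, clarify)
      fix l m l' m' assume lm: "l \<in> H" "m \<in> H" "l' \<in> H" "m' \<in> H" and eq: "l \<otimes> g0 \<otimes> m = l' \<otimes> g0 \<otimes> m'"
      have l: "l \<in> carrier G" "m \<in> carrier G" "l' \<in> carrier G" "m' \<in> carrier G" "g0 \<in> carrier G"
        using lm g0 H_carrier by auto
      have e: "inv l' \<otimes> l \<otimes> g0 = g0 \<otimes> (m' \<otimes> inv m)"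
      proof -
        have "inv l' \<otimes> l \<otimes> g0 = inv l' \<otimes> (l \<otimes> g0 \<otimes> m) \<otimes> inv m" using l by (simp add: m_assoc)
        also have "\<dots> = g0 \<otimes> (m' \<otimes> inv m)" unfolding eq using l by (simp add: m_assoc cancel_assoc)
        finally show ?thesis .
      qed
      have H2: "inv l' \<otimes> l \<in> H" "m' \<otimes> inv m \<in> H" using lm by auto
      have "A1 (inv l' \<otimes> l \<otimes> g0) - A1 g0 = 0"
        using P'1 [OF g0 H2(1)] P1 [OF g0 H2(2)] unfolding e
        by (intro wedge_zero_unique [OF _ _ PP']) (use wedge_swap_eq_0 in blast)+
      then have "inv l' \<otimes> l = \<one>" using A_translate_ne(1) [OF g0 H2(1)] by blast
      then have ll: "l = l'" using l cancel_assoc(1) [of l' l] by simp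
      then have "m = m'" using eq l by (metis Units_eq Units_l_cancel m_closed)
      with ll show "l = l' \<and> m = m'" by simp
    qed
    then have "card H * card H \<le> card (carrier G)"
      using fin g0 H_carrier by (auto simp: card_cartesian_product simp flip: card_cartesian_product intro!: card_inj_on_le)
    moreover have "card H * card H \<ge> 9 * card H" using order_ge_9 by simp
    ultimately show ?thesis using order_ge_9 by linarith
  qed
  \<comment> \<open>By \<open>large\<close>, three translates of \<open>H\<close> do not cover
    \<open>G\<close>, so an auxiliary point \<open>z\<close> exists at which all the recursions
    needed for \<open>cocycle\<close> are available.\<close>
  have exz: "\<exists>z\<in>X. a \<otimes> z \<in> X \<and> c \<otimes> z \<in> X" if ac: "a \<in> carrier G" "c \<in> carrier G" for a c
  proof -
    have "card (H \<union> (\<lambda>x. inv a \<otimes> x) ` H \<union> (\<lambda>x. inv c \<otimes> x) ` H) \<le> card H + card H + card H"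
      using card_image_le [OF fin_H] by (meson add_mono card_Un_le le_trans order_refl)
    then have "\<not> carrier G \<subseteq> H \<union> (\<lambda>x. inv a \<otimes> x) ` H \<union> (\<lambda>x. inv c \<otimes> x) ` H"
      using large fin_H card_mono [of "H \<union> (\<lambda>x. inv a \<otimes> x) ` H \<union> (\<lambda>x. inv c \<otimes> x) ` H" "carrier G"] by fastforce
    then obtain z where z: "z \<in> carrier G" "z \<notin> H" "z \<notin> (\<lambda>x. inv a \<otimes> x) ` H" "z \<notin> (\<lambda>x. inv c \<otimes> x) ` H" by auto
    have "a \<otimes> z \<notin> H" "c \<otimes> z \<notin> H"
      using z ac cancel_assoc(2) by (metis image_eqI)+
    then show ?thesis using z ac by auto
  qed
  have cocycle: "B (g1 \<otimes> g) = B g - B g / B (inv g) * B g1" if g: "g \<in> X" and g1: "g1 \<in> carrier G" for g g1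
  proof (cases "g1 \<in> H")
    case True
    then show ?thesis using BH [OF g True] by (simp add: B_def)
  next
    case g1X: False
    show ?thesis
    proof (cases "g1 \<otimes> g \<in> H")
      case True
      have "g1 = (g1 \<otimes> g) \<otimes> inv g" using g g1 by (simp add: m_assoc)
      then have "B g1 = B (inv g)" using BH [OF X_inv [OF g] True] by simp
      then show ?thesis using True B0 [OF X_inv [OF g]] by (simp add: B_def)
    next
      case False
      obtain z where z: "z \<in> X" "g \<otimes> z \<in> X" "(g1 \<otimes> g) \<otimes> z \<in> X"
        using exz [of g "g1 \<otimes> g"] g g1 by auto
      have X': "g1 \<in> X" "g1 \<otimes> g \<in> X" using g1 g1X False g by auto
      have a: "g1 \<otimes> (g \<otimes> z) = g1 \<otimes> g \<otimes> z" using g g1 z by (simp add: m_assoc)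
      have c: "inv g \<otimes> (g \<otimes> z) = z" using g z by (simp add: cancel_assoc)
      have "\<gamma> (g1 \<otimes> g \<otimes> z) = \<gamma> z + \<Phi> z * B (g1 \<otimes> g)" by (rule \<gamma> [OF X'(2) z(1,3)])
      moreover have "\<gamma> (g \<otimes> z) = \<gamma> z + \<Phi> z * B g" by (rule \<gamma> [OF g z(1,2)])
      moreover have "\<gamma> (g1 \<otimes> g \<otimes> z) = \<gamma> (g \<otimes> z) + \<Phi> (g \<otimes> z) * B g1"
        using \<gamma> [OF X'(1) z(2)] z(3) by (simp add: a)
      moreover have "\<gamma> z = \<gamma> (g \<otimes> z) + \<Phi> (g \<otimes> z) * B (inv g)"
        using \<gamma> [OF X_inv [OF g] z(2)] z(1) by (simp add: c)
      ultimately have "\<Phi> z * (B (inv g) * (B (g1 \<otimes> g) - B g) + B g * B g1) = 0"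
        by algebra
      then have "B (inv g) * (B (g1 \<otimes> g) - B g) + B g * B g1 = 0" using \<Phi>0 [OF z(1)] by simp
      then show ?thesis using B0 [OF X_inv [OF g]] by (simp add: field_simps)
    qed
  qed
  \<comment> \<open>After inversion of the argument, the sum over each right coset is a sum of
    reciprocal displacements of \<open>A1\<close>, to which \<open>right_inverse_sum\<close> applies
    after a permutation of components.\<close>
  have "(\<Sum>g\<in>carrier G. B g) = 0"
  proof -
    define E where "E = (\<lambda>g. if g \<in> X then 1 / W g else 0)"
    have "(\<Sum>g\<in>carrier G. B g) = (\<Sum>g\<in>carrier G. E (inv g))"
    proof (intro sum.cong refl)
      fix g assume "g \<in> carrier G"
      then have "inv g \<in> X \<longleftrightarrow> g \<in> X" using X_inv [of g] X_inv [of "inv g"] by (metis inv_inv)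
      then show "B g = E (inv g)" by (simp only: B_def E_def)
    qed
    also have "\<dots> = (\<Sum>g\<in>carrier G. E g)" by (rule sum_inv)
    finally have 1: "(\<Sum>g\<in>carrier G. B g) = (\<Sum>g\<in>carrier G. E g)" .
    have "(\<Sum>l\<in>H. E (l \<otimes> g)) = 0" if g: "g \<in> carrier G" for g
    proof (cases "g \<in> X")
      case True
      have par: "wedge (A1 (m \<otimes> g) - A1 g) (A1 (l \<otimes> g) - A1 g) = 0" if "m \<in> H" "l \<in> H" for m l
        by (rule wedge_common [OF P'1 [OF True that(1)] P'1 [OF True that(2)] P0(2)])
      have 0: "(\<Sum>l\<in>H. 1 / wedge P (A1 (k \<otimes> (l \<otimes> g)) - A1 (l \<otimes> g))) = 0"
        by (rule affine_multinet.right_inverse_sum [OF para_rho True _ k(1)]) (rule par)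
      have "(\<Sum>l\<in>H. E (l \<otimes> g)) = (\<Sum>l\<in>H. wedge P P' * (1 / wedge P (A1 (k \<otimes> (l \<otimes> g)) - A1 (l \<otimes> g))))"
        using X_left [OF _ True] by (intro sum.cong) (simp_all add: E_def W_def)
      also have "\<dots> = 0" by (simp only: sum_distrib_left [symmetric] 0 mult_zero_right)
      finally show ?thesis .
    next
      case False
      then have "l \<otimes> g \<notin> X" if "l \<in> H" for l
        using g that by auto
      then show ?thesis unfolding E_def by (intro sum.neutral ballI) (simp only: if_False simp_thms)
    qed
    then have "0 = (\<Sum>g\<in>carrier G. \<Sum>l\<in>H. E (l \<otimes> g))" by simp
    also have "\<dots> = (\<Sum>l\<in>H. \<Sum>g\<in>carrier G. E (l \<otimes> g))" by (rule sum.swap)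
    also have "\<dots> = (\<Sum>l\<in>H. \<Sum>g\<in>carrier G. E g)"
      by (intro sum.cong refl sum_translate(2) H_carrier)
    also have "\<dots> = h * (\<Sum>g\<in>carrier G. E g)" by (simp add: h_def)
    finally show ?thesis using h 1 by simp
  qed
  then have "0 = (\<Sum>g\<in>carrier G. B (g \<otimes> g0))"
    using sum_translate(1) [of g0 B] g0 by simp
  also have "\<dots> = (\<Sum>g\<in>carrier G. B g0 - B g0 / B (inv g0) * B g)"
    by (intro sum.cong refl cocycle g0)
  also have "\<dots> = of_nat (card (carrier G)) * B g0 - B g0 / B (inv g0) * (\<Sum>g\<in>carrier G. B g)"
    by (simp only: sum_subtractf sum_distrib_left [symmetric] sum_constant)
  also have "\<dots> = of_nat (card (carrier G)) * B g0"
    by (simp add: \<open>(\<Sum>g\<in>carrier G. B g) = 0\<close>)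
  finally show False
    using B0 [OF g0] char [of "card (carrier G)"] card_H_le order_ge_9 by auto
qed

end

text \<open>Here \<open>r\<close> stands for \<open>v / t\<close>; multiplication by
  \<open>t^2\<close> brings the equation into the shape of \<open>poly7_eq_0\<close>.\<close>

lemma clear_denominator:
  fixes t :: "'k::field"
  assumes "\<kappa> = (u * t)\<^sup>2 * \<alpha> + u * t * r * \<beta> + r\<^sup>2 * \<gamma>" "v = t * r"
  shows "v\<^sup>2 * \<gamma> + 0 * t + (u * v * \<beta> - \<kappa>) * t ^ 2 + 0 * t ^ 3 + u\<^sup>2 * \<alpha> * t ^ 4 + 0 * t ^ 5 + 0 * t ^ 6 = 0"
  unfolding assms by algebra

section \<open>The index of H and the three affine configurations\<close>

context affine_multinet
begin

text \<open>Join a left coset of \<open>g\<close> and a right coset of \<open>q\<close> by an edge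
  if some \<open>g \<otimes> y \<otimes> q\<close> lies outside \<open>H\<close>. By
  \<open>pair_parallel\<close> adjacent cosets are parallel, and the hypotheses provide a path of
  three edges from \<open>g\<close> to \<open>q\<close> along which the direction is passed
  on.\<close>

lemma parallel_connected:
  assumes E1: "\<And>g g'. g \<in> X \<Longrightarrow> g' \<in> X \<Longrightarrow> \<exists>q\<in>X. (\<exists>y\<in>H. g \<otimes> y \<otimes> q \<in> X) \<and> (\<exists>y\<in>H. g' \<otimes> y \<otimes> q \<in> X)"
    and E2: "\<And>q. q \<in> X \<Longrightarrow> \<exists>g\<in>X. \<exists>y\<in>H. g \<otimes> y \<otimes> q \<in> X"
    and g: "g \<in> X" and q: "q \<in> X" and k: "k \<in> H" and l: "l \<in> H"
  shows "wedge (A1 (g \<otimes> k) - A1 g) (A2 (l \<otimes> q) - A2 q) = 0"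
proof -
  obtain t where t: "t \<in> H" "t \<noteq> \<one>" by (rule exists_nontrivial)
  obtain g' y where g': "g' \<in> X" "y \<in> H" "g' \<otimes> y \<otimes> q \<in> X" using E2 [OF q] by blast
  obtain q' y1 y2 where q': "q' \<in> X" "y1 \<in> H" "g \<otimes> y1 \<otimes> q' \<in> X" "y2 \<in> H" "g' \<otimes> y2 \<otimes> q' \<in> X"
    using E1 [OF g g'(1)] by blast
  have "wedge (A1 (g \<otimes> k) - A1 g) (A2 (t \<otimes> q') - A2 q') = 0"
    by (rule pair_parallel [OF g q'(1-3) k t(1)])
  moreover have "wedge (A1 (g' \<otimes> t) - A1 g') (A2 (t \<otimes> q') - A2 q') = 0"
    by (rule pair_parallel [OF g'(1) q'(1,4,5) t(1) t(1)])
  ultimately have "wedge (A1 (g \<otimes> k) - A1 g) (A1 (g' \<otimes> t) - A1 g') = 0"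
    using A_translate_ne(2) [OF q'(1) t] wedge_common wedge_swap_eq_0 by blast
  then show ?thesis
    using pair_parallel [OF g'(1) q g'(2,3) t(1) l] A_translate_ne(4) [OF g'(1) t] wedge_trans by blast
qed

text \<open>The connectivity hypotheses mention only \<open>G\<close> and \<open>H\<close>, so they
  survive every permutation of the components and yield all three parallelism conditions of
  \<open>spread_contradiction\<close>.\<close>

lemma connected_contradiction:
  assumes E1: "\<And>g g'. g \<in> X \<Longrightarrow> g' \<in> X \<Longrightarrow> \<exists>q\<in>X. (\<exists>y\<in>H. g \<otimes> y \<otimes> q \<in> X) \<and> (\<exists>y\<in>H. g' \<otimes> y \<otimes> q \<in> X)"
    and E2: "\<And>q. q \<in> X \<Longrightarrow> \<exists>g\<in>X. \<exists>y\<in>H. g \<otimes> y \<otimes> q \<in> X"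
    and g0: "g0 \<in> X"
  shows False
proof (rule spread_contradiction [OF g0 parallel_connected [OF E1 E2]])
  fix g q k l assume gq: "g \<in> X" "q \<in> X" "k \<in> H" "l \<in> H"
  note SR = affine_multinet.para_rho [OF para_sigma]
  have "wedge (A3 (inv (inv q \<otimes> inv l)) - A3 (inv (inv q))) (A1 (inv (inv (k \<otimes> g))) - A1 (inv (inv g))) = 0"
    by (rule affine_multinet.parallel_connected [OF SR E1 E2 X_inv [OF gq(2)] gq(1) H_closed(3) [OF gq(4)] gq(3)])
  then have "wedge (A3 (l \<otimes> q) - A3 q) (A1 (k \<otimes> g) - A1 g) = 0"
    using gq H_carrier by (simp add: inv_mult_group)
  then show "wedge (A1 (k \<otimes> g) - A1 g) (A3 (l \<otimes> q) - A3 q) = 0" using wedge_swap_eq_0 by blast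
  have "wedge (A3 (q \<otimes> l) - A3 q) (A2 (inv (inv k \<otimes> inv g)) - A2 (inv (inv g))) = 0"
    by (rule affine_multinet.parallel_connected [OF para_rho E1 E2 gq(2) X_inv [OF gq(1)] gq(4) H_closed(3) [OF gq(3)]])
  then have "wedge (A3 (q \<otimes> l) - A3 q) (A2 (g \<otimes> k) - A2 g) = 0"
    using gq H_carrier by (simp add: inv_mult_group)
  then show "wedge (A2 (g \<otimes> k) - A2 g) (A3 (q \<otimes> l) - A3 q) = 0" using wedge_swap_eq_0 by blast
qed

lemma conj_inverse:
  assumes g: "g \<in> carrier G" and conj: "\<And>k. k \<in> H \<Longrightarrow> inv g \<otimes> k \<otimes> g \<in> H" and k: "k \<in> H"
  shows "g \<otimes> k \<otimes> inv g \<in> H"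
proof -
  have "inj_on (\<lambda>k. inv g \<otimes> k \<otimes> g) H"
    using g by (intro inj_onI) (simp add: H_carrier)
  then have "(\<lambda>k. inv g \<otimes> k \<otimes> g) ` H = H"
    using conj by (intro endo_inj_surj fin_H) auto
  then obtain l where l: "l \<in> H" "k = inv g \<otimes> l \<otimes> g" using k by blast
  then have "g \<otimes> k \<otimes> inv g = l" using g H_carrier [OF l(1)] by (simp add: m_assoc cancel_assoc)
  then show ?thesis using l by simp
qed

lemma sum_conj:
  assumes g: "g \<in> carrier G" and conj: "\<And>k. k \<in> H \<Longrightarrow> inv g \<otimes> k \<otimes> g \<in> H"
  shows "(\<Sum>k\<in>H. f (k \<otimes> g)) = (\<Sum>k\<in>H. f (g \<otimes> k))"
proof -
  have inj: "inj_on (\<lambda>k. inv g \<otimes> k \<otimes> g) H"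
    using g by (intro inj_onI) (simp add: H_carrier)
  then have "(\<lambda>k. inv g \<otimes> k \<otimes> g) ` H = H"
    using conj by (intro endo_inj_surj fin_H) auto
  with inj have b: "bij_betw (\<lambda>k. inv g \<otimes> k \<otimes> g) H H" by (simp add: bij_betw_def)
  have "(\<Sum>k\<in>H. f (k \<otimes> g)) = (\<Sum>k\<in>H. f (g \<otimes> (inv g \<otimes> k \<otimes> g)))"
    using g by (intro sum.cong refl) (simp add: H_carrier m_assoc cancel_assoc)
  also have "\<dots> = (\<Sum>k\<in>H. f (g \<otimes> k))" using sum.reindex_bij_betw [OF b, of "\<lambda>k. f (g \<otimes> k)"] .
  finally show ?thesis .
qed

text \<open>By \<open>connected_contradiction\<close> two left cosets have no common neighbour among the right cosets,
  which with at least three cosets forces \<open>H\<close> to be normal of index 3.\<close>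

lemma normal_index_3:
  assumes card: "card (carrier G) \<ge> 3 * card H" and g0: "g0 \<in> X"
  obtains s where "s \<in> X" "s \<otimes> s \<in> X" "\<And>x. x \<in> X \<Longrightarrow> inv s \<otimes> x \<in> H \<or> s \<otimes> x \<in> H"
    "\<And>k. k \<in> H \<Longrightarrow> inv s \<otimes> k \<otimes> s \<in> H" "\<And>k. k \<in> H \<Longrightarrow> s \<otimes> k \<otimes> inv s \<in> H"
proof -
  have E2: "\<exists>g\<in>X. \<exists>y\<in>H. g \<otimes> y \<otimes> q \<in> X" if q: "q \<in> X" for q
  proof -
    have "card (H \<union> (\<lambda>x. x \<otimes> inv q) ` H) \<le> card H + card H"
      using card_image_le [OF fin_H] by (meson add_mono card_Un_le le_trans order_refl)
    then have "\<not> carrier G \<subseteq> H \<union> (\<lambda>x. x \<otimes> inv q) ` H"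
      using card order_ge_9 fin_H card_mono [of "H \<union> (\<lambda>x. x \<otimes> inv q) ` H" "carrier G"] by fastforce
    then obtain g where g: "g \<in> carrier G" "g \<notin> H" "g \<notin> (\<lambda>x. x \<otimes> inv q) ` H" by auto
    have "g = (g \<otimes> q) \<otimes> inv q" using g q by (simp add: m_assoc)
    then have "g \<otimes> q \<notin> H" using g by blast
    then show ?thesis using g q by (intro bexI [of _ g] bexI [of _ \<one>]) auto
  qed
  obtain g g' where g: "g \<in> X" "g' \<in> X" and
    no: "\<And>q. q \<in> X \<Longrightarrow> (\<forall>y\<in>H. g \<otimes> y \<otimes> q \<notin> X) \<or> (\<forall>y\<in>H. g' \<otimes> y \<otimes> q \<notin> X)"
    using connected_contradiction [OF _ E2 g0] by blast
  then have no': "(\<forall>y\<in>H. g \<otimes> y \<otimes> q \<in> H) \<or> (\<forall>y\<in>H. g' \<otimes> y \<otimes> q \<in> H)" if "q \<in> X" for q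
    using no [OF that] g that H_carrier by (metis DiffI X_carrier m_closed)
  define a b where "a = inv g" and "b = inv g'"
  have ab: "a \<in> X" "b \<in> X" "inv a = g" "inv b = g'" "a \<in> carrier G" "b \<in> carrier G"
    using g X_inv by (auto simp: a_def b_def)
  \<comment> \<open>The case \<open>y = \<one>\<close> of \<open>no'\<close>: the left cosets of
    \<open>a\<close> and \<open>b\<close> cover everything outside \<open>H\<close>.\<close>
  have cov: "inv a \<otimes> q \<in> H \<or> inv b \<otimes> q \<in> H" if "q \<in> X" for q
    using no' [OF that] ab g H_closed(1) by (metis X_carrier r_one)
  have ne: "inv a \<otimes> b \<notin> H"
  proof
    assume 1: "inv a \<otimes> b \<in> H"
    have "carrier G \<subseteq> H \<union> (\<lambda>x. a \<otimes> x) ` H"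
    proof
      fix x assume x: "x \<in> carrier G"
      show "x \<in> H \<union> (\<lambda>x. a \<otimes> x) ` H"
      proof (cases "x \<in> H")
        case False
        have "(inv a \<otimes> b) \<otimes> (inv b \<otimes> x) = inv a \<otimes> x" using x ab(5,6) by (simp add: m_assoc cancel_assoc)
        with cov [of x] 1 False x have "inv a \<otimes> x \<in> H" using H_closed(2) by (metis Diff_iff)
        moreover have "x = a \<otimes> (inv a \<otimes> x)" using x ab(5) by (simp add: cancel_assoc)
        ultimately show ?thesis by blast
      qed simp
    qed
    then have "card (carrier G) \<le> card (H \<union> (\<lambda>x. a \<otimes> x) ` H)" by (intro card_mono) (use fin_H in auto)
    also have "\<dots> \<le> card H + card H"
      using card_image_le [OF fin_H] by (meson add_mono card_Un_le le_trans order_refl)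
    finally show False using card order_ge_9 by simp
  qed
  have ne': "inv b \<otimes> a \<notin> H"
  proof
    assume "inv b \<otimes> a \<in> H"
    then have "inv (inv b \<otimes> a) \<in> H" by (rule H_closed(3))
    then show False using ne ab(5,6) by (simp add: inv_mult_group del: H_closed)
  qed
  \<comment> \<open>Take \<open>q = a\<close> in \<open>no'\<close>: the alternative for
    \<open>g'\<close> fails at \<open>\<one>\<close> because \<open>a\<close> and \<open>b\<close>
    lie in different cosets, so the one for \<open>g\<close> holds for all \<open>k\<close>.\<close>
  have conja: "inv a \<otimes> k \<otimes> a \<in> H" if "k \<in> H" for k
    using no' [OF ab(1)] that ne' ab H_closed(1) by (metis X_carrier g(2) r_one)
  have conjb: "inv b \<otimes> k \<otimes> b \<in> H" if "k \<in> H" for k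
    using no' [OF ab(2)] that ne ab H_closed(1) by (metis X_carrier g(1) r_one)
  \<comment> \<open>Of the three cosets, that of \<open>a\<close> is excluded since
    \<open>b \<notin> H\<close>, and that of \<open>b\<close> since \<open>b\<close> normalises
    \<open>H\<close> and \<open>a \<notin> H\<close>.\<close>
  have abH: "a \<otimes> b \<in> H"
  proof (rule ccontr)
    assume no: "a \<otimes> b \<notin> H"
    then have "inv a \<otimes> (a \<otimes> b) \<in> H \<or> inv b \<otimes> (a \<otimes> b) \<in> H" using cov [of "a \<otimes> b"] ab by auto
    moreover have "inv a \<otimes> (a \<otimes> b) \<notin> H" using ab(1,2,5,6) by (simp add: cancel_assoc)
    ultimately have "inv b \<otimes> (a \<otimes> b) \<in> H" by blast
    from conj_inverse [OF ab(6) conjb this] have "a \<in> H" using ab(1,2,5,6) by (simp add: m_assoc cancel_assoc)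
    then show False using ab(1,2,5,6) by simp
  qed
  have aaX: "a \<otimes> a \<in> X"
  proof (rule ccontr)
    assume "a \<otimes> a \<notin> X"
    then have "a \<otimes> a \<in> H" using ab(1,2,5,6) by simp
    then have "inv (a \<otimes> a) \<otimes> (a \<otimes> b) \<in> H" by (rule H_closed(2) [OF H_closed(3) abH])
    then show False using ne ab(1,2,5,6) by (simp add: inv_mult_group m_assoc cancel_assoc)
  qed
  show thesis
  proof (rule that [OF ab(1) aaX _ conja conj_inverse [OF ab(5) conja]])
    fix x assume x: "x \<in> X"
    show "inv a \<otimes> x \<in> H \<or> a \<otimes> x \<in> H"
    proof (cases "inv a \<otimes> x \<in> H")
      case False
      with cov [OF x] have "inv b \<otimes> x \<in> H" by blast
      then have "(a \<otimes> b) \<otimes> (inv b \<otimes> x) \<in> H" using abH by simp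
      then show ?thesis using x ab(5,6) by (simp add: m_assoc cancel_assoc)
    qed simp
  qed
qed

lemma mid_sum:
  assumes g: "g \<in> X" shows "(\<Sum>k\<in>H. A2 (inv g \<otimes> k)) = (\<Sum>k\<in>H. A1 (k \<otimes> g))"
proof -
  have "(\<Sum>k\<in>H. A2 (inv (k \<otimes> g))) = (\<Sum>k\<in>H. A2 (inv g \<otimes> k))"
    using sum_H_inv [of "\<lambda>k. A2 (inv g \<otimes> k)"] g H_carrier by (simp add: inv_mult_group cong: sum.cong)
  then show ?thesis using affine_multinet.right_sum [OF para_rho g] by simp
qed

lemma left_transversal:
  assumes g: "g \<in> X" and coll: "\<And>k l. k \<in> H \<Longrightarrow> l \<in> H \<Longrightarrow> wedge (A1 (g \<otimes> k) - A1 g) (A1 (g \<otimes> l) - A1 g) = 0"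
    and k: "k \<in> H" "k \<noteq> \<one>"
  shows "wedge (A1 (g \<otimes> k) - A1 g) (A3 (g \<otimes> k) - A3 g) \<noteq> 0"
proof -
  have e: "inv (l \<otimes> inv g) = g \<otimes> inv l" if "l \<in> H" for l using that g H_carrier by (simp add: inv_mult_group)
  have "inv k \<noteq> \<one>" using k H_carrier by (metis inv_inv inv_one)
  then have "wedge (A1 (inv (inv k \<otimes> inv g)) - A1 (inv (inv g))) (A3 (inv (inv k \<otimes> inv g)) - A3 (inv (inv g))) \<noteq> 0"
    using coll k g by (intro affine_multinet.right_transversal [OF para_sigma X_inv [OF g]]) (simp_all add: e)
  then show ?thesis using k g H_carrier by (simp add: e)
qed

text \<open>The two lines through \<open>c\<close> form a triangle with the line at infinity. The
  last two clauses place a whole coset on each of them, which later shows that neither has length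
  3.\<close>

definition triangle_shape :: "'k ^ 2 \<Rightarrow> 'k ^ 2 \<Rightarrow> 'k ^ 2 \<Rightarrow> bool" where
  "triangle_shape c D D' \<longleftrightarrow> wedge D D' \<noteq> 0 \<and>
    (\<forall>x\<in>X. \<forall>A\<in>{A1, A2, A3}. wedge (A x - c) D = 0 \<or> wedge (A x - c) D' = 0) \<and>
    (\<exists>s\<in>X. \<forall>k\<in>H. wedge (A1 (s \<otimes> k) - c) D = 0) \<and> (\<exists>s\<in>X. \<forall>k\<in>H. wedge (A1 (s \<otimes> k) - c) D' = 0)"

definition tetrahedron_shape :: "'k ^ 2 \<Rightarrow> 'k ^ 2 \<Rightarrow> 'k ^ 2 \<Rightarrow> 'k ^ 2 \<Rightarrow> bool" where
  "tetrahedron_shape c D1 D2 D3 \<longleftrightarrow> wedge D1 D2 \<noteq> 0 \<and> wedge D1 D3 \<noteq> 0 \<and> wedge D2 D3 \<noteq> 0 \<and>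
    (\<forall>x\<in>X. wedge (A1 x - c) D1 = 0 \<and> wedge (A2 x - c) D2 = 0 \<and> wedge (A3 x - c) D3 = 0)"

text \<open>In coordinates with origin \<open>c\<close> and axes \<open>P\<close>, \<open>Q\<close>
  this is a hyperbola: the product of the two coordinates is constant.\<close>

definition conic_shape :: "'k ^ 2 \<Rightarrow> 'k ^ 2 \<Rightarrow> 'k ^ 2 \<Rightarrow> 'k \<Rightarrow> bool" where
  "conic_shape c P Q \<kappa> \<longleftrightarrow> wedge P Q \<noteq> 0 \<and> \<kappa> \<noteq> 0 \<and>
    (\<forall>x\<in>X. \<forall>A\<in>{A1, A2, A3}. wedge (A x - c) Q * wedge P (A x - c) = \<kappa>)"

text \<open>The six families (three components on the cosets of \<open>s\<close> and of its inverse)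
  fall into two classes of three parallel ones, and all six have the same centroid. A line that
  contains a family passes through its centroid, so each class fills one line through
  \<open>c\<close>.\<close>

lemma index_3:
  assumes card: "card (carrier G) \<ge> 3 * card H" and g0: "g0 \<in> X"
  shows "\<exists>c D D'. triangle_shape c D D'"
proof -
  obtain s where s: "s \<in> X" "s \<otimes> s \<in> X" and cov: "\<And>x. x \<in> X \<Longrightarrow> inv s \<otimes> x \<in> H \<or> s \<otimes> x \<in> H"
    and conj: "\<And>k. k \<in> H \<Longrightarrow> inv s \<otimes> k \<otimes> s \<in> H" "\<And>k. k \<in> H \<Longrightarrow> s \<otimes> k \<otimes> inv s \<in> H"
    by (rule normal_index_3 [OF card g0]) blast
  define t where "t = inv s"
  have t: "t \<in> X" "inv t = s" "t \<otimes> t \<in> X" "s \<in> carrier G" "t \<in> carrier G"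
    using s X_inv [OF s(1)] X_inv [OF s(2)] by (auto simp: t_def inv_mult_group)
  have conj': "inv t \<otimes> k \<otimes> t \<in> H" if "k \<in> H" for k using conj(2) [OF that] s by (simp add: t_def)
  obtain k0 where k0: "k0 \<in> H" "k0 \<noteq> \<one>" by (rule exists_nontrivial)
  \<comment> \<open>Since \<open>s \<otimes> s\<close> and its inverse lie outside \<open>H\<close>,
    \<open>pair_parallel\<close> applies to \<open>A1\<close>, \<open>A2\<close> at the pair
    \<open>s\<close>, \<open>s\<close>, and its permuted form to \<open>A3\<close>,
    \<open>A2\<close> at the pair \<open>inv s\<close>, \<open>inv s\<close>.\<close>
  have main: "\<exists>D. D \<noteq> 0 \<and> (\<forall>k\<in>H. wedge D (A1 (s \<otimes> k) - A1 s) = 0 \<and> wedge D (A2 (s \<otimes> k) - A2 s) = 0 \<and>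
      wedge D (A3 (inv s \<otimes> k) - A3 (inv s)) = 0)"
    if s: "s \<in> X" "s \<otimes> s \<in> X" and cs: "\<And>k. k \<in> H \<Longrightarrow> s \<otimes> k \<otimes> inv s \<in> H" for s
  proof -
    have ss: "s \<otimes> \<one> \<otimes> s \<in> X" "inv s \<otimes> \<one> \<otimes> inv s \<in> X" using s X_inv [OF s(2)] by (auto simp: inv_mult_group)
    have p12: "wedge (A1 (s \<otimes> k) - A1 s) (A2 (l \<otimes> s) - A2 s) = 0" if "k \<in> H" "l \<in> H" for k l
      by (rule pair_parallel [OF s(1) s(1) H_closed(1) ss(1) that])
    have p12': "wedge (A1 (s \<otimes> k) - A1 s) (A2 (s \<otimes> l) - A2 s) = 0" if "k \<in> H" "l \<in> H" for k l
      using p12 [OF that(1) cs [OF that(2)]] s that H_carrier by (simp add: m_assoc)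
    have p23: "wedge (A3 (inv s \<otimes> k) - A3 (inv s)) (A2 (s \<otimes> l) - A2 s) = 0" if "k \<in> H" "l \<in> H" for k l
      using affine_multinet.pair_parallel [OF para_rho X_inv [OF s(1)] X_inv [OF s(1)] H_closed(1) ss(2) that(1) H_closed(3) [OF that(2)]]
        s that H_carrier by (simp add: inv_mult_group)
    define D where "D = A1 (s \<otimes> k0) - A1 s"
    have D0: "D \<noteq> 0" and E0: "A2 (s \<otimes> k0) - A2 s \<noteq> 0" using A_translate_ne(4,5) [OF s(1) k0] by (simp_all add: D_def)
    have "wedge D (A1 (s \<otimes> k) - A1 s) = 0" if "k \<in> H" for k
      using p12' [OF k0(1) k0(1)] p12' [OF that k0(1)] E0 wedge_common wedge_swap_eq_0 unfolding D_def by blast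
    moreover have "wedge D (A2 (s \<otimes> k) - A2 s) = 0" if "k \<in> H" for k
      using p12' [OF k0(1) that] unfolding D_def .
    moreover have "wedge D (A3 (inv s \<otimes> k) - A3 (inv s)) = 0" if "k \<in> H" for k
      using p12' [OF k0(1) k0(1)] p23 [OF that k0(1)] E0 wedge_common wedge_swap_eq_0 unfolding D_def by blast
    ultimately show ?thesis using D0 by blast
  qed
  obtain D where D0: "D \<noteq> 0" and D: "\<And>k. k \<in> H \<Longrightarrow> wedge D (A1 (s \<otimes> k) - A1 s) = 0"
      "\<And>k. k \<in> H \<Longrightarrow> wedge D (A2 (s \<otimes> k) - A2 s) = 0" "\<And>k. k \<in> H \<Longrightarrow> wedge D (A3 (t \<otimes> k) - A3 t) = 0"
    using main [OF s conj(2)] unfolding t_def by blast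
  obtain D' where D'0: "D' \<noteq> 0" and D': "\<And>k. k \<in> H \<Longrightarrow> wedge D' (A1 (t \<otimes> k) - A1 t) = 0"
      "\<And>k. k \<in> H \<Longrightarrow> wedge D' (A2 (t \<otimes> k) - A2 t) = 0" "\<And>k. k \<in> H \<Longrightarrow> wedge D' (A3 (s \<otimes> k) - A3 s) = 0"
    using main [OF t(1,3)] conj(1) t unfolding t_def by auto
  have "wedge (A1 (s \<otimes> k0) - A1 s) (A3 (s \<otimes> k0) - A3 s) \<noteq> 0"
    using D(1) D0 by (intro left_transversal s k0) (rule wedge_common)
  then have DD': "wedge D D' \<noteq> 0"
    using D(1) [OF k0(1)] D'(3) [OF k0(1)] D0 D'0 wedge_trans wedge_swap_eq_0 by metis
  define M where "M = (\<Sum>k\<in>H. A1 (s \<otimes> k))"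
  define h :: 'k where "h = of_nat (card H)"
  have h: "h \<noteq> 0" using card_H_char by (simp add: h_def)
  \<comment> \<open>\<open>left_sum\<close> and \<open>right_sum\<close> link the components on one
    coset, as left and right cosets agree here; \<open>mid_sum\<close> links the coset of
    \<open>s\<close> with that of \<open>t\<close>.\<close>
  have M: "(\<Sum>k\<in>H. A1 (s \<otimes> k)) = M" "(\<Sum>k\<in>H. A2 (s \<otimes> k)) = M" "(\<Sum>k\<in>H. A3 (s \<otimes> k)) = M"
    "(\<Sum>k\<in>H. A1 (t \<otimes> k)) = M" "(\<Sum>k\<in>H. A2 (t \<otimes> k)) = M" "(\<Sum>k\<in>H. A3 (t \<otimes> k)) = M"
    using left_sum [OF s(1)] left_sum [OF t(1)] right_sum [OF s(1)] right_sum [OF t(1)]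
      mid_sum [OF s(1)] mid_sum [OF t(1)] sum_conj [OF t(4) conj(1), of A1] sum_conj [OF t(4) conj(1), of A2]
      sum_conj [OF t(4) conj(1), of A3] sum_conj [OF t(5) conj', of A1] sum_conj [OF t(5) conj', of A2]
      sum_conj [OF t(5) conj', of A3] unfolding M_def t(2) t_def [symmetric] by metis+
  define c where "c = (1 / h) *s M"
  have hc: "h *s c = M" using h by (simp add: c_def)
  have on: "wedge (A (x \<otimes> k) - c) E = 0"
    if x: "x \<in> X" and k: "k \<in> H" and E: "\<And>k. k \<in> H \<Longrightarrow> wedge E (A (x \<otimes> k) - A x) = 0" and S: "(\<Sum>k\<in>H. A (x \<otimes> k)) = M"
    for A :: "'a \<Rightarrow> 'k ^ 2" and x k E
  proof -
    have e: "wedge (A (x \<otimes> l)) E = wedge (A (x \<otimes> k)) E" if "l \<in> H" for l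
    proof -
      have "wedge (A (x \<otimes> l) - A x) E = 0" "wedge (A (x \<otimes> k) - A x) E = 0"
        using E [OF that] E [OF k] wedge_swap_eq_0 by blast+
      then show ?thesis by (simp add: wedge_distribs)
    qed
    have "wedge M E = (\<Sum>l\<in>H. wedge (A (x \<otimes> k)) E)"
      unfolding S [symmetric] wedge_sum_left by (intro sum.cong refl e)
    then have "h * wedge c E = h * wedge (A (x \<otimes> k)) E" unfolding hc [symmetric] by (simp add: h_def)
    then show ?thesis using h by (simp add: wedge_distribs)
  qed
  have "wedge (A x - c) D = 0 \<or> wedge (A x - c) D' = 0" if x: "x \<in> X" and A: "A \<in> {A1, A2, A3}" for x A
  proof (cases "inv s \<otimes> x \<in> H")
    case True
    have e: "s \<otimes> (inv s \<otimes> x) = x" using x s by (simp add: cancel_assoc)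
    show ?thesis
      using A on [OF s(1) True D(1) M(1)] on [OF s(1) True D(2) M(2)] on [OF s(1) True D'(3) M(3)] unfolding e by auto
  next
    case False
    then have True: "s \<otimes> x \<in> H" using cov [OF x] by blast
    have e: "t \<otimes> (s \<otimes> x) = x" using x s by (simp add: t_def cancel_assoc)
    show ?thesis
      using A on [OF t(1) True D'(1) M(4)] on [OF t(1) True D'(2) M(5)] on [OF t(1) True D(3) M(6)] unfolding e by auto
  qed
  then have "triangle_shape c D D'"
    unfolding triangle_shape_def using DD' on [OF s(1) _ D(1) M(1)] on [OF t(1) _ D'(1) M(4)] s(1) t(1) by blast
  then show ?thesis by blast
qed

text \<open>Only one coset lies outside \<open>H\<close>, so \<open>A3\<close> has a left normal
  form, shared with \<open>A1\<close>, and a right one, shared with \<open>A2\<close>. The left form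
  decides between a conic and lines; comparing coefficients of the right form then carries the shape
  over to \<open>A2\<close>.\<close>

lemma index_2:
  assumes g: "g \<in> X" and ix: "\<And>x y. x \<in> X \<Longrightarrow> y \<in> X \<Longrightarrow> inv x \<otimes> y \<in> H"
  shows "(\<exists>c D1 D2 D3. tetrahedron_shape c D1 D2 D3) \<or> (\<exists>c P Q \<kappa>. conic_shape c P Q \<kappa>)"
proof -
  have gc: "g \<in> carrier G" using g by simp
  have R: "\<exists>k\<in>H. x = k \<otimes> g" if "x \<in> X" for x
  proof -
    have "x \<otimes> inv g \<in> H" using ix [OF X_inv [OF that] X_inv [OF g]] that by simp
    moreover have "x = (x \<otimes> inv g) \<otimes> g" using that g by (simp add: m_assoc)
    ultimately show ?thesis by blast
  qed
  have L: "\<exists>k\<in>H. x = inv (k \<otimes> inv g)" if "x \<in> X" for x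
  proof -
    have "inv x \<otimes> g \<in> H" by (rule ix [OF that g])
    moreover have "x = inv ((inv x \<otimes> g) \<otimes> inv g)" using that g by (simp add: m_assoc)
    ultimately show ?thesis by blast
  qed
  have conj: "inv g \<otimes> k \<otimes> g \<in> H" if "k \<in> H" for k
    using ix [OF g X_left [OF that g]] g that H_carrier by (simp add: m_assoc)
  define h :: 'k where "h = of_nat (card H)"
  have h: "h \<noteq> 0" using card_H_char by (simp add: h_def)
  obtain \<theta> P Q c u v where \<theta>: "grp_char HG \<theta>" "inj_on \<theta> H" and PQ: "wedge P Q \<noteq> 0" and uv: "u \<noteq> 0 \<or> v \<noteq> 0"
    and A2: "\<And>k. k \<in> H \<Longrightarrow> A2 (k \<otimes> g) = c + (u * \<theta> k) *s P + (v / \<theta> k) *s Q"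
    and A3: "\<And>k. k \<in> H \<Longrightarrow> A3 (k \<otimes> g) = c + (u * \<theta> k) *s Q + (v / \<theta> k) *s P"
    and S3: "(\<Sum>k\<in>H. A3 (k \<otimes> g)) = h *s c" unfolding h_def
    by (rule right_form_at [OF g]) blast
  obtain \<phi> P' Q' c' u' v' where \<phi>: "grp_char HG \<phi>" "inj_on \<phi> H" and PQ': "wedge P' Q' \<noteq> 0" and uv': "u' \<noteq> 0 \<or> v' \<noteq> 0"
    and A1': "\<And>k. k \<in> H \<Longrightarrow> A1 (inv (k \<otimes> inv g)) = c' + (u' * \<phi> k) *s P' + (v' / \<phi> k) *s Q'"
    and A3': "\<And>k. k \<in> H \<Longrightarrow> A3 (inv (k \<otimes> inv g)) = c' + (u' * \<phi> k) *s Q' + (v' / \<phi> k) *s P'"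
    and S3': "(\<Sum>k\<in>H. A3 (inv (k \<otimes> inv g))) = h *s c'" unfolding h_def
    by (rule affine_multinet.right_form_at [OF para_sigma X_inv [OF g]]) blast
  have "(\<Sum>k\<in>H. A3 (inv (k \<otimes> inv g))) = (\<Sum>k\<in>H. A3 (g \<otimes> k))"
    using sum_H_inv [of "\<lambda>k. A3 (g \<otimes> k)"] g H_carrier by (simp add: inv_mult_group cong: sum.cong)
  also have "\<dots> = (\<Sum>k\<in>H. A3 (k \<otimes> g))" using sum_conj [OF gc conj, of A3] by simp
  finally have "h *s c' = h *s c" using S3 S3' by simp
  then have cc: "c' = c" using h by simp
  have \<theta>0: "\<theta> k \<noteq> 0" if "k \<in> H" for k using HG_char(2) [OF \<theta>(1) that] .
  have \<phi>0: "\<phi> k \<noteq> 0" if "k \<in> H" for k using HG_char(2) [OF \<phi>(1) that] .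
  have H7: "card H \<ge> 7" using order_ge_9 by simp
  show ?thesis
  proof (cases "u' = 0 \<or> v' = 0")
    case False
    define \<kappa> where "\<kappa> = u' * v' * wedge P' Q' ^ 2"
    define q where "q = (\<lambda>w. wedge w Q' * wedge P' w)"
    have \<kappa>: "\<kappa> \<noteq> 0" using False PQ' by (simp add: \<kappa>_def)
    have q1: "q (A1 x - c) = \<kappa>" and q3: "q (A3 x - c) = \<kappa>" if x: "x \<in> X" for x
    proof -
      obtain k where k: "k \<in> H" "x = inv (k \<otimes> inv g)" using L [OF x] by blast
      show "q (A1 x - c) = \<kappa>" "q (A3 x - c) = \<kappa>"
        using A1' [OF k(1)] A3' [OF k(1)] \<phi>0 [OF k(1)] wedge_swap [of Q' P']
        by (simp_all add: k(2) cc q_def \<kappa>_def wedge_distribs power2_eq_square)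
    qed
    define \<alpha> \<beta> \<gamma> where "\<alpha> = wedge Q Q' * wedge P' Q" and "\<beta> = wedge Q Q' * wedge P' P + wedge P Q' * wedge P' Q"
      and "\<gamma> = wedge P Q' * wedge P' P"
    have qq: "q (a *s Q + b *s P) = a\<^sup>2 * \<alpha> + a * b * \<beta> + b\<^sup>2 * \<gamma>" for a b
      unfolding q_def \<alpha>_def \<beta>_def \<gamma>_def wedge_distribs wedge_simps by algebra
    have "v\<^sup>2 * \<gamma> + 0 * \<theta> k + (u * v * \<beta> - \<kappa>) * \<theta> k ^ 2 + 0 * \<theta> k ^ 3 + u\<^sup>2 * \<alpha> * \<theta> k ^ 4 + 0 * \<theta> k ^ 5 + 0 * \<theta> k ^ 6 = 0"
      if k: "k \<in> H" for k
    proof -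
      have "q ((u * \<theta> k) *s Q + (v / \<theta> k) *s P) = \<kappa>"
        using q3 [OF X_left [OF k g]] A3 [OF k] by simp
      then have E: "(u * \<theta> k)\<^sup>2 * \<alpha> + u * \<theta> k * (v / \<theta> k) * \<beta> + (v / \<theta> k)\<^sup>2 * \<gamma> = \<kappa>" unfolding qq .
      have r: "\<theta> k * (v / \<theta> k) = v" using \<theta>0 [OF k] by simp
      show ?thesis by (rule clear_denominator [OF E [symmetric] r [symmetric]])
    qed
    \<comment> \<open>As \<open>\<kappa>\<close> is nonzero, so are \<open>u\<close> and
      \<open>v\<close>, and the pure squares disappear from \<open>q\<close>. What remains is
      symmetric in the two coefficients, and \<open>A2\<close> arises from \<open>A3\<close> by
      exchanging them.\<close>
    from poly7_eq_0 [OF fin_H \<theta>(2) H7 this] have z: "v\<^sup>2 * \<gamma> = 0" "u * v * \<beta> = \<kappa>" "u\<^sup>2 * \<alpha> = 0" by auto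
    then have z': "\<alpha> = 0" "\<gamma> = 0" using \<kappa> by auto
    have q2: "q (A2 x - c) = \<kappa>" if x: "x \<in> X" for x
    proof -
      obtain k where k: "k \<in> H" "x = k \<otimes> g" using R [OF x] by blast
      have "A2 x - c = (v / \<theta> k) *s Q + (u * \<theta> k) *s P" using A2 [OF k(1)] k(2) by simp
      then have "q (A2 x - c) = v / \<theta> k * (u * \<theta> k) * \<beta>" by (simp only: qq z') simp
      also have "\<dots> = u * v * \<beta>" using \<theta>0 [OF k(1)] by simp
      finally show ?thesis using z by simp
    qed
    have "conic_shape c P' Q' \<kappa>"
      unfolding conic_shape_def using PQ' \<kappa> q1 q2 q3 unfolding q_def by auto
    then show ?thesis by blast
  next
    case True
    define D1 D3 where "D1 = (if v' = 0 then P' else Q')" and "D3 = (if v' = 0 then Q' else P')"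
    have D13: "wedge D1 D3 \<noteq> 0" using PQ' wedge_swap_eq_0 by (auto simp: D1_def D3_def)
    have on1: "wedge (A1 x - c) D1 = 0" and on3: "wedge (A3 x - c) D3 = 0" if x: "x \<in> X" for x
    proof -
      obtain k where k: "k \<in> H" "x = inv (k \<otimes> inv g)" using L [OF x] by blast
      show "wedge (A1 x - c) D1 = 0" "wedge (A3 x - c) D3 = 0"
        using A1' [OF k(1)] A3' [OF k(1)] True by (auto simp: k(2) cc D1_def D3_def)
    qed
    \<comment> \<open>The right normal form of \<open>A3\<close> must also stay on the line of
      direction \<open>D3\<close>, which forces \<open>u\<close> or \<open>v\<close> to
      vanish.\<close>
    have "v * wedge P D3 + 0 * \<theta> k + u * wedge Q D3 * \<theta> k ^ 2 + 0 * \<theta> k ^ 3 + 0 * \<theta> k ^ 4 + 0 * \<theta> k ^ 5 + 0 * \<theta> k ^ 6 = 0"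
      if k: "k \<in> H" for k
    proof -
      have "wedge ((u * \<theta> k) *s Q + (v / \<theta> k) *s P) D3 = 0"
        using on3 [OF X_left [OF k g]] A3 [OF k] by simp
      then have "u * \<theta> k * wedge Q D3 + v / \<theta> k * wedge P D3 = 0" by (simp add: wedge_distribs)
      moreover have "\<theta> k * (v / \<theta> k) = v" using \<theta>0 [OF k] by simp
      ultimately show ?thesis by algebra
    qed
    from poly7_eq_0 [OF fin_H \<theta>(2) H7 this] have z: "v * wedge P D3 = 0" "u * wedge Q D3 = 0" by auto
    have D30: "D3 \<noteq> 0" using D13 by auto
    have uv0: "u = 0 \<or> v = 0"
    proof (rule ccontr)
      assume "\<not> ?thesis"
      then have "wedge D3 P = 0" "wedge D3 Q = 0" using z wedge_swap_eq_0 by auto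
      then show False using wedge_zero_unique [OF _ _ PQ] D30 by blast
    qed
    define D2 where "D2 = (if v = 0 then P else Q)"
    have D20: "D2 \<noteq> 0" using PQ by (auto simp: D2_def)
    have D23: "wedge D2 D3 \<noteq> 0"
    proof
      assume "wedge D2 D3 = 0"
      then have "wedge P D3 = 0" "wedge Q D3 = 0" using z uv uv0 by (auto simp: D2_def split: if_splits)
      then show False using wedge_zero_unique [of D3 P Q] wedge_swap_eq_0 [of D3] PQ D30 by blast
    qed
    have on2: "wedge (A2 x - c) D2 = 0" if x: "x \<in> X" for x
    proof -
      obtain k where k: "k \<in> H" "x = k \<otimes> g" using R [OF x] by blast
      show ?thesis using A2 [OF k(1)] uv0 by (auto simp: k(2) D2_def)
    qed
    have d2: "wedge D2 (A2 x - A2 y) = 0" if "x \<in> X" "y \<in> X" for x y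
    proof -
      have "wedge (A2 x - A2 y) D2 = 0" using on2 [OF that(1)] on2 [OF that(2)] by (simp add: wedge_distribs)
      then show ?thesis using wedge_swap_eq_0 by blast
    qed
    have d1: "wedge D1 (A1 x - A1 y) = 0" if "x \<in> X" "y \<in> X" for x y
    proof -
      have "wedge (A1 x - A1 y) D1 = 0" using on1 [OF that(1)] on1 [OF that(2)] by (simp add: wedge_distribs)
      then show ?thesis using wedge_swap_eq_0 by blast
    qed
    obtain k0 where k0: "k0 \<in> H" "k0 \<noteq> \<one>" by (rule exists_nontrivial)
    \<comment> \<open>The independence of \<open>D1\<close> and \<open>D2\<close> is the
      transversality lemma for the pair \<open>A2\<close>, \<open>A1\<close>, obtained by permuting
      the components.\<close>
    have "wedge (A2 (inv (k \<otimes> g)) - A2 (inv g)) (A2 (inv (l \<otimes> g)) - A2 (inv g)) = 0" if "k \<in> H" "l \<in> H" for k l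
      using d2 [OF X_inv [OF X_left [OF that(1) g]] X_inv [OF g]] d2 [OF X_inv [OF X_left [OF that(2) g]] X_inv [OF g]]
        D20 by (rule wedge_common)
    then have "wedge (A2 (inv (k0 \<otimes> g)) - A2 (inv g)) (A1 (k0 \<otimes> g) - A1 g) \<noteq> 0"
      by (rule affine_multinet.right_transversal [OF para_rho g _ k0])
    moreover have "wedge D2 (A2 (inv (k0 \<otimes> g)) - A2 (inv g)) = 0"
      by (rule d2 [OF X_inv [OF X_left [OF k0(1) g]] X_inv [OF g]])
    moreover have "wedge D1 (A1 (k0 \<otimes> g) - A1 g) = 0" by (rule d1 [OF X_left [OF k0(1) g] g])
    ultimately have "wedge D1 D2 \<noteq> 0"
      using D20 D13 wedge_trans wedge_swap_eq_0 by (metis wedge_simps(2))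
    then have "tetrahedron_shape c D1 D2 D3"
      unfolding tetrahedron_shape_def using D13 D23 on1 on2 on3 by blast
    then show ?thesis by blast
  qed
qed

text \<open>Two elements outside \<open>H\<close> in different left cosets yield three disjoint
  cosets, hence the bound needed for \<open>index_3\<close>; otherwise \<open>index_2\<close>
  applies.\<close>

theorem affine_classification:
  assumes "H \<noteq> carrier G"
  shows "(\<exists>c D D'. triangle_shape c D D') \<or> (\<exists>c D1 D2 D3. tetrahedron_shape c D1 D2 D3) \<or>
    (\<exists>c P Q \<kappa>. conic_shape c P Q \<kappa>)"
proof -
  obtain g where g: "g \<in> X" using assms H_carrier by auto
  show ?thesis
  proof (cases "\<forall>x\<in>X. \<forall>y\<in>X. inv x \<otimes> y \<in> H")
    case True
    then show ?thesis using index_2 [OF g] by blast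
  next
    case False
    then obtain x y where xy: "x \<in> X" "y \<in> X" "inv x \<otimes> y \<notin> H" by blast
    have inj: "inj_on (\<lambda>k. x \<otimes> k) H" "inj_on (\<lambda>k. y \<otimes> k) H" using xy by (auto intro!: inj_onI simp: H_carrier)
    have c: "inv x \<otimes> y = k \<otimes> inv l" if "x \<otimes> k = y \<otimes> l" "k \<in> H" "l \<in> H" for k l
    proof -
      have "inv x \<otimes> y = inv x \<otimes> ((y \<otimes> l) \<otimes> inv l)" using xy that(3) by (simp add: m_assoc H_carrier)
      also have "y \<otimes> l = x \<otimes> k" by (rule that(1) [symmetric])
      also have "inv x \<otimes> (x \<otimes> k \<otimes> inv l) = k \<otimes> inv l"
        using xy that(2,3) by (simp add: m_assoc cancel_assoc H_carrier)
      finally show ?thesis .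
    qed
    have disj0: "H \<inter> (\<lambda>k. z \<otimes> k) ` H = {}" if "z \<in> X" for z
    proof -
      have "z \<otimes> k \<notin> H" if "k \<in> H" for k using X_right [OF \<open>z \<in> X\<close> that] by simp
      then show ?thesis by blast
    qed
    note disj1 = disj0 [OF xy(1)] and disj2 = disj0 [OF xy(2)]
    have "x \<otimes> k \<noteq> y \<otimes> l" if "k \<in> H" "l \<in> H" for k l
      using c [OF _ that] that xy(3) H_closed(2,3) by metis
    then have "(\<lambda>k. x \<otimes> k) ` H \<inter> (\<lambda>k. y \<otimes> k) ` H = {}" by blast
    then have disj: "H \<inter> (\<lambda>k. x \<otimes> k) ` H = {}" "(H \<union> (\<lambda>k. x \<otimes> k) ` H) \<inter> (\<lambda>k. y \<otimes> k) ` H = {}"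
      using disj1 disj2 by blast+
    have "3 * card H = card (H \<union> (\<lambda>k. x \<otimes> k) ` H \<union> (\<lambda>k. y \<otimes> k) ` H)"
      using fin_H by (simp add: card_Un_disjoint disj card_image inj)
    also have "\<dots> \<le> card (carrier G)"
      by (rule card_mono [OF fin]) (use xy H_carrier in auto)
    finally show ?thesis using index_3 [OF _ g] by blast
  qed
qed

end

section \<open>Ternary forms\<close>

lemma poly_mapping_sum_single: "F = (\<Sum>e\<in>Poly_Mapping.keys F. Poly_Mapping.single e (Poly_Mapping.lookup F e))"
  by (rule poly_mapping_eqI) (auto simp: lookup_sum lookup_single when_def in_keys_iff sum.delta)

text \<open>A common form of evaluation at a point and of the grading below, so that
  multiplicativity is proved once for both.\<close>

definition monoid_eval :: "('a::zero \<Rightarrow> 'r::comm_ring_1) \<Rightarrow> ('m \<Rightarrow> 'r) \<Rightarrow> ('m \<Rightarrow>\<^sub>0 'a) \<Rightarrow> 'r" where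
  "monoid_eval \<iota> X F = (\<Sum>e\<in>Poly_Mapping.keys F. \<iota> (Poly_Mapping.lookup F e) * X e)"

locale monoid_evaluation =
  fixes \<iota> :: "'a::field \<Rightarrow> 'r::comm_ring_1" and X :: "'m::comm_monoid_add \<Rightarrow> 'r"
  assumes \<iota>_0: "\<iota> 0 = 0" and \<iota>_add: "\<iota> (a + b) = \<iota> a + \<iota> b" and \<iota>_mult: "\<iota> (a * b) = \<iota> a * \<iota> b"
    and X_add: "X (d + e) = X d * X e"
begin

lemma add: "monoid_eval \<iota> X (F + G) = monoid_eval \<iota> X F + monoid_eval \<iota> X G"
  unfolding monoid_eval_def
  by (rule setsum_keys_plus_distrib) (simp_all add: \<iota>_0 \<iota>_add distrib_right)

lemma zero: "monoid_eval \<iota> X 0 = 0"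
  by (simp add: monoid_eval_def)

lemma sum: "monoid_eval \<iota> X (sum f A) = (\<Sum>x\<in>A. monoid_eval \<iota> X (f x))"
  by (induction A rule: infinite_finite_induct) (simp_all add: add zero)

lemma single: "monoid_eval \<iota> X (Poly_Mapping.single e c) = \<iota> c * X e"
  by (cases "c = 0") (simp_all add: monoid_eval_def \<iota>_0)

lemma mult: "monoid_eval \<iota> X (F * G) = monoid_eval \<iota> X F * monoid_eval \<iota> X G"
proof -
  have "F * G = (\<Sum>d\<in>Poly_Mapping.keys F. \<Sum>e\<in>Poly_Mapping.keys G.
      Poly_Mapping.single (d + e) (Poly_Mapping.lookup F d * Poly_Mapping.lookup G e))"
    by (subst poly_mapping_sum_single [of F], subst poly_mapping_sum_single [of G])
      (simp add: sum_product mult_single)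
  then have "monoid_eval \<iota> X (F * G) = (\<Sum>d\<in>Poly_Mapping.keys F. \<Sum>e\<in>Poly_Mapping.keys G.
      (\<iota> (Poly_Mapping.lookup F d) * X d) * (\<iota> (Poly_Mapping.lookup G e) * X e))"
    by (simp add: sum single \<iota>_mult X_add mult_ac)
  then show ?thesis by (simp add: monoid_eval_def sum_product)
qed

end

section \<open>Grading by total degree\<close>

definition mdeg :: "(3 \<Rightarrow>\<^sub>0 nat) \<Rightarrow> nat" where
  "mdeg e = (\<Sum>i\<in>UNIV. Poly_Mapping.lookup e i)"

lemma mdeg_add: "mdeg (d + e) = mdeg d + mdeg e"
  by (simp add: mdeg_def lookup_add sum.distrib)

lemma mdeg_eq_0: "mdeg e = 0 \<longleftrightarrow> e = 0"
  by (auto simp: mdeg_def intro: poly_mapping_eqI)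

lemma mdeg_eq_1: "mdeg e = 1 \<longleftrightarrow> (\<exists>i. e = Poly_Mapping.single i 1)"
proof
  assume "mdeg e = 1"
  then obtain i where i: "Poly_Mapping.lookup e i = 1" "\<And>j. i \<noteq> j \<Longrightarrow> Poly_Mapping.lookup e j = 0"
    unfolding mdeg_def by (subst (asm) sum_eq_1_iff) auto
  then have "e = Poly_Mapping.single i 1"
    by (intro poly_mapping_eqI) (auto simp: lookup_single when_def)
  then show "\<exists>i. e = Poly_Mapping.single i 1" ..
next
  assume "\<exists>i. e = Poly_Mapping.single i 1"
  then show "mdeg e = 1" by (auto simp: mdeg_def lookup_single when_def sum.delta)
qed

lemma eval3_monoid_eval: "eval3 F v = monoid_eval id (\<lambda>e. \<Prod>i\<in>UNIV. (v $ i) ^ Poly_Mapping.lookup e i) F"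
  by (simp add: eval3_def monoid_eval_def)

lemma eval3_evaluation:
  fixes v :: "'k::field ^ 3"
  shows "monoid_evaluation id (\<lambda>e. \<Prod>i\<in>UNIV. (v $ i) ^ Poly_Mapping.lookup e i)"
  by unfold_locales (simp_all add: lookup_add power_add prod.distrib)

lemma eval3_add: "eval3 (F + G) v = eval3 F v + eval3 G v"
  and eval3_mult: "eval3 (F * G) v = eval3 F v * eval3 G v"
  and eval3_sum: "eval3 (sum f A) v = (\<Sum>x\<in>A. eval3 (f x) v)"
  and eval3_single: "eval3 (Poly_Mapping.single e c) v = c * (\<Prod>i\<in>UNIV. (v $ i) ^ Poly_Mapping.lookup e i)"
  using monoid_evaluation.add [OF eval3_evaluation] monoid_evaluation.mult [OF eval3_evaluation]
    monoid_evaluation.sum [OF eval3_evaluation] monoid_evaluation.single [OF eval3_evaluation]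
  by (simp_all add: eval3_monoid_eval)

text \<open>The substitution of \<open>t x\<close> for \<open>x\<close>: the coefficient of \<open>t\<^sup>n\<close> is the homogeneous component of degree \<open>n\<close>.\<close>

definition graded :: "'k::field poly3 \<Rightarrow> 'k poly3 poly" where
  "graded = monoid_eval (\<lambda>c. [:Poly_Mapping.single 0 c:]) (\<lambda>e. monom (Poly_Mapping.single e 1) (mdeg e))"

lemma graded_evaluation:
  "monoid_evaluation (\<lambda>c::'k::field. [:Poly_Mapping.single 0 c:]) (\<lambda>e. monom (Poly_Mapping.single e 1 :: 'k poly3) (mdeg e))"
  by unfold_locales (simp_all add: single_add mult_single mult_monom mdeg_add mult.commute)

lemma graded_mult: "graded (F * G) = graded F * graded G"
  unfolding graded_def by (rule monoid_evaluation.mult [OF graded_evaluation])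

lemma lookup_coeff_graded: "Poly_Mapping.lookup (coeff (graded F) n) e = (if mdeg e = n then Poly_Mapping.lookup F e else 0)"
proof -
  have "graded F = (\<Sum>e\<in>Poly_Mapping.keys F. monom (Poly_Mapping.single e (Poly_Mapping.lookup F e)) (mdeg e))"
    unfolding graded_def monoid_eval_def by (intro sum.cong) (simp_all add: smult_monom mult_single)
  then have "Poly_Mapping.lookup (coeff (graded F) n) e
      = (\<Sum>d\<in>Poly_Mapping.keys F. Poly_Mapping.lookup (if mdeg d = n then Poly_Mapping.single d (Poly_Mapping.lookup F d) else 0) e)"
    by (simp add: coeff_sum lookup_sum)
  also have "\<dots> = (\<Sum>d\<in>Poly_Mapping.keys F. if d = e then if mdeg e = n then Poly_Mapping.lookup F e else 0 else 0)"
    by (intro sum.cong) (auto simp: lookup_single when_def)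
  finally show ?thesis by (simp add: sum.delta in_keys_iff)
qed

lemma coeff_graded_ne: "e \<in> Poly_Mapping.keys F \<Longrightarrow> coeff (graded F) (mdeg e) \<noteq> 0"
  using lookup_coeff_graded [of F "mdeg e" e] by (auto simp: in_keys_iff)

lemma graded_eq_0: "graded F = 0 \<longleftrightarrow> F = 0"
proof
  assume "graded F = 0"
  then have "e \<notin> Poly_Mapping.keys F" for e using coeff_graded_ne [of e F] by auto
  then show "F = 0" by (intro poly_mapping_eqI) (simp add: in_keys_iff)
next
  show "F = 0 \<Longrightarrow> graded F = 0" by (simp add: graded_def monoid_eval_def)
qed

lemma form3_iff: "form3 n F \<longleftrightarrow> F \<noteq> 0 \<and> (\<forall>e\<in>Poly_Mapping.keys F. mdeg e = n)"
  by (simp add: form3_def mdeg_def)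

lemma graded_form:
  assumes "form3 n F" shows "graded F = monom F n"
proof (rule poly_eqI, rule poly_mapping_eqI)
  fix m e
  show "Poly_Mapping.lookup (coeff (graded F) m) e = Poly_Mapping.lookup (coeff (monom F n) m) e"
    using assms by (auto simp: lookup_coeff_graded form3_iff in_keys_iff)
qed

lemma form3_mult:
  assumes "form3 m F" "form3 n G" shows "form3 (m + n) (F * G)"
  using assms keys_mult [of F G] by (fastforce simp: form3_iff mdeg_add)

section \<open>Linear forms and irreducible quadratic forms\<close>

definition lin :: "'k::field ^ 3 \<Rightarrow> 'k ^ 3 \<Rightarrow> 'k" where
  "lin l v = (\<Sum>i\<in>UNIV. l $ i * v $ i)"

definition linear_form :: "'k::field ^ 3 \<Rightarrow> 'k poly3" where
  "linear_form l = (\<Sum>i\<in>UNIV. Poly_Mapping.single (Poly_Mapping.single i 1) (l $ i))"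

lemma eval3_linear_form: "eval3 (linear_form l) v = lin l v"
proof -
  have "(\<Prod>j\<in>UNIV. (v $ j) ^ Poly_Mapping.lookup (Poly_Mapping.single i (1::nat)) j) = v $ i" for i
  proof -
    have "(\<Prod>j\<in>UNIV. (v $ j) ^ Poly_Mapping.lookup (Poly_Mapping.single i (1::nat)) j) = (\<Prod>j\<in>UNIV. if j = i then v $ j else 1)"
      by (intro prod.cong) (auto simp: lookup_single when_def)
    then show ?thesis by simp
  qed
  then show ?thesis by (simp add: linear_form_def eval3_sum eval3_single lin_def)
qed

lemma single_one_inject: "Poly_Mapping.single i (Suc 0) = Poly_Mapping.single j (Suc 0) \<longleftrightarrow> i = j"
  by (metis lookup_single_eq lookup_single_not_eq nat.distinct(1))

lemma lookup_linear_form: "Poly_Mapping.lookup (linear_form l) (Poly_Mapping.single i (Suc 0)) = l $ i"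
  by (auto simp: linear_form_def lookup_sum lookup_single when_def single_one_inject sum.delta)

lemma lookup_linear_form_eq_0:
  "(\<And>i. e \<noteq> Poly_Mapping.single i (Suc 0)) \<Longrightarrow> Poly_Mapping.lookup (linear_form l) e = 0"
  by (auto simp: linear_form_def lookup_sum lookup_single when_def eq_commute [of _ e] intro!: sum.neutral)

lemma form3_linear_form:
  assumes "l \<noteq> 0" shows "form3 1 (linear_form l)"
proof -
  obtain i where i: "l $ i \<noteq> 0" using assms by (auto simp: vec_eq_iff)
  with lookup_linear_form [of l i] have "linear_form l \<noteq> 0" by auto
  moreover have "mdeg e = 1" if "e \<in> Poly_Mapping.keys (linear_form l)" for e
    using that lookup_linear_form_eq_0 [of e l] unfolding mdeg_eq_1 in_keys_iff by auto
  ultimately show ?thesis by (simp add: form3_iff)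
qed

lemma degree_1_linear:
  assumes "\<forall>e\<in>Poly_Mapping.keys F. mdeg e = 1" 
  shows "\<exists>l. \<forall>v. eval3 F v = lin l v"
proof -
  let ?l = "\<chi> i. Poly_Mapping.lookup F (Poly_Mapping.single i 1)"
  have "F = linear_form ?l"
  proof (rule poly_mapping_eqI)
    fix e show "Poly_Mapping.lookup F e = Poly_Mapping.lookup (linear_form ?l) e"
    proof (cases "\<exists>i. e = Poly_Mapping.single i 1")
      case True
      then show ?thesis by (auto simp: lookup_linear_form)
    next
      case False
      then have "mdeg e \<noteq> 1" unfolding mdeg_eq_1 .
      then have "e \<notin> Poly_Mapping.keys F" using assms by blast
      then show ?thesis using False by (simp add: lookup_linear_form_eq_0 in_keys_iff)
    qed
  qed
  then show ?thesis by (metis eval3_linear_form)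
qed

text \<open>Degrees in the grading variable add under multiplication, and factors of degree 0 are
  constants, hence units. A proper factorisation therefore has degrees 1 and 1, and the leading
  components display \<open>C\<close> as a product of two linear forms.\<close>

lemma irreducible_quadratic_form:
  assumes C: "form3 2 C" and no: "\<And>p q. \<exists>v. eval3 C v \<noteq> lin p v * lin q v"
  shows "irreducible C"
proof (rule irreducibleI)
  have C0: "C \<noteq> 0" using C by (simp add: form3_iff)
  show "C \<noteq> 0" by (rule C0)
  have gC: "graded C = monom C 2" by (rule graded_form [OF C])
  have deg: "degree (graded a) + degree (graded b) = degree (graded (a * b))" if "a * b \<noteq> 0" for a b :: "'a poly3"
    using that unfolding graded_mult by (subst degree_mult_eq) (auto simp: graded_eq_0)
  show "\<not> C dvd 1"
  proof
    assume "C dvd 1"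
    then obtain D where D: "1 = C * D" by (elim dvdE)
    have "graded (Poly_Mapping.single 0 1) = (1 :: 'a poly3 poly)"
      unfolding graded_def monoid_evaluation.single [OF graded_evaluation]
      by (simp add: mdeg_def monom_0 one_pCons)
    then have "graded 1 = (1 :: 'a poly3 poly)" by (simp only: single_one)
    then have "degree (graded C) + degree (graded D) = 0" using deg [of C D] unfolding D [symmetric] by simp
    then show False using C0 by (simp add: gC degree_monom_eq)
  qed
  have unit: "a dvd 1" if a0: "a \<noteq> 0" and d: "degree (graded a) = 0" for a :: "'a poly3"
  proof -
    have "e = 0" if "e \<in> Poly_Mapping.keys a" for e
    proof -
      have "mdeg e \<le> degree (graded a)" using coeff_graded_ne [OF that] by (rule le_degree)
      then show ?thesis using d mdeg_eq_0 by simp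
    qed
    then have a: "a = Poly_Mapping.single 0 (Poly_Mapping.lookup a 0)"
      by (intro poly_mapping_eqI) (metis in_keys_iff lookup_single_eq lookup_single_not_eq)
    have c: "Poly_Mapping.lookup a 0 \<noteq> 0" using a a0 by (metis single_zero)
    have "a * Poly_Mapping.single 0 (1 / Poly_Mapping.lookup a 0) = 1"
      by (subst a) (use c in \<open>simp add: mult_single\<close>)
    then show ?thesis by (metis dvdI)
  qed
  fix a b assume ab: "C = a * b"
  show "a dvd 1 \<or> b dvd 1"
  proof (rule ccontr)
    assume "\<not> ?thesis"
    then have n: "degree (graded a) \<noteq> 0" "degree (graded b) \<noteq> 0" using unit C0 ab by auto
    have "degree (graded a) + degree (graded b) = 2"
      using deg [of a b] C0 ab gC by (simp add: degree_monom_eq)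
    with n have d1: "degree (graded a) = 1" "degree (graded b) = 1" by linarith+
    \<comment> \<open>The factors may be inhomogeneous; comparing top coefficients replaces them by
      their homogeneous parts of degree 1.\<close>
    have "C = coeff (graded C) 2" by (simp add: gC)
    also have "\<dots> = coeff (graded a) 1 * coeff (graded b) 1"
      using coeff_mult_degree_sum [of "graded a" "graded b"] unfolding ab graded_mult d1 by (simp add: numeral_2_eq_2)
    finally have C1: "C = coeff (graded a) 1 * coeff (graded b) 1" .
    have "\<forall>e\<in>Poly_Mapping.keys (coeff (graded F) 1). mdeg e = 1" for F :: "'a poly3"
      by (auto simp: in_keys_iff lookup_coeff_graded split: if_splits)
    then obtain p q where "\<And>v. eval3 (coeff (graded a) 1) v = lin p v" "\<And>v. eval3 (coeff (graded b) 1) v = lin q v"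
      using degree_1_linear by metis
    then have "\<And>v. eval3 C v = lin p v * lin q v" by (subst C1) (simp add: eval3_mult)
    then show False using no [of p q] by blast
  qed
qed

section \<open>Lines of the projective plane as kernels of functionals\<close>

lemma vec3_eq_iff: "(u :: 'k ^ 3) = v \<longleftrightarrow> u $ 1 = v $ 1 \<and> u $ 2 = v $ 2 \<and> u $ 3 = v $ 3"
  by (simp add: vec_eq_iff forall_3)

lemma lin_3: "lin l v = l $ 1 * v $ 1 + l $ 2 * v $ 2 + l $ 3 * v $ 3"
  by (simp add: lin_def sum_3)

lemma lin_linear [simp]:
  "lin l (u + v) = lin l u + lin l v" "lin l (u - v) = lin l u - lin l v" "lin l (c *s v) = c * lin l v" "lin l 0 = 0"
  by (simp_all add: lin_3 algebra_simps)

definition cross :: "'k::field ^ 3 \<Rightarrow> 'k ^ 3 \<Rightarrow> 'k ^ 3" where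
  "cross u v = vector [u $ 2 * v $ 3 - u $ 3 * v $ 2, u $ 3 * v $ 1 - u $ 1 * v $ 3, u $ 1 * v $ 2 - u $ 2 * v $ 1]"

lemma cross_nth [simp]:
  "cross u v $ 1 = u $ 2 * v $ 3 - u $ 3 * v $ 2" "cross u v $ 2 = u $ 3 * v $ 1 - u $ 1 * v $ 3"
  "cross u v $ 3 = u $ 1 * v $ 2 - u $ 2 * v $ 1"
  by (simp_all add: cross_def)

lemma lin_cross [simp]: "lin (cross u v) u = 0" "lin (cross u v) v = 0"
  by (simp_all add: lin_3 algebra_simps)

lemma cross_eq_0E:
  assumes "cross u v = 0" "u \<noteq> 0"
  obtains c where "v = c *s u"
proof -
  have e: "u $ 2 * v $ 3 = u $ 3 * v $ 2" "u $ 3 * v $ 1 = u $ 1 * v $ 3" "u $ 1 * v $ 2 = u $ 2 * v $ 1"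
    using assms(1) by (simp_all add: vec3_eq_iff)
  consider "u $ 1 \<noteq> 0" | "u $ 2 \<noteq> 0" | "u $ 3 \<noteq> 0" using assms(2) by (auto simp: vec3_eq_iff)
  then show thesis
  proof cases
    case 1 then show thesis using e by (intro that [of "v $ 1 / u $ 1"]) (simp add: vec3_eq_iff field_simps)
  next
    case 2 then show thesis using e by (intro that [of "v $ 2 / u $ 2"]) (simp add: vec3_eq_iff field_simps)
  next
    case 3 then show thesis using e by (intro that [of "v $ 3 / u $ 3"]) (simp add: vec3_eq_iff field_simps)
  qed
qed

lemma cross_cross_eq_0:
  assumes "lin l u = 0" "lin l v = 0" shows "cross (cross u v) l = 0"
  using assms unfolding vec3_eq_iff lin_3 cross_nth zero_index by (intro conjI; algebra)

lemma subspace_lin: "vec.subspace {v. lin l v = 0}"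
  by (auto simp: vec.subspace_def)

lemma dim_two_independent:
  assumes "(u :: 'k::field ^ 3) \<noteq> 0" "\<And>c. v \<noteq> c *s u"
  shows "vec.dim (vec.span {u, v}) = 2" "vec.independent {u, v}"
proof -
  have ne: "v \<noteq> u" using assms(2) [of 1] by simp
  have "vec.independent {u}" using assms(1) by (simp add: vec.dependent_single)
  moreover have "v \<notin> vec.span {u}" using assms(2) by (auto simp: vec.span_singleton)
  ultimately have "vec.independent (insert v {u})" by (rule vec.independent_insertI [rotated])
  then show i: "vec.independent {u, v}" by (simp add: insert_commute)
  show "vec.dim (vec.span {u, v}) = 2"
    using vec.dim_span_eq_card_independent [OF i] ne by simp
qed

lemma dim_lin:
  assumes "(l :: 'k::field ^ 3) \<noteq> 0" shows "vec.dim {v. lin l v = 0} = 2"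
proof -
  have main: "vec.dim {v. lin l v = 0} = 2"
    if u: "u \<noteq> 0" "\<And>c. w \<noteq> c *s u" "lin l u = 0" "lin l w = 0" and sp: "\<And>v. lin l v = 0 \<Longrightarrow> \<exists>a b. v = a *s u + b *s w"
    for u w :: "'k ^ 3"
  proof -
    have "{v. lin l v = 0} = vec.span {u, w}"
    proof
      show "{v. lin l v = 0} \<subseteq> vec.span {u, w}"
      proof
        fix v assume "v \<in> {v. lin l v = 0}"
        then obtain a b where "v = a *s u + b *s w" using sp by blast
        then show "v \<in> vec.span {u, w}" by (simp add: vec.span_add vec.span_scale vec.span_base)
      qed
      show "vec.span {u, w} \<subseteq> {v. lin l v = 0}"
        by (rule vec.span_minimal) (use u subspace_lin in auto)
    qed
    then show ?thesis using dim_two_independent [OF u(1,2)] by simp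
  qed
  consider "l $ 1 \<noteq> 0" | "l $ 2 \<noteq> 0" | "l $ 3 \<noteq> 0" using assms by (auto simp: vec3_eq_iff)
  then show ?thesis
  proof cases
    case 1
    show ?thesis
    proof (rule main [of "vector [- l $ 2, l $ 1, 0]" "vector [- l $ 3, 0, l $ 1]"])
      fix v assume "lin l v = 0"
      then have "v $ 1 * l $ 1 = - (l $ 2 * v $ 2) - l $ 3 * v $ 3" unfolding lin_3 by algebra
      then show "\<exists>a b. v = a *s vector [- l $ 2, l $ 1, 0] + b *s vector [- l $ 3, 0, l $ 1]"
        using 1 by (intro exI [of _ "v $ 2 / l $ 1"] exI [of _ "v $ 3 / l $ 1"]) (simp add: vec3_eq_iff field_simps)
    qed (use 1 in \<open>auto simp: vec3_eq_iff lin_3\<close>)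
  next
    case 2
    show ?thesis
    proof (rule main [of "vector [l $ 2, - l $ 1, 0]" "vector [0, - l $ 3, l $ 2]"])
      fix v assume "lin l v = 0"
      then have "v $ 2 * l $ 2 = - (l $ 1 * v $ 1) - l $ 3 * v $ 3" unfolding lin_3 by algebra
      then show "\<exists>a b. v = a *s vector [l $ 2, - l $ 1, 0] + b *s vector [0, - l $ 3, l $ 2]"
        using 2 by (intro exI [of _ "v $ 1 / l $ 2"] exI [of _ "v $ 3 / l $ 2"]) (simp add: vec3_eq_iff field_simps)
    qed (use 2 in \<open>auto simp: vec3_eq_iff lin_3\<close>)
  next
    case 3
    show ?thesis
    proof (rule main [of "vector [l $ 3, 0, - l $ 1]" "vector [0, l $ 3, - l $ 2]"])
      fix v assume "lin l v = 0"
      then have "v $ 3 * l $ 3 = - (l $ 1 * v $ 1) - l $ 2 * v $ 2" unfolding lin_3 by algebra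
      then show "\<exists>a b. v = a *s vector [l $ 3, 0, - l $ 1] + b *s vector [0, l $ 3, - l $ 2]"
        using 3 by (intro exI [of _ "v $ 1 / l $ 3"] exI [of _ "v $ 2 / l $ 3"]) (simp add: vec3_eq_iff field_simps)
    qed (use 3 in \<open>auto simp: vec3_eq_iff lin_3\<close>)
  qed
qed

definition kernel_line :: "'k::field ^ 3 \<Rightarrow> ('k ^ 3) set set" where
  "kernel_line l = {P \<in> PG2. \<forall>v\<in>P. lin l v = 0}"

lemma kernel_line_in_lines: "l \<noteq> 0 \<Longrightarrow> kernel_line l \<in> PG2_lines"
  unfolding PG2_lines_def kernel_line_def
  by (intro CollectI exI [of _ "{v. lin l v = 0}"] conjI subspace_lin dim_lin) auto

text \<open>The cross product of a basis of \<open>W\<close> is a functional vanishing on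
  \<open>W\<close>; equality of dimensions turns the inclusion in its kernel into an
  equality.\<close>

lemma line_obtain_kernel:
  assumes "m \<in> PG2_lines" obtains l where "l \<noteq> 0" "m = kernel_line l"
proof -
  obtain W where W: "m = {P \<in> PG2. P \<subseteq> W}" "vec.subspace W" "vec.dim W = 2"
    using assms by (auto simp: PG2_lines_def)
  obtain B where B: "B \<subseteq> W" "vec.independent B" "W \<subseteq> vec.span B" "card B = vec.dim W" by (rule vec.basis_exists)
  obtain u v where uv: "B = {u, v}" "u \<noteq> v" using B(4) W(3) by (auto simp: card_2_iff)
  have u0: "u \<noteq> 0" using B(2) uv vec.dependent_zero [of B] by auto
  have "v \<noteq> c *s u" for c
    using B(2) uv vec.independent_insert [of v "{u}"] by (auto simp: vec.span_singleton insert_commute)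
  then have l0: "cross u v \<noteq> 0" using cross_eq_0E [OF _ u0] by blast
  have "W \<subseteq> {w. lin (cross u v) w = 0}"
    using B(3) vec.span_minimal [OF _ subspace_lin, of B "cross u v"] uv by auto
  then have "W = {w. lin (cross u v) w = 0}"
    by (intro vec.subspace_dim_equal W(2) subspace_lin) (simp_all add: W(3) dim_lin [OF l0])
  then show thesis using l0 W(1) by (intro that [of "cross u v"]) (auto simp: kernel_line_def)
qed

lemma PG2_iff: "P \<in> PG2 \<longleftrightarrow> (\<exists>v. v \<noteq> 0 \<and> P = vec.span {v})"
proof
  assume P: "P \<in> PG2"
  then have sP: "vec.subspace P" "vec.dim P = 1" by (auto simp: PG2_def)
  obtain B where B: "B \<subseteq> P" "vec.independent B" "P \<subseteq> vec.span B" "card B = vec.dim P" by (rule vec.basis_exists)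
  obtain v where v: "B = {v}" using B(4) sP(2) by (auto simp: card_1_singleton_iff)
  have "v \<noteq> 0" using B(2) v vec.dependent_zero [of B] by auto
  moreover have "P = vec.span {v}" using B sP v vec.span_minimal by blast
  ultimately show "\<exists>v. v \<noteq> 0 \<and> P = vec.span {v}" by blast
next
  assume "\<exists>v. v \<noteq> 0 \<and> P = vec.span {v}"
  then obtain v where v: "v \<noteq> 0" "P = vec.span {v}" by blast
  then have "vec.dim P = 1" using vec.dim_span_eq_card_independent [of "{v}"] by (simp add: vec.dependent_single)
  then show "P \<in> PG2" using v by (simp add: PG2_def vec.subspace_span)
qed

lemma span_in_PG2: "v \<noteq> 0 \<Longrightarrow> vec.span {v} \<in> PG2"
  using PG2_iff by blast

lemma span_in_kernel_line: "v \<noteq> 0 \<Longrightarrow> vec.span {v} \<in> kernel_line l \<longleftrightarrow> lin l v = 0"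
  by (simp add: kernel_line_def span_in_PG2) (auto simp: vec.span_singleton)

lemma span_eq_iff_scale:
  assumes "v \<noteq> 0" "w \<noteq> 0" shows "vec.span {v} = vec.span {w} \<longleftrightarrow> (\<exists>c. w = c *s v)"
proof
  assume "vec.span {v} = vec.span {w}"
  then show "\<exists>c. w = c *s v" using vec.span_base [of w "{w}"] by (auto simp: vec.span_singleton)
next
  assume "\<exists>c. w = c *s v"
  then obtain c where c: "w = c *s v" "c \<noteq> 0" using assms by auto
  have "k *s v = (k / c) *s (c *s v)" for k using c by simp
  then show "vec.span {v} = vec.span {w}" unfolding c(1) vec.span_singleton by fastforce
qed

text \<open>A functional that vanishes on two independent vectors is a multiple of their cross
  product.\<close>

lemma two_points_one_line:
  assumes "m \<in> PG2_lines" "m' \<in> PG2_lines" "P \<in> m" "Q \<in> m" "P \<in> m'" "Q \<in> m'" "P \<noteq> Q"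
  shows "m = m'"
proof -
  obtain l where l: "l \<noteq> 0" "m = kernel_line l" by (rule line_obtain_kernel [OF assms(1)])
  obtain l' where l': "l' \<noteq> 0" "m' = kernel_line l'" by (rule line_obtain_kernel [OF assms(2)])
  have "P \<in> PG2" "Q \<in> PG2" using assms l by (auto simp: kernel_line_def)
  then obtain u v where u: "u \<noteq> 0" "P = vec.span {u}" and v: "v \<noteq> 0" "Q = vec.span {v}" by (auto simp: PG2_iff)
  have z: "lin l u = 0" "lin l v = 0" "lin l' u = 0" "lin l' v = 0"
    using assms u v span_in_kernel_line unfolding l l' by blast+
  have c0: "cross u v \<noteq> 0"
  proof
    assume "cross u v = 0"
    then obtain c where "v = c *s u" by (rule cross_eq_0E [OF _ u(1)])
    then show False using assms(7) span_eq_iff_scale [OF u(1) v(1)] u v by blast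
  qed
  have K: "kernel_line k = kernel_line (cross u v)" if k: "k \<noteq> 0" "lin k u = 0" "lin k v = 0" for k
  proof -
    obtain c where c: "k = c *s cross u v" by (rule cross_eq_0E [OF cross_cross_eq_0 [OF k(2,3)] c0])
    then have "c \<noteq> 0" using k by auto
    moreover have "lin k w = c * lin (cross u v) w" for w by (simp add: c lin_3 algebra_simps)
    ultimately show ?thesis by (simp add: kernel_line_def)
  qed
  show ?thesis using K [OF l(1) z(1,2)] K [OF l'(1) z(3,4)] l(2) l'(2) by simp
qed

lemma curve_linear_form: "curve (linear_form l) = kernel_line l"
  by (simp add: curve_def kernel_line_def eval3_linear_form)

text \<open>Dropping a coordinate in which \<open>l0\<close> is nonzero leaves two coordinates that,
  together with \<open>l0\<close>, form a coordinate system. The last two properties translate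
  linear functionals into line equations of the chart and back.\<close>

lemma affine_chart:
  fixes l0 :: "'k::field ^ 3"
  assumes "l0 \<noteq> 0"
  obtains aff :: "'k ^ 3 \<Rightarrow> 'k ^ 2" where
    "\<And>u v. aff (u + v) = aff u + aff v" "\<And>c v. aff (c *s v) = c *s aff v"
    "\<And>v. aff v = 0 \<Longrightarrow> lin l0 v = 0 \<Longrightarrow> v = 0"
    "\<And>a s. \<exists>v. aff v = a \<and> lin l0 v = s"
    "\<And>D e. \<exists>l. \<forall>v. lin l v = wedge (aff v) D + e * lin l0 v"
    "\<And>l. \<exists>D e. \<forall>v. lin l v = wedge (aff v) D + e * lin l0 v"
proof -
  note chart = that
  have main: thesis if k: "l0 $ k \<noteq> 0" and d: "(i, j, k) \<in> {(2, 3, 1), (1, 3, 2), (1, 2, 3)}" for i j k :: 3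
  proof (rule chart [of "\<lambda>v. vector [v $ i, v $ j]"])
    fix u v :: "'k ^ 3" and c s e :: 'k and D a :: "'k ^ 2" and l :: "'k ^ 3"
    show "(vector [(u + v) $ i, (u + v) $ j] :: 'k ^ 2) = vector [u $ i, u $ j] + vector [v $ i, v $ j]"
      "(vector [(c *s v) $ i, (c *s v) $ j] :: 'k ^ 2) = c *s vector [v $ i, v $ j]"
      by (simp_all add: vec2_eq_iff)
    show "v = 0" if "(vector [v $ i, v $ j] :: 'k ^ 2) = 0" "lin l0 v = 0"
      using that k d by (auto simp: vec2_eq_iff vec3_eq_iff lin_3)
    let ?p = "(s - l0 $ i * a $ 1 - l0 $ j * a $ 2) / l0 $ k"
    show "\<exists>v. (vector [v $ i, v $ j] :: 'k ^ 2) = a \<and> lin l0 v = s"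
      by (rule exI [of _ "\<chi> r. if r = i then a $ 1 else if r = j then a $ 2 else ?p"])
        (use k d in \<open>auto simp: vec2_eq_iff lin_3\<close>)
    show "\<exists>l. \<forall>v. lin l v = wedge (vector [v $ i, v $ j]) D + e * lin l0 v"
      by (rule exI [of _ "\<chi> r. e * l0 $ r + (if r = i then D $ 2 else if r = j then - D $ 1 else 0)"])
        (use d in \<open>auto simp: wedge_def lin_3 algebra_simps\<close>)
    let ?e = "l $ k / l0 $ k"
    have e: "l $ k = ?e * l0 $ k" using k by simp
    show "\<exists>D e. \<forall>v. lin l v = wedge (vector [v $ i, v $ j]) D + e * lin l0 v"
      by (rule exI [of _ "vector [?e * l0 $ j - l $ j, l $ i - ?e * l0 $ i]"], rule exI [of _ ?e])
        (use d e k in \<open>auto simp: wedge_def lin_3 algebra_simps\<close>)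
  qed
  consider "l0 $ 1 \<noteq> 0" | "l0 $ 2 \<noteq> 0" | "l0 $ 3 \<noteq> 0" using assms by (auto simp: vec3_eq_iff)
  then show thesis using main [where i = 2 and j = 3 and k = 1] main [where i = 1 and j = 3 and k = 2] main [where i = 1 and j = 2 and k = 3] by cases simp_all
qed

section \<open>From the projective plane to the affine chart\<close>

lemma lin_eq_0:
  assumes "\<And>v. lin l v = 0" shows "l = 0"
proof -
  have "lin l (axis i 1) = l $ i" for i
    using exhaust_3 [of i] by (auto simp: lin_3 axis_def)
  then show ?thesis using assms by (simp add: vec_eq_iff)
qed

lemma wedge_level:
  assumes "wedge u D + e = 0" "wedge v D + e = 0" shows "wedge D (u - v) = 0"
  using assms unfolding wedge_def vector_minus_component by algebra

lemma curve_mult: "curve F \<union> curve G \<subseteq> curve (F * G)"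
  by (auto simp: curve_def eval3_mult)

lemma form3_add:
  assumes "form3 n F" "form3 n G" "F + G \<noteq> 0" shows "form3 n (F + G)"
  using assms keys_add [of F G] by (auto simp: form3_iff)

lemma form3_single_0: "c \<noteq> 0 \<Longrightarrow> form3 0 (Poly_Mapping.single 0 c)"
  by (simp add: form3_iff mdeg_def) (metis lookup_single_eq lookup_zero)

text \<open>Restricted to the line, the equation of the conic becomes a quadratic polynomial with
  three roots, so its coefficients vanish. As \<open>\<kappa> \<noteq> 0\<close>, this makes
  \<open>D\<close> parallel to both \<open>P\<close> and \<open>Q\<close>.\<close>

lemma conic_no_three_collinear:
  fixes P Q :: "'k::field ^ 2"
  assumes PQ: "wedge P Q \<noteq> 0" and \<kappa>: "\<kappa> \<noteq> 0" and D: "D \<noteq> 0"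
    and coll: "wedge (a2 - a1) D = 0" "wedge (a3 - a1) D = 0" and ne: "a1 \<noteq> a2" "a1 \<noteq> a3" "a2 \<noteq> a3"
    and on: "wedge (a1 - c) Q * wedge P (a1 - c) = \<kappa>" "wedge (a2 - c) Q * wedge P (a2 - c) = \<kappa>"
      "wedge (a3 - c) Q * wedge P (a3 - c) = \<kappa>"
  shows False
proof -
  obtain s where s: "a2 - a1 = s *s D" using wedge_parallelE [OF _ D] coll(1) wedge_swap_eq_0 by metis
  obtain t where t: "a3 - a1 = t *s D" using wedge_parallelE [OF _ D] coll(2) wedge_swap_eq_0 by metis
  have "a2 - a1 \<noteq> a3 - a1" using ne by simp
  then have st: "0 \<noteq> s" "0 \<noteq> t" "s \<noteq> t" using s t ne by auto
  define w where "w = a1 - c"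
  have a: "a2 - c = w + s *s D" "a3 - c = w + t *s D" using s t by (simp_all add: w_def algebra_simps)
  let ?b = "wedge D Q * wedge P w + wedge w Q * wedge P D" and ?q = "wedge D Q * wedge P D"
  have q0: "wedge w Q * wedge P w = \<kappa>" using on(1) by (simp add: w_def)
  have E: "0 + ?b * x + ?q * x\<^sup>2 = wedge (w + x *s D) Q * wedge P (w + x *s D) - \<kappa>" for x
    unfolding q0 [symmetric] by (simp add: wedge_distribs power2_eq_square algebra_simps)
  have "?b = 0" "?q = 0"
    using quadratic_three_roots [OF st, of 0 ?b ?q] on(2,3) unfolding E a by (simp_all add: q0)
  then have "wedge D Q = 0 \<and> wedge D P = 0"
    using q0 \<kappa> wedge_swap_eq_0 [of D P] by auto
  then show False using wedge_zero_unique [of D P Q] PQ D by blast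
qed

text \<open>\<open>aff\<close> gives affine coordinates on the complement of the line \<open>l0 = 0\<close>, and \<open>r\<close> chooses
  representatives of points on which \<open>l0\<close> takes the value 0 or 1.\<close>

locale plane_multinet = group G for G (structure) +
  fixes \<alpha>1 \<alpha>2 \<alpha>3 :: "'a \<Rightarrow> ('k::alg_closed_field ^ 3) set" and l0 :: "'k ^ 3" and aff :: "'k ^ 3 \<Rightarrow> 'k ^ 2"
    and r :: "('k ^ 3) set \<Rightarrow> 'k ^ 3"
  assumes fin: "finite (carrier G)"
    and char: "\<And>j. 0 < j \<Longrightarrow> j \<le> card (carrier G) \<Longrightarrow> of_nat j \<noteq> (0::'k)"
    and points: "\<And>x. x \<in> carrier G \<Longrightarrow> \<alpha>1 x \<in> PG2" "\<And>x. x \<in> carrier G \<Longrightarrow> \<alpha>2 x \<in> PG2" "\<And>x. x \<in> carrier G \<Longrightarrow> \<alpha>3 x \<in> PG2"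
    and injective: "inj_on \<alpha>1 (carrier G)" "inj_on \<alpha>2 (carrier G)" "inj_on \<alpha>3 (carrier G)"
    and disjoint: "\<alpha>1 ` carrier G \<inter> \<alpha>2 ` carrier G = {}" "\<alpha>1 ` carrier G \<inter> \<alpha>3 ` carrier G = {}" "\<alpha>2 ` carrier G \<inter> \<alpha>3 ` carrier G = {}"
    and collinear: "\<And>x y. x \<in> carrier G \<Longrightarrow> y \<in> carrier G \<Longrightarrow> collinear_points {\<alpha>1 x, \<alpha>2 y, \<alpha>3 (x \<otimes> y)}"
    and base: "\<alpha>1 \<one> \<in> kernel_line l0" "\<alpha>2 \<one> \<in> kernel_line l0"
    and long: "card (kernel_line l0 \<inter> \<alpha>1 ` carrier G) \<ge> 9"
    and l0: "l0 \<noteq> 0"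
    and aff_add: "\<And>u v. aff (u + v) = aff u + aff v" and aff_scale: "\<And>c v. aff (c *s v) = c *s aff v"
    and aff_inj: "\<And>v. aff v = 0 \<Longrightarrow> lin l0 v = 0 \<Longrightarrow> v = 0"
    and aff_surj: "\<And>a s. \<exists>v. aff v = a \<and> lin l0 v = s"
    and aff_lin: "\<And>D e. \<exists>l. \<forall>v. lin l v = wedge (aff v) D + e * lin l0 v"
    and lin_aff: "\<And>l. \<exists>D e. \<forall>v. lin l v = wedge (aff v) D + e * lin l0 v"
    and r: "\<And>P. P \<in> PG2 \<Longrightarrow> r P \<noteq> 0 \<and> P = vec.span {r P} \<and> (lin l0 (r P) = 0 \<or> lin l0 (r P) = 1)"
begin

abbreviation "m \<equiv> kernel_line l0"
abbreviation "\<Lambda>1 \<equiv> \<alpha>1 ` carrier G"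
abbreviation "\<Lambda>2 \<equiv> \<alpha>2 ` carrier G"
abbreviation "\<Lambda>3 \<equiv> \<alpha>3 ` carrier G"
abbreviation "S \<equiv> \<Lambda>1 \<union> \<Lambda>2 \<union> \<Lambda>3"

definition H where "H = {x \<in> carrier G. \<alpha>1 x \<in> m}"

abbreviation "a1 x \<equiv> aff (r (\<alpha>1 x))"
abbreviation "a2 x \<equiv> aff (r (\<alpha>2 x))"
abbreviation "a3 x \<equiv> aff (r (\<alpha>3 x))"

lemma m_line: "m \<in> PG2_lines"
  by (rule kernel_line_in_lines [OF l0])

lemma on_line: "P \<in> PG2 \<Longrightarrow> P \<in> kernel_line l \<longleftrightarrow> lin l (r P) = 0"
  using r span_in_kernel_line by metis

lemma join_m:
  assumes "x \<in> carrier G" "y \<in> carrier G"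
  shows "\<alpha>1 x \<in> m \<Longrightarrow> \<alpha>2 y \<in> m \<Longrightarrow> \<alpha>3 (x \<otimes> y) \<in> m" "\<alpha>1 x \<in> m \<Longrightarrow> \<alpha>3 (x \<otimes> y) \<in> m \<Longrightarrow> \<alpha>2 y \<in> m"
    "\<alpha>2 y \<in> m \<Longrightarrow> \<alpha>3 (x \<otimes> y) \<in> m \<Longrightarrow> \<alpha>1 x \<in> m"
proof -
  obtain m' where m': "m' \<in> PG2_lines" "\<alpha>1 x \<in> m'" "\<alpha>2 y \<in> m'" "\<alpha>3 (x \<otimes> y) \<in> m'"
    using collinear [OF assms] by (auto simp: collinear_points_def)
  have "\<alpha>1 x \<noteq> \<alpha>2 y" using disjoint(1) assms by blast
  moreover have "\<alpha>1 x \<noteq> \<alpha>3 (x \<otimes> y)" using disjoint(2) assms(1) m_closed [OF assms] by blast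
  moreover have "\<alpha>2 y \<noteq> \<alpha>3 (x \<otimes> y)" using disjoint(3) assms(2) m_closed [OF assms] by blast
  ultimately have ne: "\<alpha>1 x \<noteq> \<alpha>2 y" "\<alpha>1 x \<noteq> \<alpha>3 (x \<otimes> y)" "\<alpha>2 y \<noteq> \<alpha>3 (x \<otimes> y)" .
  note L = two_points_one_line [OF m_line m'(1)]
  show "\<alpha>1 x \<in> m \<Longrightarrow> \<alpha>2 y \<in> m \<Longrightarrow> \<alpha>3 (x \<otimes> y) \<in> m" using L [OF _ _ m'(2,3) ne(1)] m' by blast
  show "\<alpha>1 x \<in> m \<Longrightarrow> \<alpha>3 (x \<otimes> y) \<in> m \<Longrightarrow> \<alpha>2 y \<in> m" using L [OF _ _ m'(2,4) ne(2)] m' by blast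
  show "\<alpha>2 y \<in> m \<Longrightarrow> \<alpha>3 (x \<otimes> y) \<in> m \<Longrightarrow> \<alpha>1 x \<in> m" using L [OF _ _ m'(3,4) ne(3)] m' by blast
qed

text \<open>Both base points lie on \<open>m\<close>, so products with \<open>\<one>\<close>
  transfer membership from the first component to the third and from there to the second. One index
  set thus serves all three components.\<close>

lemma in_m_iff:
  assumes "x \<in> carrier G"
  shows "\<alpha>1 x \<in> m \<longleftrightarrow> x \<in> H" "\<alpha>2 x \<in> m \<longleftrightarrow> x \<in> H" "\<alpha>3 x \<in> m \<longleftrightarrow> x \<in> H"
proof -
  show 1: "\<alpha>1 x \<in> m \<longleftrightarrow> x \<in> H" using assms by (simp add: H_def)
  show 3: "\<alpha>3 x \<in> m \<longleftrightarrow> x \<in> H" using join_m [OF assms one_closed] base assms 1 by auto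
  show "\<alpha>2 x \<in> m \<longleftrightarrow> x \<in> H" using join_m [OF one_closed assms] base assms 3 by auto
qed

lemma H_subgroup: "subgroup H G"
proof (rule subgroupI)
  show sub: "H \<subseteq> carrier G" by (auto simp: H_def)
  show "H \<noteq> {}" using base by (auto simp: H_def)
  fix x assume x: "x \<in> H"
  then have xc: "x \<in> carrier G" using sub by blast
  have one: "\<one> \<in> H" using base by (simp add: H_def)
  show "inv x \<in> H"
    using join_m(2) [OF xc inv_closed [OF xc]] in_m_iff [OF xc] in_m_iff [OF one_closed] in_m_iff [OF inv_closed [OF xc]] x one xc by simp
  fix y assume y: "y \<in> H"
  then have yc: "y \<in> carrier G" using sub by blast
  show "x \<otimes> y \<in> H"
    using join_m(1) [OF xc yc] in_m_iff [OF xc] in_m_iff [OF yc] in_m_iff [OF m_closed [OF xc yc]] x y by simp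
qed

lemma card_H: "card H \<ge> 9"
proof -
  have "m \<inter> \<Lambda>1 = \<alpha>1 ` H" by (auto simp: H_def)
  moreover have "inj_on \<alpha>1 H" using injective(1) by (rule inj_on_subset) (auto simp: H_def)
  ultimately show ?thesis using long by (simp add: card_image)
qed

lemma level:
  assumes "x \<in> carrier G"
  shows "lin l0 (r (\<alpha>1 x)) = (if x \<in> H then 0 else 1)" "lin l0 (r (\<alpha>2 x)) = (if x \<in> H then 0 else 1)"
    "lin l0 (r (\<alpha>3 x)) = (if x \<in> H then 0 else 1)"
  using in_m_iff [OF assms] on_line [of _ l0] points [OF assms] r by metis+

lemma aff_diff: "aff (u - v) = aff u - aff v"
  using aff_add [of "u - v" v] by (simp add: algebra_simps)

lemma collinear_functional:
  assumes "x \<in> carrier G" "y \<in> carrier G"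
  obtains D e where "D \<noteq> 0 \<or> e \<noteq> 0" "wedge (a1 x) D + e * lin l0 (r (\<alpha>1 x)) = 0"
    "wedge (a2 y) D + e * lin l0 (r (\<alpha>2 y)) = 0" "wedge (a3 (x \<otimes> y)) D + e * lin l0 (r (\<alpha>3 (x \<otimes> y))) = 0"
proof -
  obtain m' where m': "m' \<in> PG2_lines" "\<alpha>1 x \<in> m'" "\<alpha>2 y \<in> m'" "\<alpha>3 (x \<otimes> y) \<in> m'"
    using collinear [OF assms] by (auto simp: collinear_points_def)
  obtain l where l: "l \<noteq> 0" "m' = kernel_line l" by (rule line_obtain_kernel [OF m'(1)])
  obtain D e where De: "\<And>v. lin l v = wedge (aff v) D + e * lin l0 v" using lin_aff [of l] by blast
  have "D \<noteq> 0 \<or> e \<noteq> 0" using lin_eq_0 [of l] l(1) De by auto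
  then show thesis
    using m'(2-4) on_line points assms unfolding l(2) by (intro that [of D e]) (simp_all flip: De)
qed

lemma direction_injective:
  assumes "P \<in> PG2" "Q \<in> PG2" "lin l0 (r P) = 0" "lin l0 (r Q) = 0" "wedge (aff (r P)) (aff (r Q)) = 0"
  shows "P = Q"
proof -
  have "aff (r P) \<noteq> 0" using aff_inj r assms by blast
  then obtain c where c: "aff (r Q) = c *s aff (r P)" by (rule wedge_parallelE [OF assms(5)])
  have "r Q - c *s r P = 0"
    by (rule aff_inj) (simp_all add: aff_diff aff_scale c assms)
  then have "r Q = c *s r P" by simp
  then show ?thesis using r [OF assms(1)] r [OF assms(2)] span_eq_iff_scale [of "r P" "r Q"] by metis
qed

lemma affine_injective:
  assumes "P \<in> PG2" "Q \<in> PG2" "lin l0 (r P) = lin l0 (r Q)" "aff (r P) = aff (r Q)"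
  shows "P = Q"
proof -
  have "r P - r Q = 0" by (rule aff_inj) (simp_all add: aff_diff assms)
  then show ?thesis using r assms by (metis eq_iff_diff_eq_0)
qed

text \<open>On a representative with \<open>l0\<close> equal to 1, \<open>aff\<close> gives the
  affine position; on one with \<open>l0\<close> equal to 0 it gives a direction. This is why the
  same three functions appear both as points and as directions.\<close>

lemma affine: "affine_multinet G H a1 a2 a3 a1 a2 a3"
proof (intro affine_multinet.intro affine_multinet_axioms.intro group_axioms; (rule fin H_subgroup card_H char)?)
  have Hc: "x \<in> H \<Longrightarrow> x \<in> carrier G" for x by (simp add: H_def)
  have I: "inj_on (\<lambda>x. aff (r (\<beta> x))) (carrier G - H)"
    if \<beta>: "inj_on \<beta> (carrier G)" "\<And>x. x \<in> carrier G \<Longrightarrow> \<beta> x \<in> PG2"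
      "\<And>x. x \<in> carrier G \<Longrightarrow> lin l0 (r (\<beta> x)) = (if x \<in> H then 0 else 1)" for \<beta>
  proof (rule inj_onI)
    fix x y assume xy: "x \<in> carrier G - H" "y \<in> carrier G - H" "aff (r (\<beta> x)) = aff (r (\<beta> y))"
    then have c: "x \<in> carrier G" "y \<in> carrier G" by auto
    have "\<beta> x = \<beta> y"
      by (rule affine_injective [OF \<beta>(2) [OF c(1)] \<beta>(2) [OF c(2)] _ xy(3)]) (use xy c \<beta>(3) in simp)
    then show "x = y" using \<beta>(1) c by (simp add: inj_on_eq_iff)
  qed
  show "inj_on a1 (carrier G - H)" "inj_on a2 (carrier G - H)" "inj_on a3 (carrier G - H)"
    using I [OF injective(1) points(1) level(1)] I [OF injective(2) points(2) level(2)]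
      I [OF injective(3) points(3) level(3)] by simp_all
  have J: "wedge (aff (r (\<beta> x))) (aff (r (\<beta> y))) \<noteq> 0"
    if \<beta>: "inj_on \<beta> (carrier G)" "\<And>x. x \<in> carrier G \<Longrightarrow> \<beta> x \<in> PG2"
      "\<And>x. x \<in> carrier G \<Longrightarrow> lin l0 (r (\<beta> x)) = (if x \<in> H then 0 else 1)" and xy: "x \<in> H" "y \<in> H" "x \<noteq> y" for \<beta> x y
  proof
    assume 0: "wedge (aff (r (\<beta> x))) (aff (r (\<beta> y))) = 0"
    have "\<beta> x = \<beta> y"
      by (rule direction_injective [OF \<beta>(2) \<beta>(2) _ _ 0]) (use xy Hc \<beta>(3) in simp_all)
    then show False using \<beta>(1) xy Hc by (simp add: inj_on_eq_iff)
  qed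
  fix x y
  show "wedge (a1 x) (a1 y) \<noteq> 0" "wedge (a2 x) (a2 y) \<noteq> 0" "wedge (a3 x) (a3 y) \<noteq> 0" if "x \<in> H" "y \<in> H" "x \<noteq> y"
    using J [OF injective(1) points(1) level(1) that] J [OF injective(2) points(2) level(2) that]
      J [OF injective(3) points(3) level(3) that] by simp_all
  show "wedge (a3 (x \<otimes> y) - a2 y) (a1 x) = 0" if xy: "x \<in> H" "y \<in> carrier G - H"
  proof -
    have c: "x \<in> carrier G" "y \<in> carrier G" "x \<otimes> y \<in> carrier G" "x \<otimes> y \<notin> H" "y \<notin> H"
      using xy Hc H_subgroup subgroup.m_closed [OF H_subgroup] subgroup.m_inv_closed [OF H_subgroup] 
      by (auto, metis Hc cancel_assoc(2))
    obtain D e where De: "D \<noteq> 0 \<or> e \<noteq> 0" "wedge (a1 x) D = 0" "wedge (a2 y) D + e = 0" "wedge (a3 (x \<otimes> y)) D + e = 0"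
      using collinear_functional [OF c(1,2)] level [OF c(1)] level [OF c(2)] level [OF c(3)] xy(1) c(4,5) by simp metis
    have "D \<noteq> 0" using De(1,2,3) by auto
    moreover have "wedge D (a3 (x \<otimes> y) - a2 y) = 0" by (rule wedge_level [OF De(4) De(3)])
    moreover have "wedge D (a1 x) = 0" using De(2) wedge_swap_eq_0 by blast
    ultimately show ?thesis using wedge_common by blast
  qed
  show "wedge (a3 (x \<otimes> y) - a1 x) (a2 y) = 0" if xy: "x \<in> carrier G - H" "y \<in> H"
  proof -
    have c: "x \<in> carrier G" "y \<in> carrier G" "x \<otimes> y \<in> carrier G" "x \<otimes> y \<notin> H" "x \<notin> H"
      using xy Hc join_m(3) [of x y] in_m_iff by auto
    obtain D e where De: "D \<noteq> 0 \<or> e \<noteq> 0" "wedge (a1 x) D + e = 0" "wedge (a2 y) D = 0" "wedge (a3 (x \<otimes> y)) D + e = 0"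
      using collinear_functional [OF c(1,2)] level [OF c(1)] level [OF c(2)] level [OF c(3)] xy(2) c(4,5) by simp metis
    have "D \<noteq> 0" using De(1,2,3) by auto
    moreover have "wedge D (a3 (x \<otimes> y) - a1 x) = 0" by (rule wedge_level [OF De(4) De(2)])
    moreover have "wedge D (a2 y) = 0" using De(3) wedge_swap_eq_0 by blast
    ultimately show ?thesis using wedge_common by blast
  qed
  show "wedge (a1 x - a2 y) (a3 (x \<otimes> y)) = 0" if xy: "x \<in> carrier G - H" "y \<in> carrier G - H" "x \<otimes> y \<in> H"
  proof -
    have c: "x \<in> carrier G" "y \<in> carrier G" "x \<otimes> y \<in> carrier G" "x \<notin> H" "y \<notin> H" using xy by auto
    obtain D e where De: "D \<noteq> 0 \<or> e \<noteq> 0" "wedge (a1 x) D + e = 0" "wedge (a2 y) D + e = 0" "wedge (a3 (x \<otimes> y)) D = 0"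
      using collinear_functional [OF c(1,2)] level [OF c(1)] level [OF c(2)] level [OF c(3)] xy(3) c(4,5) by simp metis
    have "D \<noteq> 0" using De(1,2,3) by auto
    moreover have "wedge D (a1 x - a2 y) = 0" by (rule wedge_level [OF De(2) De(3)])
    moreover have "wedge D (a3 (x \<otimes> y)) = 0" using De(4) wedge_swap_eq_0 by blast
    ultimately show ?thesis using wedge_common by blast
  qed
  show "wedge (a1 x - a3 (x \<otimes> y)) (a2 y - a3 (x \<otimes> y)) = 0"
    if xy: "x \<in> carrier G - H" "y \<in> carrier G - H" "x \<otimes> y \<in> carrier G - H"
  proof -
    have c: "x \<in> carrier G" "y \<in> carrier G" "x \<otimes> y \<in> carrier G" "x \<notin> H" "y \<notin> H" "x \<otimes> y \<notin> H" using xy by auto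
    obtain D e where De: "D \<noteq> 0 \<or> e \<noteq> 0" "wedge (a1 x) D + e = 0" "wedge (a2 y) D + e = 0" "wedge (a3 (x \<otimes> y)) D + e = 0"
      using collinear_functional [OF c(1,2)] level [OF c(1)] level [OF c(2)] level [OF c(3)] c(4-6) by simp metis
    have "D \<noteq> 0" using De(1,2,3) by auto
    moreover have "wedge D (a1 x - a3 (x \<otimes> y)) = 0" by (rule wedge_level [OF De(2) De(4)])
    moreover have "wedge D (a2 y - a3 (x \<otimes> y)) = 0" by (rule wedge_level [OF De(3) De(4)])
    ultimately show ?thesis using wedge_common by blast
  qed
qed

end

section \<open>The three shapes as projective configurations, and lines of length 3\<close>

context plane_multinet
begin

text \<open>The functional is the homogeneous equation of the affine line through \<open>c\<close>
  with direction \<open>D\<close>.\<close>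

lemma line_through:
  obtains l where "\<And>v. lin l v = wedge (aff v - lin l0 v *s c) D" "D \<noteq> 0 \<Longrightarrow> l \<noteq> 0"
proof -
  obtain l where l: "\<And>v. lin l v = wedge (aff v) D + (- wedge c D) * lin l0 v"
    using aff_lin [of D "- wedge c D"] by blast
  then have l': "lin l v = wedge (aff v - lin l0 v *s c) D" for v by (simp add: wedge_distribs)
  have "l \<noteq> 0" if D: "D \<noteq> 0"
  proof
    assume l0: "l = 0"
    have "wedge a D = 0" for a
    proof -
      obtain v where "aff v = a" "lin l0 v = 0" using aff_surj by blast
      then show ?thesis using l' [of v] by (simp add: l0 lin_3)
    qed
    from this [of "vector [1, 0]"] this [of "vector [0, 1]"] D show False
      by (auto simp: wedge_def vec2_eq_iff)
  qed
  with l' show thesis by (rule that)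
qed

lemma aff_0 [simp]: "aff 0 = 0"
  using aff_scale [of 0 0] by simp

lemma points_S: "P \<in> S \<Longrightarrow> P \<in> PG2"
  using points by auto

lemma all_on_m:
  assumes "H = carrier G" shows "S \<subseteq> m"
  using in_m_iff assms by auto

lemma fin_\<Lambda>: "finite \<Lambda>1" "finite \<Lambda>2" "finite \<Lambda>3"
  using fin by auto

lemma card_coset:
  assumes "s \<in> carrier G" "\<And>k. k \<in> H \<Longrightarrow> \<alpha>1 (s \<otimes> k) \<in> L"
  shows "card (L \<inter> \<Lambda>1) \<ge> 9"
proof -
  have Hc: "k \<in> H \<Longrightarrow> k \<in> carrier G" for k by (simp add: H_def)
  have inj: "inj_on (\<lambda>k. \<alpha>1 (s \<otimes> k)) H"
  proof (rule inj_onI)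
    fix k k' assume k: "k \<in> H" "k' \<in> H" "\<alpha>1 (s \<otimes> k) = \<alpha>1 (s \<otimes> k')"
    then have "s \<otimes> k = s \<otimes> k'" using injective(1) assms(1) Hc by (simp add: inj_on_eq_iff)
    then show "k = k'" using assms(1) k Hc by simp
  qed
  have "card H = card ((\<lambda>k. \<alpha>1 (s \<otimes> k)) ` H)" by (simp add: card_image [OF inj])
  also have "\<dots> \<le> card (L \<inter> \<Lambda>1)"
    by (rule card_mono) (use fin assms Hc in auto)
  finally show ?thesis using card_H by simp
qed

lemma not_collinear:
  assumes "H \<noteq> carrier G" shows "\<not> collinear_points S"
proof
  assume "collinear_points S"
  then obtain m' where m': "m' \<in> PG2_lines" "S \<subseteq> m'" by (auto simp: collinear_points_def)
  have ne: "\<alpha>1 \<one> \<noteq> \<alpha>2 \<one>" using disjoint(1) by blast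
  have "\<alpha>1 \<one> \<in> m'" "\<alpha>2 \<one> \<in> m'" using m'(2) one_closed by blast+
  then have "m' = m" using two_points_one_line [OF m'(1) m_line] base ne by blast
  then have "\<alpha>1 x \<in> m" if "x \<in> carrier G" for x using m'(2) that by blast
  then show False using assms by (auto simp: H_def)
qed

lemma card_line_of_length_3:
  assumes "line_of_length \<Lambda>1 \<Lambda>2 \<Lambda>3 l 3"
  shows "card (l \<inter> S) = 9" "l \<in> PG2_lines"
proof -
  have c: "card (l \<inter> \<Lambda>1) = 3" "card (l \<inter> \<Lambda>2) = 3" "card (l \<inter> \<Lambda>3) = 3" and "l \<in> PG2_lines"
    using assms by (auto simp: line_of_length_def line_of_multinet_def)
  then show "l \<in> PG2_lines" by blast
  have "l \<inter> S = (l \<inter> \<Lambda>1) \<union> (l \<inter> \<Lambda>2) \<union> (l \<inter> \<Lambda>3)" by blast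
  moreover have "card ((l \<inter> \<Lambda>1) \<union> (l \<inter> \<Lambda>2) \<union> (l \<inter> \<Lambda>3)) = card (l \<inter> \<Lambda>1) + card (l \<inter> \<Lambda>2) + card (l \<inter> \<Lambda>3)"
  proof -
    have "(l \<inter> \<Lambda>1) \<inter> (l \<inter> \<Lambda>2) = {}" using disjoint(1) by blast
    moreover have "((l \<inter> \<Lambda>1) \<union> (l \<inter> \<Lambda>2)) \<inter> (l \<inter> \<Lambda>3) = {}" using disjoint(2,3) by blast
    ultimately show ?thesis
      using fin_\<Lambda> by (metis (no_types, lifting) card_Un_disjoint finite_Int finite_Un)
  qed
  ultimately show "card (l \<inter> S) = 9" using c by simp
qed

lemma card_two_lines:
  assumes "l \<in> PG2_lines" "L \<in> PG2_lines" "l \<noteq> L"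
  shows "finite (l \<inter> L) \<and> card (l \<inter> L) \<le> 1"
proof (cases "l \<inter> L = {}")
  case False
  then obtain P where P: "P \<in> l \<inter> L" by blast
  then have "l \<inter> L = {P}" using two_points_one_line [OF assms(1,2)] assms(3) by blast
  then show ?thesis by simp
qed simp

text \<open>A line of length 3 carries nine points. It differs from each member of
  \<open>LL\<close>, since these contain at least nine points of one component, and so it meets each
  of them at most once: at most eight points in all.\<close>

lemma no_short_line:
  assumes LL: "finite LL" "card LL \<le> 8" "S \<subseteq> \<Union>LL"
    and L: "\<And>L. L \<in> LL \<Longrightarrow> L \<in> PG2_lines \<and> (card (L \<inter> \<Lambda>1) \<ge> 9 \<or> card (L \<inter> \<Lambda>2) \<ge> 9 \<or> card (L \<inter> \<Lambda>3) \<ge> 9)"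
  shows "\<not> line_of_length \<Lambda>1 \<Lambda>2 \<Lambda>3 l 3"
proof
  assume l: "line_of_length \<Lambda>1 \<Lambda>2 \<Lambda>3 l 3"
  have ne: "l \<noteq> L" if "L \<in> LL" for L using L [OF that] l by (auto simp: line_of_length_def)
  have c: "finite (l \<inter> L) \<and> card (l \<inter> L) \<le> 1" if "L \<in> LL" for L
    using card_two_lines card_line_of_length_3(2) [OF l] L [OF that] ne [OF that] by blast
  have "l \<inter> S \<subseteq> (\<Union>L\<in>LL. l \<inter> L)" using LL(3) by blast
  moreover have "finite (\<Union>L\<in>LL. l \<inter> L)" using LL(1) c by (intro finite_UN_I) blast+
  ultimately have "card (l \<inter> S) \<le> card (\<Union>L\<in>LL. l \<inter> L)" by (intro card_mono)
  also have "\<dots> \<le> (\<Sum>L\<in>LL. card (l \<inter> L))" by (rule card_UN_le [OF LL(1)])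
  also have "\<dots> \<le> (\<Sum>L\<in>LL. 1)" by (rule sum_mono) (use c in blast)
  finally show False using LL(2) card_line_of_length_3(1) [OF l] by simp
qed

lemma no_short_line_collinear:
  assumes "H = carrier G" shows "\<not> line_of_length \<Lambda>1 \<Lambda>2 \<Lambda>3 l 3"
  by (rule no_short_line [of "{m}"]) (use all_on_m [OF assms] m_line long in auto)

lemma S_cases:
  assumes "P \<in> S" "P \<notin> m"
  obtains x \<alpha> where "x \<in> carrier G - H" "(\<alpha>, \<lambda>x. aff (r (\<alpha> x))) \<in> {(\<alpha>1, a1), (\<alpha>2, a2), (\<alpha>3, a3)}" "P = \<alpha> x" "lin l0 (r P) = 1"
proof -
  have P: "P \<in> PG2" using assms points by auto
  then have lP: "lin l0 (r P) = 1" using assms(2) on_line r by blast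
  from assms(1) consider x where "x \<in> carrier G" "P = \<alpha>1 x" | x where "x \<in> carrier G" "P = \<alpha>2 x"
    | x where "x \<in> carrier G" "P = \<alpha>3 x" by blast
  then show thesis
  proof cases
    case 1 then show thesis using in_m_iff(1) [OF 1(1)] assms(2) lP by (intro that [of x \<alpha>1]) auto
  next
    case 2 then show thesis using in_m_iff(2) [OF 2(1)] assms(2) lP by (intro that [of x \<alpha>2]) auto
  next
    case 3 then show thesis using in_m_iff(3) [OF 3(1)] assms(2) lP by (intro that [of x \<alpha>3]) auto
  qed
qed

lemma triangle_case:
  assumes T: "affine_multinet.triangle_shape G H a1 a2 a3 c D D'"
  shows "triangular S" "\<not> line_of_length \<Lambda>1 \<Lambda>2 \<Lambda>3 l 3"
proof -
  interpret A: affine_multinet G H a1 a2 a3 a1 a2 a3 by (rule affine)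
  note T' = T [unfolded A.triangle_shape_def]
  have DD: "wedge D D' \<noteq> 0" using T' by (rule conjunct1)
  have cov: "wedge (a x - c) D = 0 \<or> wedge (a x - c) D' = 0" if "x \<in> carrier G - H" "a \<in> {a1, a2, a3}" for x a
    using bspec [OF T' [THEN conjunct2, THEN conjunct1] that(1)] that(2) by (rule bspec)
  obtain s where s: "s \<in> carrier G - H" "\<And>k. k \<in> H \<Longrightarrow> wedge (a1 (s \<otimes> k) - c) D = 0"
    using T unfolding A.triangle_shape_def by blast
  obtain t where t: "t \<in> carrier G - H" "\<And>k. k \<in> H \<Longrightarrow> wedge (a1 (t \<otimes> k) - c) D' = 0"
    using T unfolding A.triangle_shape_def by blast
  have D0: "D \<noteq> 0" "D' \<noteq> 0" using DD by auto
  obtain l1 where l1: "\<And>v. lin l1 v = wedge (aff v - lin l0 v *s c) D" "l1 \<noteq> 0" using line_through D0 by metis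
  obtain l2 where l2: "\<And>v. lin l2 v = wedge (aff v - lin l0 v *s c) D'" "l2 \<noteq> 0" using line_through D0 by metis
  have S: "S \<subseteq> m \<union> kernel_line l1 \<union> kernel_line l2"
  proof
    fix P assume P: "P \<in> S"
    show "P \<in> m \<union> kernel_line l1 \<union> kernel_line l2"
    proof (cases "P \<in> m")
      case False
      then obtain x \<alpha> where x: "x \<in> carrier G - H" "(\<alpha>, \<lambda>x. aff (r (\<alpha> x))) \<in> {(\<alpha>1, a1), (\<alpha>2, a2), (\<alpha>3, a3)}" "P = \<alpha> x" "lin l0 (r P) = 1"
        by (rule S_cases [OF P])
      have "wedge (aff (r P) - c) D = 0 \<or> wedge (aff (r P) - c) D' = 0"
        using cov [OF x(1), of "\<lambda>x. aff (r (\<alpha> x))"] x(2,3) by auto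
      then show ?thesis using on_line [OF points_S [OF P]] l1(1) l2(1) x(4) by auto
    qed simp
  qed
  have on: "\<alpha>1 x \<in> kernel_line l1 \<longleftrightarrow> wedge (a1 x - c) D = 0" "\<alpha>1 x \<in> kernel_line l2 \<longleftrightarrow> wedge (a1 x - c) D' = 0"
    if "x \<in> carrier G - H" for x
    using that on_line points(1) l1(1) l2(1) level(1) by auto
  have "card (kernel_line l1 \<inter> \<Lambda>1) \<ge> 9"
    by (rule card_coset [of s]) (use s on A.X_right [OF s(1)] in auto)
  moreover have "card (kernel_line l2 \<inter> \<Lambda>1) \<ge> 9"
    by (rule card_coset [of t]) (use t on A.X_right [OF t(1)] in auto)
  ultimately show "\<not> line_of_length \<Lambda>1 \<Lambda>2 \<Lambda>3 l 3"
    using S long m_line kernel_line_in_lines l1(2) l2(2)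
    by (intro no_short_line [of "{m, kernel_line l1, kernel_line l2}"]) (auto simp: card_insert_if)
  show "triangular S"
    unfolding triangular_def
  proof (intro exI conjI)
    show "form3 1 (linear_form l0)" "form3 1 (linear_form l1)" "form3 1 (linear_form l2)"
      using form3_linear_form l0 l1(2) l2(2) by blast+
    then have "form3 (1 + 1 + 1) (linear_form l0 * linear_form l1 * linear_form l2)" by (intro form3_mult)
    then show "form3 3 (linear_form l0 * linear_form l1 * linear_form l2)" by (simp add: numeral_3_eq_3)
    show "S \<subseteq> curve (linear_form l0 * linear_form l1 * linear_form l2)"
      using S curve_mult [of "linear_form l0 * linear_form l1" "linear_form l2"] curve_mult [of "linear_form l0" "linear_form l1"]
      unfolding curve_linear_form by blast
    \<comment> \<open>A common point would be at infinity, with a direction parallel to both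
      \<open>D\<close> and \<open>D'\<close>.\<close>
    show "curve (linear_form l0) \<inter> curve (linear_form l1) \<inter> curve (linear_form l2) = {}"
    proof (rule ccontr)
      assume "\<not> ?thesis"
      then obtain P where P: "P \<in> m" "P \<in> kernel_line l1" "P \<in> kernel_line l2" unfolding curve_linear_form by blast
      then have PG: "P \<in> PG2" by (simp add: kernel_line_def)
      then have z: "lin l0 (r P) = 0" "wedge (aff (r P)) D = 0" "wedge (aff (r P)) D' = 0"
        using P on_line l1(1) l2(1) by auto
      then have "aff (r P) = 0" using wedge_zero_unique DD by blast
      then show False using aff_inj z(1) r [OF PG] by blast
    qed
  qed (rule refl)
qed

lemma tetrahedron_case:
  assumes T: "affine_multinet.tetrahedron_shape G H a1 a2 a3 c D1 D2 D3" and ne: "H \<noteq> carrier G"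
  shows "tetrahedron_type S" "\<not> line_of_length \<Lambda>1 \<Lambda>2 \<Lambda>3 l 3"
proof -
  interpret A: affine_multinet G H a1 a2 a3 a1 a2 a3 by (rule affine)
  have DD: "wedge D1 D2 \<noteq> 0" "wedge D1 D3 \<noteq> 0" "wedge D2 D3 \<noteq> 0"
    and z: "\<And>x. x \<in> carrier G - H \<Longrightarrow> wedge (a1 x - c) D1 = 0" "\<And>x. x \<in> carrier G - H \<Longrightarrow> wedge (a2 x - c) D2 = 0"
      "\<And>x. x \<in> carrier G - H \<Longrightarrow> wedge (a3 x - c) D3 = 0"
    using T unfolding A.tetrahedron_shape_def by blast+
  have D0: "D1 \<noteq> 0" "D2 \<noteq> 0" "D3 \<noteq> 0" using DD by auto
  obtain l1 where l1: "\<And>v. lin l1 v = wedge (aff v - lin l0 v *s c) D1" "l1 \<noteq> 0" using line_through D0 by metis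
  obtain l2 where l2: "\<And>v. lin l2 v = wedge (aff v - lin l0 v *s c) D2" "l2 \<noteq> 0" using line_through D0 by metis
  obtain l3 where l3: "\<And>v. lin l3 v = wedge (aff v - lin l0 v *s c) D3" "l3 \<noteq> 0" using line_through D0 by metis
  have on: "\<alpha>1 x \<in> kernel_line l1" "\<alpha>2 x \<in> kernel_line l2" "\<alpha>3 x \<in> kernel_line l3" if "x \<in> carrier G - H" for x
    using that on_line points l1(1) l2(1) l3(1) level z by auto
  have "\<alpha>1 x \<in> m \<union> kernel_line l1" "\<alpha>2 x \<in> m \<union> kernel_line l2" "\<alpha>3 x \<in> m \<union> kernel_line l3" if "x \<in> carrier G" for x
    using on [of x] in_m_iff [OF that] that by blast+
  then have S: "S \<subseteq> m \<union> kernel_line l1 \<union> kernel_line l2 \<union> kernel_line l3" by blast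
  obtain g where g: "g \<in> carrier G - H" using ne by (auto simp: H_def)
  \<comment> \<open>The coset of \<open>g\<close> lies outside \<open>H\<close>, so at least as many
    points of each component are affine as lie at infinity.\<close>
  have big: "card (L \<inter> \<beta> ` carrier G) \<ge> 9"
    if \<beta>: "inj_on \<beta> (carrier G)" "\<And>x. x \<in> carrier G - H \<Longrightarrow> \<beta> x \<in> L" for \<beta> :: "'a \<Rightarrow> ('k ^ 3) set" and L
  proof -
    have "inj_on (\<lambda>k. g \<otimes> k) H" using g A.H_carrier by (auto intro!: inj_onI)
    then have "card H \<le> card (carrier G - H)"
      using fin A.X_right [OF g] by (intro card_inj_on_le [of "\<lambda>k. g \<otimes> k"]) auto
    also have "\<dots> = card (\<beta> ` (carrier G - H))"
      using \<beta>(1) by (intro card_image [symmetric]) (rule inj_on_subset, auto)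
    also have "\<dots> \<le> card (L \<inter> \<beta> ` carrier G)"
      by (rule card_mono) (use fin \<beta>(2) in auto)
    finally show ?thesis using card_H by simp
  qed
  note b = big [OF injective(1) on(1)] big [OF injective(2) on(2)] big [OF injective(3) on(3)]
  have LL: "card {m, kernel_line l1, kernel_line l2, kernel_line l3} \<le> 8"
    using card_length [of "[m, kernel_line l1, kernel_line l2, kernel_line l3]"] by simp
  show "\<not> line_of_length \<Lambda>1 \<Lambda>2 \<Lambda>3 l 3"
  proof (rule no_short_line [OF _ LL])
    fix L assume "L \<in> {m, kernel_line l1, kernel_line l2, kernel_line l3}"
    then show "L \<in> PG2_lines \<and> (card (L \<inter> \<Lambda>1) \<ge> 9 \<or> card (L \<inter> \<Lambda>2) \<ge> 9 \<or> card (L \<inter> \<Lambda>3) \<ge> 9)"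
      using b long m_line kernel_line_in_lines l1(2) l2(2) l3(2) by blast
  qed (use S in auto)
  have distinct: "kernel_line l \<noteq> kernel_line l'"
    if l: "\<And>v. lin l v = wedge (aff v - lin l0 v *s c) D" and l': "\<And>v. lin l' v = wedge (aff v - lin l0 v *s c) D'"
      and DD: "wedge D D' \<noteq> 0" for l l' D D'
  proof -
    obtain w where w: "aff w = D" "lin l0 w = 0" using aff_surj by blast
    then have w0: "w \<noteq> 0" using DD by auto
    have "vec.span {w} \<in> kernel_line l" "vec.span {w} \<notin> kernel_line l'"
      using span_in_kernel_line [OF w0] l [of w] l' [of w] w DD by simp_all
    then show ?thesis by blast
  qed
  obtain v where v: "aff v = c" "lin l0 v = 1" using aff_surj by blast
  then have v0: "v \<noteq> 0" by auto
  show "tetrahedron_type S"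
    unfolding tetrahedron_type_def
  proof (intro bexI conjI exI)
    show "distinct [kernel_line l1, kernel_line l2, kernel_line l3]"
      using distinct [OF l1(1) l2(1) DD(1)] distinct [OF l1(1) l3(1) DD(2)] distinct [OF l2(1) l3(1) DD(3)] by simp
    show "vec.span {v} \<in> kernel_line l1 \<inter> kernel_line l2 \<inter> kernel_line l3"
      using span_in_kernel_line [OF v0] l1(1) l2(1) l3(1) v by simp
    show "vec.span {v} \<notin> m" using span_in_kernel_line [OF v0] v by simp
    show "S \<subseteq> m \<union> kernel_line l1 \<union> kernel_line l2 \<union> kernel_line l3" by (rule S)
  qed (use kernel_line_in_lines m_line l1 l2 l3 in auto)
qed

lemma conic_case:
  assumes T: "affine_multinet.conic_shape G H a1 a2 a3 c P Q \<kappa>"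
  shows "conic_line_type S" "\<not> line_of_length \<Lambda>1 \<Lambda>2 \<Lambda>3 l 3"
proof -
  interpret A: affine_multinet G H a1 a2 a3 a1 a2 a3 by (rule affine)
  note T' = T [unfolded A.conic_shape_def]
  have PQ: "wedge P Q \<noteq> 0" using T' by (rule conjunct1)
  have \<kappa>: "\<kappa> \<noteq> 0" using T' [THEN conjunct2] by (rule conjunct1)
  have on: "wedge (a x - c) Q * wedge P (a x - c) = \<kappa>" if "x \<in> carrier G - H" "a \<in> {a1, a2, a3}" for x a
    using bspec [OF T' [THEN conjunct2, THEN conjunct2] that(1)] that(2) by (rule bspec)
  have onS: "lin l0 (r R) = 1 \<and> wedge (aff (r R) - c) Q * wedge P (aff (r R) - c) = \<kappa>" if R: "R \<in> S" "R \<notin> m" for R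
  proof -
    obtain x \<alpha> where x: "x \<in> carrier G - H" "(\<alpha>, \<lambda>x. aff (r (\<alpha> x))) \<in> {(\<alpha>1, a1), (\<alpha>2, a2), (\<alpha>3, a3)}" "R = \<alpha> x" "lin l0 (r R) = 1"
      by (rule S_cases [OF R])
    then show ?thesis using on [OF x(1), of "\<lambda>x. aff (r (\<alpha> x))"] by auto
  qed
  show "\<not> line_of_length \<Lambda>1 \<Lambda>2 \<Lambda>3 l 3"
  proof
    assume l: "line_of_length \<Lambda>1 \<Lambda>2 \<Lambda>3 l 3"
    note c9 = card_line_of_length_3 [OF l]
    have "l \<noteq> m" using l long by (auto simp: line_of_length_def)
    then have lm: "finite (l \<inter> m)" "card (l \<inter> m) \<le> 1" using card_two_lines [OF c9(2) m_line] by blast+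
    \<comment> \<open>At most one of the nine points lies on \<open>m\<close>. The others are on the
      conic, and three of them already give a contradiction.\<close>
    have "card (l \<inter> S) \<le> card ((l \<inter> S - m) \<union> (l \<inter> m))"
      by (rule card_mono) (use lm fin_\<Lambda> in auto)
    also have "\<dots> \<le> card (l \<inter> S - m) + card (l \<inter> m)" by (rule card_Un_le)
    finally have "3 \<le> card (l \<inter> S - m)" using c9(1) lm(2) by linarith
    then obtain B where B: "B \<subseteq> l \<inter> S - m" "card B = 3" using obtain_subset_with_card_n by metis
    then obtain R1 R2 R3 where R: "B = {R1, R2, R3}" "R1 \<noteq> R2" "R1 \<noteq> R3" "R2 \<noteq> R3" by (auto simp: card_3_iff)
    obtain k where k: "k \<noteq> 0" "l = kernel_line k" by (rule line_obtain_kernel [OF c9(2)])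
    obtain D e where De: "\<And>v. lin k v = wedge (aff v) D + e * lin l0 v" using lin_aff [of k] by blast
    have "R1 \<in> l \<inter> S - m" "R2 \<in> l \<inter> S - m" "R3 \<in> l \<inter> S - m"
      using B(1) unfolding R(1) by (simp_all only: insert_subset)
    then have mem: "R1 \<in> S" "R1 \<notin> m" "R1 \<in> l" "R2 \<in> S" "R2 \<notin> m" "R2 \<in> l" "R3 \<in> S" "R3 \<notin> m" "R3 \<in> l"
      by (simp_all only: Int_iff Diff_iff simp_thms)
    have pg: "R1 \<in> PG2" "R2 \<in> PG2" "R3 \<in> PG2" by (rule points_S, rule mem)+
    note o = onS [OF mem(1,2)] onS [OF mem(4,5)] onS [OF mem(7,8)]
    have "lin k (r R1) = 0" "lin k (r R2) = 0" "lin k (r R3) = 0"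
      using mem(3,6,9) on_line [OF pg(1)] on_line [OF pg(2)] on_line [OF pg(3)] unfolding k(2) by blast+
    then have E: "wedge (aff (r R1)) D + e = 0" "wedge (aff (r R2)) D + e = 0" "wedge (aff (r R3)) D + e = 0"
      using o unfolding De by simp_all
    have D0: "D \<noteq> 0"
    proof
      assume "D = 0"
      then have "lin k v = 0" for v using E(1) De by simp
      then show False using lin_eq_0 k(1) by blast
    qed
    have ne: "aff (r R1) \<noteq> aff (r R2)" "aff (r R1) \<noteq> aff (r R3)" "aff (r R2) \<noteq> aff (r R3)"
      using affine_injective [OF pg(1,2)] affine_injective [OF pg(1,3)] affine_injective [OF pg(2,3)] o R(2-4) by auto
    show False
    proof (rule conic_no_three_collinear [where c = c, OF PQ \<kappa> D0 _ _ ne])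
      have e: "wedge (aff (r R1)) D = - e" "wedge (aff (r R2)) D = - e" "wedge (aff (r R3)) D = - e"
        using E by (simp_all add: eq_neg_iff_add_eq_0)
      show "wedge (aff (r R2) - aff (r R1)) D = 0" "wedge (aff (r R3) - aff (r R1)) D = 0"
        by (simp_all add: wedge_distribs e)
    qed (use o in simp_all)
  qed
  have PQ0: "- P \<noteq> 0" "Q \<noteq> 0" using PQ by auto
  obtain lU where lU: "\<And>v. lin lU v = wedge (aff v - lin l0 v *s c) Q" "lU \<noteq> 0" using line_through PQ0 by metis
  obtain lV where lV: "\<And>v. lin lV v = wedge (aff v - lin l0 v *s c) (- P)" "lV \<noteq> 0" using line_through PQ0 by metis
  have lV': "lin lV v = wedge P (aff v - lin l0 v *s c)" for v
    using lV(1) [of v] wedge_swap [of P "aff v - lin l0 v *s c"] by simp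
  \<comment> \<open>The equation of the hyperbola, made homogeneous by the square of
    \<open>l0\<close>.\<close>
  define C where "C = linear_form lU * linear_form lV + Poly_Mapping.single 0 (- \<kappa>) * (linear_form l0 * linear_form l0)"
  have evC: "eval3 C v = lin lU v * lin lV v - \<kappa> * (lin l0 v)\<^sup>2" for v
    by (simp add: C_def eval3_add eval3_mult eval3_single eval3_linear_form power2_eq_square)
  obtain v1 where v1: "aff v1 = P" "lin l0 v1 = 0" using aff_surj by blast
  obtain v2 where v2: "aff v2 = Q" "lin l0 v2 = 0" using aff_surj by blast
  obtain v3 where v3: "aff v3 = c" "lin l0 v3 = 1" using aff_surj by blast
  have C3: "eval3 C v3 = - \<kappa>" by (simp add: evC lU(1) v3)
  then have C0: "C \<noteq> 0" using \<kappa> by (auto simp: eval3_def)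
  have formC: "form3 2 C"
  proof -
    have "form3 (1 + 1) (linear_form lU * linear_form lV)"
      by (intro form3_mult form3_linear_form lU(2) lV(2))
    moreover have "form3 (0 + (1 + 1)) (Poly_Mapping.single 0 (- \<kappa>) * (linear_form l0 * linear_form l0))"
      by (intro form3_mult form3_linear_form form3_single_0 l0) (use \<kappa> in simp)
    ultimately show ?thesis using C0 unfolding C_def by (intro form3_add) (simp_all add: numeral_2_eq_2)
  qed
  have irr: "irreducible C"
  proof (rule irreducible_quadratic_form [OF formC])
    fix p q
    show "\<exists>v. eval3 C v \<noteq> lin p v * lin q v"
    proof (rule ccontr)
      assume "\<not> ?thesis"
      then have eq: "lin p v * lin q v = lin lU v * lin lV v - \<kappa> * (lin l0 v)\<^sup>2" for v using evC by metis
      \<comment> \<open>A product of two linear forms is tested on the frame \<open>v1\<close>,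
        \<open>v2\<close>, \<open>v3\<close>. The values at \<open>v1\<close>, \<open>v3\<close> and
        \<open>v1 + v3\<close> force both factors to vanish at \<open>v1\<close>, which contradicts
        the mixed value at \<open>v1 + v2\<close>.\<close>
      have U: "lin lU v1 = wedge P Q" "lin lU v2 = 0" "lin lU v3 = 0" and V: "lin lV v1 = 0" "lin lV v2 = wedge P Q" "lin lV v3 = 0"
        by (simp_all add: lU(1) lV' v1 v2 v3)
      have 1: "lin p v1 * lin q v1 = 0" using eq [of v1] by (simp add: U V v1)
      have 2: "lin p v2 * lin q v2 = 0" using eq [of v2] by (simp add: U V v2)
      have 3: "lin p v3 * lin q v3 = - \<kappa>" using eq [of v3] by (simp add: U V v3)
      have 12: "lin p v1 * lin q v2 + lin p v2 * lin q v1 = (wedge P Q)\<^sup>2"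
        using eq [of "v1 + v2"] 1 2 by (simp add: U V v1 v2 algebra_simps power2_eq_square)
      have 13: "lin p v1 * lin q v3 + lin p v3 * lin q v1 = 0"
        using eq [of "v1 + v3"] 1 3 by (simp add: U V v1 v3 algebra_simps power2_eq_square)
      have "lin p v1 = 0 \<and> lin q v1 = 0" using 1 3 13 \<kappa> by auto
      then show False using 12 PQ by simp
    qed
  qed
  show "conic_line_type S"
    unfolding conic_line_type_def
  proof (intro exI conjI)
    show "form3 2 C" by (rule formC)
    show "irreducible C" by (rule irr)
    show l: "form3 1 (linear_form l0)" by (rule form3_linear_form [OF l0])
    show "form3 3 (C * linear_form l0)" using form3_mult [OF formC l] by simp
    show "S \<subseteq> curve (C * linear_form l0)"
    proof
      fix R assume R: "R \<in> S"
      show "R \<in> curve (C * linear_form l0)"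
      proof (cases "R \<in> m")
        case True
        then show ?thesis using curve_mult [of C "linear_form l0"] unfolding curve_linear_form by blast
      next
        case False
        note o = onS [OF R False]
        have "eval3 C v = 0" if v: "v \<in> R" for v
        proof -
          have span: "R = vec.span {r R}" using r [OF points_S [OF R]] by (elim conjE)
          have "v \<in> vec.span {r R}" using v by (subst (asm) span)
          then obtain k where k: "v = k *s r R" unfolding vec.span_singleton by blast
          have lv: "lin l0 v = k" using o by (simp add: k)
          have av: "aff v - k *s c = k *s (aff (r R) - c)"
            by (simp add: k aff_scale vec.scale_right_diff_distrib)
          have "eval3 C v = k\<^sup>2 * (wedge (aff (r R) - c) Q * wedge P (aff (r R) - c) - \<kappa>)"
            unfolding evC lU(1) lV' lv av wedge_simps by (simp add: power2_eq_square algebra_simps)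
          then show ?thesis using o by simp
        qed
        then have "R \<in> curve C" using points_S [OF R] by (simp add: curve_def)
        then show ?thesis using curve_mult by blast
      qed
    qed
  qed (rule refl)
qed

text \<open>The dichotomy is whether \<open>m\<close> contains all points. If not, one of the three
  types holds, and each configuration excludes lines of length 3. Alternatives (i) and (iii) are
  separated by noncollinearity, because the types alone are containment conditions.\<close>

lemma trichotomy:
  "exactly_one (collinear_points S) (\<exists>l. line_of_length \<Lambda>1 \<Lambda>2 \<Lambda>3 l 3)
    (\<not> collinear_points S \<and> (triangular S \<or> tetrahedron_type S \<or> conic_line_type S))"
proof (cases "H = carrier G")
  case True
  then have "collinear_points S" using all_on_m m_line by (auto simp: collinear_points_def)
  then show ?thesis using no_short_line_collinear [OF True] by (simp add: exactly_one_def)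
next
  case False
  note nc = not_collinear [OF False]
  consider c D D' where "affine_multinet.triangle_shape G H a1 a2 a3 c D D'"
    | c D1 D2 D3 where "affine_multinet.tetrahedron_shape G H a1 a2 a3 c D1 D2 D3"
    | c P Q \<kappa> where "affine_multinet.conic_shape G H a1 a2 a3 c P Q \<kappa>"
    using affine_multinet.affine_classification [OF affine False] by blast
  then have "(triangular S \<or> tetrahedron_type S \<or> conic_line_type S) \<and> (\<forall>l. \<not> line_of_length \<Lambda>1 \<Lambda>2 \<Lambda>3 l 3)"
  proof cases
    case 1
    show ?thesis using triangle_case [OF 1] by simp
  next
    case 2
    show ?thesis using tetrahedron_case [OF 2 False] by simp
  next
    case 3
    show ?thesis using conic_case [OF 3] by simp
  qed
  then show ?thesis using nc by (simp add: exactly_one_def)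
qed

end

theorem theorem1p1:
  fixes G :: "('g, 'm) monoid_scheme"
    and n :: nat
    and \<alpha>\<^sub>1 \<alpha>\<^sub>2 \<alpha>\<^sub>3 :: "'g \<Rightarrow> ('k::alg_closed_field ^ 3) set"
    and \<Lambda>\<^sub>1 \<Lambda>\<^sub>2 \<Lambda>\<^sub>3 :: "('k ^ 3) set set"
  assumes "group G" and "finite (carrier G)" and "card (carrier G) = n"
    and "CHAR('k) = 0 \<or> CHAR('k) > n"
    and "light_dual_multinet G \<alpha>\<^sub>1 \<alpha>\<^sub>2 \<alpha>\<^sub>3"
    and "\<Lambda>\<^sub>1 = \<alpha>\<^sub>1 ` carrier G" and "\<Lambda>\<^sub>2 = \<alpha>\<^sub>2 ` carrier G" and "\<Lambda>\<^sub>3 = \<alpha>\<^sub>3 ` carrier G"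
    and "\<exists>m l. line_of_length \<Lambda>\<^sub>1 \<Lambda>\<^sub>2 \<Lambda>\<^sub>3 m l \<and> l \<ge> 9"
  shows "exactly_one
    (collinear_points (\<Lambda>\<^sub>1 \<union> \<Lambda>\<^sub>2 \<union> \<Lambda>\<^sub>3))
    (\<exists>m. line_of_length \<Lambda>\<^sub>1 \<Lambda>\<^sub>2 \<Lambda>\<^sub>3 m 3)
    (\<not> collinear_points (\<Lambda>\<^sub>1 \<union> \<Lambda>\<^sub>2 \<union> \<Lambda>\<^sub>3) \<and>
      (triangular (\<Lambda>\<^sub>1 \<union> \<Lambda>\<^sub>2 \<union> \<Lambda>\<^sub>3) \<or> tetrahedron_type (\<Lambda>\<^sub>1 \<union> \<Lambda>\<^sub>2 \<union> \<Lambda>\<^sub>3) \<or>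
        conic_line_type (\<Lambda>\<^sub>1 \<union> \<Lambda>\<^sub>2 \<union> \<Lambda>\<^sub>3)))"
proof -
  interpret group G by (rule assms(1))
  obtain m l where ml: "line_of_length \<Lambda>\<^sub>1 \<Lambda>\<^sub>2 \<Lambda>\<^sub>3 m l" "l \<ge> 9" using assms(9) by blast
  then have m: "m \<in> PG2_lines" "m \<inter> \<Lambda>\<^sub>1 \<noteq> {}" "m \<inter> \<Lambda>\<^sub>2 \<noteq> {}" "card (m \<inter> \<Lambda>\<^sub>1) \<ge> 9"
    by (auto simp: line_of_length_def line_of_multinet_def)
  obtain a b where a: "a \<in> carrier G" "\<alpha>\<^sub>1 a \<in> m" and b: "b \<in> carrier G" "\<alpha>\<^sub>2 b \<in> m"
    using m(2,3) assms(6,7) by blast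
  obtain l0 where l0: "l0 \<noteq> 0" "m = kernel_line l0" by (rule line_obtain_kernel [OF m(1)])
  obtain aff :: "'k ^ 3 \<Rightarrow> 'k ^ 2" where aff:
    "\<And>u v. aff (u + v) = aff u + aff v" "\<And>c v. aff (c *s v) = c *s aff v"
    "\<And>v. aff v = 0 \<Longrightarrow> lin l0 v = 0 \<Longrightarrow> v = 0"
    "\<And>a s. \<exists>v. aff v = a \<and> lin l0 v = s"
    "\<And>D e. \<exists>l. \<forall>v. lin l v = wedge (aff v) D + e * lin l0 v"
    "\<And>l. \<exists>D e. \<forall>v. lin l v = wedge (aff v) D + e * lin l0 v"
    by (rule affine_chart [OF l0(1)]) blast
  \<comment> \<open>Representatives off the line are rescaled so that \<open>l0\<close> takes the
    value 1, which makes \<open>aff\<close> of them the affine position.\<close>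
  have "\<exists>v. P \<in> PG2 \<longrightarrow> v \<noteq> 0 \<and> P = vec.span {v} \<and> (lin l0 v = 0 \<or> lin l0 v = 1)" for P
  proof (cases "P \<in> PG2")
    case True
    then obtain v where v: "v \<noteq> 0" "P = vec.span {v}" by (auto simp: PG2_iff)
    show ?thesis
    proof (cases "lin l0 v = 0")
      case False
      let ?w = "(1 / lin l0 v) *s v"
      have "?w \<noteq> 0" using v False by simp
      moreover have "P = vec.span {?w}" using span_eq_iff_scale [OF v(1) \<open>?w \<noteq> 0\<close>] v(2) by blast
      moreover have "lin l0 ?w = 1" using False by simp
      ultimately show ?thesis by blast
    qed (use v in blast)
  qed simp
  then obtain r where r: "\<And>P. P \<in> PG2 \<Longrightarrow> r P \<noteq> 0 \<and> P = vec.span {r P} \<and> (lin l0 (r P) = 0 \<or> lin l0 (r P) = 1)"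
    by metis
  have L: "bij_betw (\<lambda>x. a \<otimes>\<^bsub>G\<^esub> x) (carrier G) (carrier G)"
    by (rule bij_betw_byWitness [where f' = "\<lambda>x. inv\<^bsub>G\<^esub> a \<otimes>\<^bsub>G\<^esub> x"]) (use a in \<open>auto simp: cancel_assoc\<close>)
  have R: "bij_betw (\<lambda>x. x \<otimes>\<^bsub>G\<^esub> b) (carrier G) (carrier G)"
    by (rule bij_betw_byWitness [where f' = "\<lambda>x. x \<otimes>\<^bsub>G\<^esub> inv\<^bsub>G\<^esub> b"]) (use b in \<open>auto simp: m_assoc\<close>)
  have LR: "bij_betw (\<lambda>x. a \<otimes>\<^bsub>G\<^esub> x \<otimes>\<^bsub>G\<^esub> b) (carrier G) (carrier G)"
    using bij_betw_trans [OF L R] by (simp add: comp_def)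
  have img: "(\<lambda>x. \<alpha> (f x)) ` carrier G = \<alpha> ` carrier G" if "bij_betw f (carrier G) (carrier G)" for f and \<alpha> :: "'g \<Rightarrow> ('k ^ 3) set"
    using that by (metis bij_betw_imp_surj_on image_image)
  have inj: "inj_on (\<lambda>x. \<alpha> (f x)) (carrier G)" if "bij_betw f (carrier G) (carrier G)" "inj_on \<alpha> (carrier G)"
    for f and \<alpha> :: "'g \<Rightarrow> ('k ^ 3) set"
    using comp_inj_on [of f "carrier G" \<alpha>] that by (simp add: bij_betw_def comp_def)
  have dm: "\<alpha>\<^sub>1 ` carrier G \<subseteq> PG2" "\<alpha>\<^sub>2 ` carrier G \<subseteq> PG2" "\<alpha>\<^sub>3 ` carrier G \<subseteq> PG2"
    "\<And>x y. x \<in> carrier G \<Longrightarrow> y \<in> carrier G \<Longrightarrow> collinear_points {\<alpha>\<^sub>1 x, \<alpha>\<^sub>2 y, \<alpha>\<^sub>3 (x \<otimes>\<^bsub>G\<^esub> y)}"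
    "\<alpha>\<^sub>1 ` carrier G \<inter> \<alpha>\<^sub>2 ` carrier G = {}" "\<alpha>\<^sub>1 ` carrier G \<inter> \<alpha>\<^sub>3 ` carrier G = {}" "\<alpha>\<^sub>2 ` carrier G \<inter> \<alpha>\<^sub>3 ` carrier G = {}"
    "inj_on \<alpha>\<^sub>1 (carrier G)" "inj_on \<alpha>\<^sub>2 (carrier G)" "inj_on \<alpha>\<^sub>3 (carrier G)"
    using assms(5) unfolding light_dual_multinet_def dual_multinet_def by simp_all
  \<comment> \<open>The relabeling moves the indices \<open>a\<close> and \<open>b\<close> of two
    points on the long line to the identity. It is compatible with the product and leaves the three
    components unchanged as sets.\<close>
  have "plane_multinet G (\<lambda>x. \<alpha>\<^sub>1 (a \<otimes>\<^bsub>G\<^esub> x)) (\<lambda>x. \<alpha>\<^sub>2 (x \<otimes>\<^bsub>G\<^esub> b)) (\<lambda>x. \<alpha>\<^sub>3 (a \<otimes>\<^bsub>G\<^esub> x \<otimes>\<^bsub>G\<^esub> b)) l0 aff r"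
  proof (intro plane_multinet.intro plane_multinet_axioms.intro group_axioms)
    let ?a1 = "\<lambda>x. \<alpha>\<^sub>1 (a \<otimes>\<^bsub>G\<^esub> x)" and ?a2 = "\<lambda>x. \<alpha>\<^sub>2 (x \<otimes>\<^bsub>G\<^esub> b)"
      and ?a3 = "\<lambda>x. \<alpha>\<^sub>3 (a \<otimes>\<^bsub>G\<^esub> x \<otimes>\<^bsub>G\<^esub> b)"
    show "finite (carrier G)" by (rule assms(2))
    show "inj_on ?a1 (carrier G)" "inj_on ?a2 (carrier G)" "inj_on ?a3 (carrier G)"
      by (rule inj [OF L dm(8)], rule inj [OF R dm(9)], rule inj [OF LR dm(10)])
    show "?a1 ` carrier G \<inter> ?a2 ` carrier G = {}" "?a1 ` carrier G \<inter> ?a3 ` carrier G = {}"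
      "?a2 ` carrier G \<inter> ?a3 ` carrier G = {}"
      unfolding img [OF L] img [OF R] img [OF LR] by (rule dm)+
    show "of_nat j \<noteq> (0::'k)" if "0 < j" "j \<le> card (carrier G)" for j
    proof
      assume "of_nat j = (0::'k)"
      then have "CHAR('k) dvd j" by (simp add: of_nat_eq_0_iff_char_dvd)
      then have "CHAR('k) \<le> j" "CHAR('k) \<noteq> 0" using that(1) by (auto dest: dvd_imp_le)
      then show False using assms(3,4) that(2) by linarith
    qed
    show "\<alpha>\<^sub>1 (a \<otimes>\<^bsub>G\<^esub> x) \<in> PG2" "\<alpha>\<^sub>2 (x \<otimes>\<^bsub>G\<^esub> b) \<in> PG2" "\<alpha>\<^sub>3 (a \<otimes>\<^bsub>G\<^esub> x \<otimes>\<^bsub>G\<^esub> b) \<in> PG2" if "x \<in> carrier G" for x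
      using that dm(1-3) a b by (auto simp: image_subset_iff)
    show "collinear_points {\<alpha>\<^sub>1 (a \<otimes>\<^bsub>G\<^esub> x), \<alpha>\<^sub>2 (y \<otimes>\<^bsub>G\<^esub> b), \<alpha>\<^sub>3 (a \<otimes>\<^bsub>G\<^esub> (x \<otimes>\<^bsub>G\<^esub> y) \<otimes>\<^bsub>G\<^esub> b)}" if "x \<in> carrier G" "y \<in> carrier G" for x y
      using dm(4) [of "a \<otimes>\<^bsub>G\<^esub> x" "y \<otimes>\<^bsub>G\<^esub> b"] that a b by (simp add: m_assoc)
    show "\<alpha>\<^sub>1 (a \<otimes>\<^bsub>G\<^esub> \<one>\<^bsub>G\<^esub>) \<in> kernel_line l0" "\<alpha>\<^sub>2 (\<one>\<^bsub>G\<^esub> \<otimes>\<^bsub>G\<^esub> b) \<in> kernel_line l0" using a b l0(2) by simp_all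
    show "9 \<le> card (kernel_line l0 \<inter> ?a1 ` carrier G)"
      unfolding img [OF L] using m(4) l0(2) assms(6) by simp
  qed (rule l0(1) aff(1,2,4-6) | erule (1) aff(3) | erule r)+
  from plane_multinet.trichotomy [OF this] show ?thesis
    unfolding img [OF L] img [OF R] img [OF LR] assms(6-8) .
qed

end
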